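(* Let $X$ be a closed, connected smooth manifold and let $\phi\colon X\to X$ be a diffeomorphism of prime period $p$ (meaning $\phi^p=\mathrm{Id}_X$). Let $M=M_\phi=([0,1]\times X)/\big((1,x)\sim(0,\phi(x))\big)$ be the mapping torus of $\phi$. If the fixed-point set $X^\phi=\{x\in X\mid\phi(x)=x\}$ is path-connected, then \[ \mathsf{TC}(M)\leq 2\dim M. \]
   Context: For a path-connected space $X$, let $\mathscr{P}X=\{\gamma\colon [0,1]\to X\}$ be the space of continuous paths in $X$ with the compact-open topology, and let $\pi\colon\mathscr{P}X\to X\times X$, $\pi(\gamma)=(\gamma(0),\gamma(1))$. The topological complexity $\mathsf{TC}(X)$ is the smallest integer $k$ such that $X\times X$ can be covered by $k$ open sets $U_1,\dots,U_k$, each admitting a continuous map $s_i\colon U_i\to\mathscr{P}X$ with $\pi\circ s_i$ equal to the inclusion $U_i\hookrightarrow X\times X$; it is $\infty$ if no such integer exists (not reduced: $\mathsf{TC}(\text{point})=1$). *)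

theory Defs
  imports "HOL-Analysis.Analysis" "HOL-Homology.Homology" "HOL-Computational_Algebra.Primes"
begin

section \<open>Smooth manifolds\<close>

text \<open>
  \<open>Euclidean_space n\<close> is the library's $\mathbb{R}^n$ carried by the functions
  \<^typ>\<open>nat \<Rightarrow> real\<close> that vanish from index \<open>n\<close> on; this keeps the dimension an arbitrary
  natural number, including \<open>0\<close>.  Below, \<open>W\<close> is meant to be open in \<open>Euclidean_space n\<close>, and
  \<open>(\<lambda>t. f (x(i := t)))\<close> at \<open>x i\<close> gives the \<open>i\<close>-th partial derivative of \<open>f\<close> at \<open>x\<close>.
\<close>

fun Ck_on :: "nat \<Rightarrow> nat \<Rightarrow> (nat \<Rightarrow> real) set \<Rightarrow> ((nat \<Rightarrow> real) \<Rightarrow> real) \<Rightarrow> bool" where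
  "Ck_on n 0 W f \<longleftrightarrow> continuous_map (subtopology (Euclidean_space n) W) euclideanreal f"
| "Ck_on n (Suc k) W f \<longleftrightarrow>
     continuous_map (subtopology (Euclidean_space n) W) euclideanreal f \<and>
     (\<forall>i<n. \<exists>g. (\<forall>x\<in>W. ((\<lambda>t. f (x(i := t))) has_real_derivative g x) (at (x i))) \<and>
                Ck_on n k W g)"

definition smooth_fun_on :: "nat \<Rightarrow> (nat \<Rightarrow> real) set \<Rightarrow> ((nat \<Rightarrow> real) \<Rightarrow> real) \<Rightarrow> bool" where
  "smooth_fun_on n W f \<longleftrightarrow> (\<forall>k. Ck_on n k W f)"

definition chart :: "nat \<Rightarrow> 'a topology \<Rightarrow> 'a set \<times> ('a \<Rightarrow> nat \<Rightarrow> real) \<Rightarrow> bool" where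
  "chart n X = (\<lambda>(U, h). openin X U \<and> openin (Euclidean_space n) (h ` U) \<and>
     homeomorphic_map (subtopology X U) (subtopology (Euclidean_space n) (h ` U)) h)"

definition topological_manifold :: "nat \<Rightarrow> 'a topology \<Rightarrow> bool" where
  "topological_manifold n X \<longleftrightarrow> Hausdorff_space X \<and> second_countable X \<and>
     (\<forall>x\<in>topspace X. \<exists>U h. x \<in> U \<and> chart n X (U, h))"

definition smooth_map ::
  "nat \<Rightarrow> 'a topology \<Rightarrow> ('a set \<times> ('a \<Rightarrow> nat \<Rightarrow> real)) set \<Rightarrow>
   nat \<Rightarrow> 'b topology \<Rightarrow> ('b set \<times> ('b \<Rightarrow> nat \<Rightarrow> real)) set \<Rightarrow> ('a \<Rightarrow> 'b) \<Rightarrow> bool" where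
  "smooth_map m X A n Y B f \<longleftrightarrow> continuous_map X Y f \<and>
     (\<forall>(U, h)\<in>A. \<forall>(V, k)\<in>B. \<forall>i<n.
        smooth_fun_on m (h ` (U \<inter> f -` V)) (\<lambda>x. k (f (inv_into U h x)) i))"

text \<open>
  The atlas is not required to be maximal.  The clause \<open>smooth_map \<dots> id\<close> says exactly that the
  transition map between any two charts of \<open>A\<close> is smooth (in both directions, since the pair of
  charts is arbitrary).  Charts map onto open subsets of $\mathbb{R}^n$, so there is no boundary.
\<close>

definition smooth_manifold ::
  "nat \<Rightarrow> 'a topology \<Rightarrow> ('a set \<times> ('a \<Rightarrow> nat \<Rightarrow> real)) set \<Rightarrow> bool" where
  "smooth_manifold n X A \<longleftrightarrow> topological_manifold n X \<and>
     (\<forall>c\<in>A. chart n X c) \<and> (\<Union>(U, h)\<in>A. U) = topspace X \<and> smooth_map n X A n X A id"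

definition closed_smooth_manifold ::
  "nat \<Rightarrow> 'a topology \<Rightarrow> ('a set \<times> ('a \<Rightarrow> nat \<Rightarrow> real)) set \<Rightarrow> bool" where
  "closed_smooth_manifold n X A \<longleftrightarrow> smooth_manifold n X A \<and> compact_space X"

definition diffeomorphism ::
  "nat \<Rightarrow> 'a topology \<Rightarrow> ('a set \<times> ('a \<Rightarrow> nat \<Rightarrow> real)) set \<Rightarrow>
   nat \<Rightarrow> 'b topology \<Rightarrow> ('b set \<times> ('b \<Rightarrow> nat \<Rightarrow> real)) set \<Rightarrow> ('a \<Rightarrow> 'b) \<Rightarrow> bool" where
  "diffeomorphism m X A n Y B f \<longleftrightarrow> smooth_map m X A n Y B f \<and>
     (\<exists>g. smooth_map n Y B m X A g \<and>
          (\<forall>x\<in>topspace X. g (f x) = x) \<and> (\<forall>y\<in>topspace Y. f (g y) = y))"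

definition manifold_dim :: "'a topology \<Rightarrow> nat" where
  "manifold_dim X = (THE n. topological_manifold n X)"

lemma topological_manifold_dim_le:
  assumes "topological_manifold m X" "topological_manifold n X" "topspace X \<noteq> {}"
  shows "n \<le> m"
proof (rule ccontr)
  assume "\<not> n \<le> m"
  then have mn: "m < n" by simp
  obtain x where "x \<in> topspace X" using assms(3) by blast
  then obtain U h V k where x: "x \<in> U" "x \<in> V" and "chart m X (U, h)" "chart n X (V, k)"
    using assms(1,2) unfolding topological_manifold_def by meson
  then have oU: "openin X U" and oV: "openin X V"
    and oh: "openin (Euclidean_space m) (h ` U)" and ok: "openin (Euclidean_space n) (k ` V)"
    and hh: "homeomorphic_map (subtopology X U) (subtopology (Euclidean_space m) (h ` U)) h"
    and hk: "homeomorphic_map (subtopology X V) (subtopology (Euclidean_space n) (k ` V)) k"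
    by (auto simp: chart_def)
  define W where "W = U \<inter> V"
  have tU: "topspace (subtopology X U) = U" and tV: "topspace (subtopology X V) = V"
    using oU oV openin_subset by (auto simp: topspace_subtopology_subset)
  have oW: "openin (subtopology X V) W"
    using oU by (auto simp: W_def openin_subtopology Int_commute)
  have "openin (subtopology (Euclidean_space n) (k ` V)) (k ` W)"
    using hk oW homeomorphic_map_openness[OF hk, of W] tV W_def by auto
  then have okW: "openin (Euclidean_space n) (k ` W)"
    using ok openin_trans_full by blast
  obtain k' where k': "homeomorphic_maps (subtopology X V) (subtopology (Euclidean_space n) (k ` V)) k k'"
    using hk homeomorphic_map_maps by blast
  have kk: "k' (k y) = y" if "y \<in> V" for y
    using k' that tV by (auto simp: homeomorphic_maps_def)
  have img: "k' ` k ` W = W"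
    using kk by (force simp: W_def image_iff)
  have "continuous_map (subtopology (Euclidean_space n) (k ` W)) X k'"
    using k' unfolding homeomorphic_maps_def
    by (metis W_def continuous_map_from_subtopology_mono continuous_map_in_subtopology
        image_mono inf.cobounded2)
  then have c1: "continuous_map (subtopology (Euclidean_space n) (k ` W)) (subtopology X U) k'"
    using img W_def by (auto simp: continuous_map_in_subtopology topspace_subtopology)
  have "continuous_map (subtopology X U) (Euclidean_space m) h"
    using hh homeomorphic_imp_continuous_map continuous_map_in_subtopology by blast
  then have c2: "continuous_map (subtopology (Euclidean_space n) (k ` W)) (Euclidean_space m) (h \<circ> k')"
    using c1 continuous_map_compose by blast
  have sub: "Euclidean_space m = subtopology (Euclidean_space n) {y. \<forall>i\<ge>m. y i = 0}"
    using mn unfolding Euclidean_space_def subtopology_subtopology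
    by (intro arg_cong[where f="subtopology _"]) auto
  have c3: "continuous_map (subtopology (Euclidean_space n) (k ` W)) (Euclidean_space n) (h \<circ> k')"
    using c2 unfolding sub by (simp only: continuous_map_in_subtopology)
  have injh: "inj_on h U"
    using hh homeomorphic_imp_injective_map tU by metis
  have inj: "inj_on (h \<circ> k') (k ` W)"
    by (rule comp_inj_on) (use injh img W_def kk in \<open>auto simp: inj_on_def\<close>)
  have op: "openin (Euclidean_space n) ((h \<circ> k') ` k ` W)"
    using invariance_of_domain_Euclidean_space[OF okW c3 inj] .
  have "(h \<circ> k') ` k ` W = h ` W"
    using img by (metis image_comp)
  with op have op: "openin (Euclidean_space n) (h ` W)" by simp
  have hW: "h ` W \<subseteq> {y. \<forall>i\<ge>m. y i = 0}"
    using openin_subset[OF oh] by (auto simp: W_def topspace_Euclidean_space)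
  define y where "y = h x"
  have y: "y \<in> h ` W" using x by (auto simp: y_def W_def)
  have "continuous_map euclideanreal euclideanreal (\<lambda>t. (y(m := t)) i)" for i
    by (cases "i = m") auto
  moreover have "y(m := t) \<in> {x. \<forall>i\<ge>n. x i = 0}" for t
    using y hW mn by auto
  ultimately have "continuous_map euclideanreal (Euclidean_space n) (\<lambda>t. y(m := t))"
    by (simp add: Euclidean_space_def continuous_map_in_subtopology continuous_map_componentwise_UNIV)
  then have "open {t. y(m := t) \<in> h ` W}"
    using op by (auto simp: continuous_map_def)
  moreover have "{t. y(m := t) \<in> h ` W} = {0}"
  proof -
    have "y m = 0" using y hW by auto
    then have "y(m := 0) = y" by auto
    moreover have "t = 0" if "y(m := t) \<in> h ` W" for t
    proof -
      have "(y(m := t)) m = 0" using hW that by blast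
      then show ?thesis by simp
    qed
    ultimately show ?thesis using y by auto
  qed
  ultimately show False
    using not_open_singleton[of "0::real"] by simp
qed

lemma manifold_dim_eq:
  assumes "topological_manifold n X" "topspace X \<noteq> {}"
  shows "manifold_dim X = n"
  unfolding manifold_dim_def
  by (rule the_equality) (use assms topological_manifold_dim_le in \<open>auto intro: antisym\<close>)

section \<open>Mapping torus\<close>

text \<open>The quotient topology on \<open>topspace X // R\<close>, for an equivalence relation \<open>R\<close> on \<open>topspace X\<close>.\<close>

definition quotient_topology :: "'a topology \<Rightarrow> ('a \<times> 'a) set \<Rightarrow> 'a set topology" where
  "quotient_topology X R = topology (\<lambda>W. W \<subseteq> topspace X // R \<and> openin X (\<Union>W))"

lemma openin_quotient_topology:
  assumes "equiv (topspace X) R"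
  shows "openin (quotient_topology X R) W \<longleftrightarrow> W \<subseteq> topspace X // R \<and> openin X (\<Union>W)"
proof -
  have int: "\<Union>(S \<inter> T) = \<Union>S \<inter> \<Union>T"
    if "S \<subseteq> topspace X // R" "T \<subseteq> topspace X // R" for S T
  proof
    show "\<Union>S \<inter> \<Union>T \<subseteq> \<Union>(S \<inter> T)"
    proof clarify
      fix x C D assume CD: "x \<in> C" "C \<in> S" "x \<in> D" "D \<in> T"
      then have "C = D \<or> C \<inter> D = {}"
        using that by (intro quotient_disj[OF assms]) auto
      then show "x \<in> \<Union>(S \<inter> T)" using CD by blast
    qed
  qed blast
  have "istopology (\<lambda>W. W \<subseteq> topspace X // R \<and> openin X (\<Union>W))"
    unfolding istopology_def
  proof (intro conjI allI impI)
    fix S T assume "S \<subseteq> topspace X // R \<and> openin X (\<Union>S)" "T \<subseteq> topspace X // R \<and> openin X (\<Union>T)"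
    then show "S \<inter> T \<subseteq> topspace X // R" "openin X (\<Union>(S \<inter> T))"
      using int[of S T] by (blast, metis openin_Int)
  next
    fix \<K> assume K: "\<forall>K\<in>\<K>. K \<subseteq> topspace X // R \<and> openin X (\<Union>K)"
    then show "\<Union>\<K> \<subseteq> topspace X // R" by blast
    have "\<Union>(\<Union>\<K>) = \<Union>(Union ` \<K>)" by blast
    then show "openin X (\<Union>(\<Union>\<K>))"
      using K by auto
  qed
  then show ?thesis
    by (simp add: quotient_topology_def)
qed

lemma quotient_map_quotient_topology:
  assumes "equiv (topspace X) R"
  shows "quotient_map X (quotient_topology X R) (\<lambda>x. R `` {x})"
proof -
  have Un: "\<Union>(topspace X // R) = topspace X"
    using assms by (simp add: Union_quotient)
  have top: "topspace (quotient_topology X R) = topspace X // R"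
    using openin_quotient_topology[OF assms] Un
    by (metis openin_subset openin_topspace subset_antisym subset_refl)
  have eq: "{x \<in> topspace X. R `` {x} \<in> W} = \<Union>W" if "W \<subseteq> topspace X // R" for W
  proof
    show "{x \<in> topspace X. R `` {x} \<in> W} \<subseteq> \<Union>W"
      using equiv_class_self[OF assms] by blast
    show "\<Union>W \<subseteq> {x \<in> topspace X. R `` {x} \<in> W}"
    proof clarify
      fix x C assume x: "x \<in> C" "C \<in> W"
      then have "C \<in> topspace X // R" using that by blast
      then obtain y where y: "y \<in> topspace X" "C = R `` {y}" by (auto elim: quotientE)
      with x have "(y, x) \<in> R" by blast
      then have "R `` {x} = C" "x \<in> topspace X"
        using y equiv_class_eq[OF assms] assms by (auto simp: equiv_def refl_on_def)
      with x show "x \<in> topspace X \<and> R `` {x} \<in> W" by simp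
    qed
  qed
  show ?thesis
    unfolding quotient_map_def top
  proof (intro conjI allI impI)
    show "(\<lambda>x. R `` {x}) ` topspace X = topspace X // R"
      by (auto simp: quotient_def)
    fix W assume W: "W \<subseteq> topspace X // R"
    show "openin X {x \<in> topspace X. R `` {x} \<in> W} = openin (quotient_topology X R) W"
      unfolding eq[OF W] openin_quotient_topology[OF assms] using W by blast
  qed
qed

definition mapping_torus_rel ::
  "'a topology \<Rightarrow> ('a \<Rightarrow> 'a) \<Rightarrow> ((real \<times> 'a) \<times> (real \<times> 'a)) set" where
  "mapping_torus_rel X \<phi> =
     {(a, b). a \<in> {0..1} \<times> topspace X \<and> b \<in> {0..1} \<times> topspace X \<and>
        equivclp (\<lambda>a b. \<exists>x\<in>topspace X. a = (1, x) \<and> b = (0, \<phi> x)) a b}"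

definition mapping_torus :: "'a topology \<Rightarrow> ('a \<Rightarrow> 'a) \<Rightarrow> (real \<times> 'a) set topology" where
  "mapping_torus X \<phi> =
     quotient_topology (prod_topology (top_of_set {0..1}) X) (mapping_torus_rel X \<phi>)"

lemma equiv_mapping_torus_rel: "equiv ({0..1} \<times> topspace X) (mapping_torus_rel X \<phi>)"
proof (rule equivI)
  show "mapping_torus_rel X \<phi> \<subseteq> ({0..1} \<times> topspace X) \<times> ({0..1} \<times> topspace X)"
    unfolding mapping_torus_rel_def by blast
  show "refl_on ({0..1} \<times> topspace X) (mapping_torus_rel X \<phi>)"
    unfolding mapping_torus_rel_def refl_on_def by simp
  show "sym (mapping_torus_rel X \<phi>)"
    unfolding mapping_torus_rel_def sym_def by (blast intro: equivclp_sym)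
  show "trans (mapping_torus_rel X \<phi>)"
    unfolding mapping_torus_rel_def trans_def by (blast intro: equivclp_trans)
qed

section \<open>Topological complexity\<close>

text \<open>
  Paths are represented by their extensional versions (constant \<open>undefined\<close> outside \<open>[0,1]\<close>), so
  that distinct elements are distinct maps on \<open>[0,1]\<close>.
\<close>

definition paths :: "'a topology \<Rightarrow> (real \<Rightarrow> 'a) set" where
  "paths X = {\<gamma> \<in> extensional {0..1}. pathin X \<gamma>}"

definition path_space :: "'a topology \<Rightarrow> (real \<Rightarrow> 'a) topology" where
  "path_space X = topology_generated_by
     {{\<gamma> \<in> paths X. \<gamma> ` K \<subseteq> U} |K U. compact K \<and> K \<subseteq> {0..1} \<and> openin X U}"

lemma topspace_path_space: "topspace (path_space X) = paths X"
proof -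
  have "paths X \<in> {{\<gamma> \<in> paths X. \<gamma> ` K \<subseteq> U} |K U. compact K \<and> K \<subseteq> {0..1} \<and> openin X U}"
    by (rule CollectI, rule exI[of _ "{}"], rule exI[of _ "{}"]) auto
  then show ?thesis
    unfolding path_space_def topology_generated_by_topspace by blast
qed

definition path_ends :: "(real \<Rightarrow> 'a) \<Rightarrow> 'a \<times> 'a" where
  "path_ends \<gamma> = (\<gamma> 0, \<gamma> 1)"

definition motion_planner_cover :: "'a topology \<Rightarrow> nat \<Rightarrow> bool" where
  "motion_planner_cover X k \<longleftrightarrow>
     (\<exists>U :: nat \<Rightarrow> ('a \<times> 'a) set.
        (\<Union>i<k. U i) = topspace (prod_topology X X) \<and>
        (\<forall>i<k. openin (prod_topology X X) (U i) \<and>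
           (\<exists>s. continuous_map (subtopology (prod_topology X X) (U i)) (path_space X) s \<and>
                (\<forall>z\<in>U i. path_ends (s z) = z))))"

text \<open>Non-reduced: a point has topological complexity \<open>1\<close>.  The infimum of the empty set is \<open>\<infinity>\<close>.\<close>

definition TC :: "'a topology \<Rightarrow> enat" where
  "TC X = Inf {enat k |k. motion_planner_cover X k}"

end

(*
  The mapping torus M carries the circle action of the suspension flow, and a motion planner is
  made equivariant for the diagonal action on M x M, so that only the 2n + 1 dimensions of the orbit
  space, n = dim X, contribute and 2n + 2 = 2 dim M open sets suffice.

  In the infinite cyclic cover R x X, a pair of points ((t, x), (u, y)) near a given orbit is joined
  by moving linearly from t to u while following a local planner from x to y. It descends to
  M provided that the local planner commutes with phi. Since p is prime, either phi fixes both
  base points or the cyclic group moves the pair freely. In the second case a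
  small neighbourhood imposes no condition; in the first, phi is linearised near each of the two
  fixed points, radial contractions are equivariant, and the two are connected by a path of
  fixed points.

  The orbit space has box-counting dimension at most 2n + 1 in a phi-invariant metric. It is covered
  by finitely many sublevel sets of Lipschitz functions whose thresholds can be chosen such that no
  point lies on 2n + 2 of their boundaries; the number of boundaries near which a point lies
  then sorts the sublevel sets into 2n + 2 families of disjoint open pieces.
*)

theory Submission
  imports Defs
begin

section \<open>Strict differentiability\<close>

text \<open>The product M x M has dimension 2n + 2, and dimension alone would allow 2n + 3 sets. One
  set is saved because domains and planners respect the diagonal flow, which translates both real
  coordinates of the cover by the same amount: only the difference of these coordinates is ever
  measured, and the linear motion commutes with the translation.

  The flow has extra stabilisers over pairs of fixed points, so the orbit space need not be a
  manifold and is never formed. Its dimension is used solely as a growth rate of covering numbers,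
  and the functions that carve the cover live on M x M and are constant along orbits.

  Equivariance explains the hypothesis on the fixed set: if \<open>\<phi>\<close> fixes both end
  points, a path that commutes with \<open>\<phi>\<close> consists of fixed points. Smoothness
  enters through first derivatives: they linearise \<open>\<phi>\<close> at a fixed point, and they
  make composition with powers of \<open>\<phi>\<close> preserve Lipschitz bounds in charts, so the
  metric can be averaged without losing the O(K^n) bound on pieces of diameter 1/K.\<close>

definition ebox :: "nat \<Rightarrow> (nat \<Rightarrow> real) \<Rightarrow> real \<Rightarrow> (nat \<Rightarrow> real) set" where
  "ebox n w d = {u \<in> topspace (Euclidean_space n). \<forall>i<n. \<bar>u i - w i\<bar> < d}"

text \<open>A seminorm on all sequences, a norm only on \<open>Euclidean_space n\<close>. With this
  choice the errors of n one-coordinate moves add up to a multiple of the norm without a factor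
  n.\<close>

definition l1 :: "nat \<Rightarrow> (nat \<Rightarrow> real) \<Rightarrow> real" where
  "l1 n x = (\<Sum>i<n. \<bar>x i\<bar>)"

lemma l1_nonneg [simp]: "0 \<le> l1 n x"
  by (simp add: l1_def sum_nonneg)

lemma l1_add_le: "l1 n (\<lambda>i. x i + y i) \<le> l1 n x + l1 n y"
  unfolding l1_def sum.distrib[symmetric] by (intro sum_mono abs_triangle_ineq)

lemma l1_scale: "l1 n (\<lambda>i. c * x i) = \<bar>c\<bar> * l1 n x"
  by (simp add: l1_def abs_mult sum_distrib_left)

lemma l1_commute: "l1 n (\<lambda>i. x i - y i) = l1 n (\<lambda>i. y i - x i)"
  by (simp add: l1_def abs_minus_commute)

lemma l1_component_le: "i < n \<Longrightarrow> \<bar>x i\<bar> \<le> l1 n x"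
  unfolding l1_def by (rule member_le_sum) auto

lemma l1_diff_eq_0_iff:
  assumes "u \<in> topspace (Euclidean_space n)" "v \<in> topspace (Euclidean_space n)"
  shows "l1 n (\<lambda>i. u i - v i) = 0 \<longleftrightarrow> u = v"
proof
  assume "l1 n (\<lambda>i. u i - v i) = 0"
  then have "\<forall>i<n. u i = v i"
    by (simp add: l1_def sum_nonneg_eq_0_iff)
  then show "u = v"
    using assms by (auto simp: topspace_Euclidean_space fun_eq_iff) (metis leI)
qed (simp add: l1_def)

lemma continuous_map_Euclidean_coordinate:
  "continuous_map (Euclidean_space n) euclideanreal (\<lambda>u. u i)"
  unfolding Euclidean_space_def
  by (intro continuous_map_from_subtopology continuous_map_product_projection) auto

lemma continuous_map_into_Euclidean_space:
  assumes "\<And>i. i < n \<Longrightarrow> continuous_map X euclideanreal (\<lambda>x. f x i)"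
    and "f \<in> topspace X \<rightarrow> topspace (Euclidean_space n)"
  shows "continuous_map X (Euclidean_space n) f"
proof (rule continuous_map_eq)
  show "continuous_map X (Euclidean_space n) (\<lambda>x i. if i < n then f x i else 0)"
    using assms(1) by (simp add: continuous_map_componentwise_Euclidean_space)
  show "(\<lambda>i. if i < n then f x i else 0) = f x" if "x \<in> topspace X" for x
    using assms(2) that by (auto simp: Pi_iff topspace_Euclidean_space fun_eq_iff)
qed

lemma ebox_subset: "ebox n w d \<subseteq> topspace (Euclidean_space n)"
  by (auto simp: ebox_def)

lemma ebox_mono: "d \<le> d' \<Longrightarrow> ebox n w d \<subseteq> ebox n w d'"
  by (force simp: ebox_def)

lemma centre_in_ebox: "w \<in> topspace (Euclidean_space n) \<Longrightarrow> 0 < d \<Longrightarrow> w \<in> ebox n w d"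
  by (simp add: ebox_def)

lemma openin_ebox: "openin (Euclidean_space n) (ebox n w d)"
proof -
  have "openin (Euclidean_space n) {u \<in> topspace (Euclidean_space n). u i \<in> {w i - d<..<w i + d}}" for i
    by (rule openin_continuous_map_preimage[OF continuous_map_Euclidean_coordinate]) auto
  moreover have "ebox n w d = topspace (Euclidean_space n) \<inter>
      (\<Inter>i<n. {u \<in> topspace (Euclidean_space n). u i \<in> {w i - d<..<w i + d}})"
    by (force simp: ebox_def abs_less_iff)
  ultimately show ?thesis
    by (cases "n = 0") (auto intro!: openin_INT)
qed

text \<open>The topology comes from the product of all coordinates. A basic open set constrains them
  separately, and those from n on are constant on \<open>Euclidean_space n\<close>, so only n radii
  have to be minimised.\<close>

lemma Euclidean_open_contains_ebox:
  assumes W: "openin (Euclidean_space n) W" and w: "w \<in> W"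
  obtains d where "0 < d" "ebox n w d \<subseteq> W"
proof -
  obtain T where T: "openin (powertop_real UNIV) T" "W = T \<inter> {x. \<forall>i\<ge>n. x i = 0}"
    using W by (auto simp: Euclidean_space_def openin_subtopology)
  then obtain B where B: "w \<in> PiE UNIV B" "\<And>i. open (B i)" "PiE UNIV B \<subseteq> T"
    using product_topology_open_contains_basis[OF T(1)] w by auto blast
  have "\<exists>e>0. \<forall>y. \<bar>y - w i\<bar> < e \<longrightarrow> y \<in> B i" for i
    using B(1) B(2)[of i] unfolding open_dist dist_real_def by (auto simp: PiE_iff)
  then obtain e where e: "\<And>i. 0 < e i" "\<And>i y. \<bar>y - w i\<bar> < e i \<Longrightarrow> y \<in> B i"
    by metis
  \<comment> \<open>The inserted 1 keeps the minimum meaningful for n = 0.\<close>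
  define d where "d = Min (insert 1 (e ` {..<n}))"
  have "0 < d" using e(1) by (auto simp: d_def)
  moreover have "ebox n w d \<subseteq> W"
  proof
    fix u assume u: "u \<in> ebox n w d"
    have "u i \<in> B i" for i
    proof (cases "i < n")
      case True
      then have "d \<le> e i" by (auto simp: d_def)
      with u True show ?thesis by (intro e(2)) (auto simp: ebox_def)
    next
      case False
      then have "u i = w i" using u w T(2) by (auto simp: ebox_def topspace_Euclidean_space)
      then show ?thesis using e(1)[of i] e(2)[of "u i" i] by simp
    qed
    then show "u \<in> W" using B(3) T(2) u by (auto simp: ebox_def topspace_Euclidean_space PiE_iff)
  qed
  ultimately show thesis by (rule that)
qed

text \<open>Strict differentiability is a two-point condition, so it yields injectivity and is
  stable under composition; \<open>C\<^sup>1\<close> functions have it by moving one coordinate at a time.\<close>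

lemma C1_strictly_differentiable:
  assumes W: "openin (Euclidean_space n) W" and w: "w \<in> W" and f: "Ck_on n 1 W f"
  obtains a where "\<And>e. 0 < e \<Longrightarrow> \<exists>d>0. ebox n w d \<subseteq> W \<and> (\<forall>u\<in>ebox n w d. \<forall>v\<in>ebox n w d.
     \<bar>f v - f u - (\<Sum>i<n. a i * (v i - u i))\<bar> \<le> e * l1 n (\<lambda>i. v i - u i))"
proof -
  have wE: "w \<in> topspace (Euclidean_space n)" using openin_subset[OF W] w by blast
  have "\<exists>g. (\<forall>x\<in>W. ((\<lambda>t. f (x(i := t))) has_real_derivative g x) (at (x i))) \<and>
      continuous_map (subtopology (Euclidean_space n) W) euclideanreal g" if "i < n" for i
    using f that by auto
  then obtain g where gd: "\<And>i x. i < n \<Longrightarrow> x \<in> W \<Longrightarrow> ((\<lambda>t. f (x(i := t))) has_real_derivative g i x) (at (x i))"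
    and gc: "\<And>i. i < n \<Longrightarrow> continuous_map (subtopology (Euclidean_space n) W) euclideanreal (g i)"
    by metis
  have tW: "topspace (subtopology (Euclidean_space n) W) = W"
    using openin_subset[OF W] by auto
  have main: "\<exists>d>0. ebox n w d \<subseteq> W \<and> (\<forall>u\<in>ebox n w d. \<forall>v\<in>ebox n w d.
     \<bar>f v - f u - (\<Sum>i<n. g i w * (v i - u i))\<bar> \<le> e * l1 n (\<lambda>i. v i - u i))" if e: "0 < e" for e
  proof -
    define V where "V = W \<inter> (\<Inter>i<n. {x \<in> W. g i x \<in> {g i w - e<..<g i w + e}})"
    have "openin (Euclidean_space n) {x \<in> W. g i x \<in> {g i w - e<..<g i w + e}}" if "i < n" for i
      using openin_trans_full[OF openin_continuous_map_preimage[OF gc[OF that], of "{g i w - e<..<g i w + e}"] W]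
      unfolding tW by auto
    then have "openin (Euclidean_space n) V"
      unfolding V_def using W by (cases "n = 0") (auto intro!: openin_INT openin_Int)
    moreover have "w \<in> V" using w e by (auto simp: V_def)
    ultimately obtain d where d: "0 < d" "ebox n w d \<subseteq> V"
      by (rule Euclidean_open_contains_ebox)
    have "\<bar>f v - f u - (\<Sum>i<n. g i w * (v i - u i))\<bar> \<le> e * l1 n (\<lambda>i. v i - u i)"
      if u: "u \<in> ebox n w d" and v: "v \<in> ebox n w d" for u v
    proof -
      \<comment> \<open>The route from u to v that replaces one coordinate after another. A box is a
        product, so the route stays inside it.\<close>
      define m where "m = (\<lambda>k i. if i < k then v i else u i)"
      have step: "\<bar>f (m (Suc k)) - f (m k) - g k w * (v k - u k)\<bar> \<le> e * \<bar>v k - u k\<bar>" if k: "k < n" for k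
      proof -
        let ?F = "\<lambda>t. f ((m k)(k := t))"
        have in_box: "(m k)(k := t) \<in> ebox n w d" if "t \<in> closed_segment (u k) (v k)" for t
        proof -
          have "\<bar>t - w k\<bar> < d"
            using that u v k by (auto simp: ebox_def closed_segment_eq_real_ivl split: if_splits) fastforce+
          then show ?thesis
            using u v k by (auto simp: ebox_def m_def topspace_Euclidean_space)
        qed
        have der: "(?F has_real_derivative g k ((m k)(k := t))) (at t)"
          if "t \<in> closed_segment (u k) (v k)" for t
        proof -
          have "(m k)(k := t) \<in> W" using in_box[OF that] d(2) by (auto simp: V_def)
          from gd[OF k this] show ?thesis by simp
        qed
        have ebd: "\<bar>g k ((m k)(k := t)) - g k w\<bar> \<le> e" if "t \<in> closed_segment (u k) (v k)" for t
        proof -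
          have "(m k)(k := t) \<in> V" using in_box[OF that] d(2) by auto
          then show ?thesis using k unfolding V_def by (simp add: abs_le_iff) (smt (verit) lessThan_iff)
        qed
        \<comment> \<open>Mean value inequality for f minus its linear part in coordinate k: on the
          box the derivative of this difference is at most e in absolute value.\<close>
        have "norm ((\<lambda>t. ?F t - g k w * t) (v k) - (\<lambda>t. ?F t - g k w * t) (u k)) \<le> e * norm (v k - u k)"
        proof (rule field_differentiable_bound[of "closed_segment (u k) (v k)" _ "\<lambda>t. g k ((m k)(k := t)) - g k w"])
          fix t assume "t \<in> closed_segment (u k) (v k)"
          then show "((\<lambda>t. ?F t - g k w * t) has_field_derivative g k ((m k)(k := t)) - g k w)
            (at t within closed_segment (u k) (v k))"
            by (auto intro!: derivative_eq_intros der[THEN has_field_derivative_at_within])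
          show "norm (g k ((m k)(k := t)) - g k w) \<le> e"
            using ebd \<open>t \<in> _\<close> by simp
        qed auto
        moreover have "(m k)(k := v k) = m (Suc k)" "(m k)(k := u k) = m k"
          by (auto simp: m_def fun_eq_iff)
        ultimately show ?thesis by (simp add: algebra_simps)
      qed
      have "m n = v" "m 0 = u"
        using u v by (auto simp: m_def ebox_def topspace_Euclidean_space fun_eq_iff)
      then have "f v - f u - (\<Sum>i<n. g i w * (v i - u i)) =
          (\<Sum>k<n. (f (m (Suc k)) - f (m k)) - g k w * (v k - u k))"
        using sum_lessThan_telescope[of "\<lambda>k. f (m k)" n] by (simp add: sum_subtractf)
      also have "\<bar>\<dots>\<bar> \<le> (\<Sum>k<n. e * \<bar>v k - u k\<bar>)"
        by (rule order_trans[OF sum_abs]) (intro sum_mono step, simp)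
      finally show ?thesis by (simp add: l1_def sum_distrib_left)
    qed
    then show ?thesis using d by (auto simp: V_def)
  qed
  show thesis by (rule that[OF main])
qed


text \<open>Linearity is required on all sequences, so differences of points can be inserted without
  membership proofs. The norm bound and the last clause together make L depend on the first n
  coordinates alone.\<close>

definition bounded_linear_upto :: "nat \<Rightarrow> ((nat \<Rightarrow> real) \<Rightarrow> nat \<Rightarrow> real) \<Rightarrow> bool" where
  "bounded_linear_upto n L \<longleftrightarrow>
     (\<forall>x y. L (\<lambda>i. x i + y i) = (\<lambda>i. L x i + L y i)) \<and> (\<forall>c x. L (\<lambda>i. c * x i) = (\<lambda>i. c * L x i)) \<and>
     (\<exists>C\<ge>0. \<forall>x. l1 n (L x) \<le> C * l1 n x) \<and> (\<forall>x. L x \<in> topspace (Euclidean_space n))"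

lemma bounded_linear_uptoD:
  assumes "bounded_linear_upto n L"
  shows "L (\<lambda>i. x i + y i) = (\<lambda>i. L x i + L y i)" "L (\<lambda>i. c * x i) = (\<lambda>i. c * L x i)"
    "L x \<in> topspace (Euclidean_space n)" "\<exists>C\<ge>0. \<forall>x. l1 n (L x) \<le> C * l1 n x"
  using assms by (auto simp: bounded_linear_upto_def)

lemma bounded_linear_upto_diff:
  assumes "bounded_linear_upto n L"
  shows "L (\<lambda>i. x i - y i) = (\<lambda>i. L x i - L y i)"
  using bounded_linear_uptoD(1)[OF assms, of x "\<lambda>i. (-1) * y i"] bounded_linear_uptoD(2)[OF assms, of "-1" y]
  by simp

lemma bounded_linear_upto_sum:
  assumes "bounded_linear_upto n L"
  shows "L (\<lambda>i. \<Sum>j<(m::nat). x j i) = (\<lambda>i. \<Sum>j<m. L (x j) i)"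
proof (induction m)
  case 0
  show ?case using bounded_linear_uptoD(2)[OF assms, of 0 "\<lambda>_. 0"] by simp
qed (simp add: bounded_linear_uptoD(1)[OF assms])

lemma bounded_linear_upto_comp:
  assumes L: "bounded_linear_upto n L" and K: "bounded_linear_upto n K"
  shows "bounded_linear_upto n (K \<circ> L)"
proof -
  obtain C where C: "0 \<le> C" "\<And>x. l1 n (L x) \<le> C * l1 n x" using bounded_linear_uptoD(4)[OF L] by blast
  obtain D where D: "0 \<le> D" "\<And>x. l1 n (K x) \<le> D * l1 n x" using bounded_linear_uptoD(4)[OF K] by blast
  have "l1 n (K (L x)) \<le> (D * C) * l1 n x" for x
    using D(2)[of "L x"] mult_left_mono[OF C(2)[of x] D(1)] by (simp add: mult.assoc)
  then have "\<exists>B\<ge>0. \<forall>x. l1 n (K (L x)) \<le> B * l1 n x"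
    using C(1) D(1) by (intro exI[of _ "D * C"]) simp
  then show ?thesis
    by (simp add: bounded_linear_upto_def bounded_linear_uptoD(1-3)[OF L] bounded_linear_uptoD(1-3)[OF K])
qed

text \<open>Positive powers only: the identity keeps the coordinates from n on and so violates the
  last clause of \<open>bounded_linear_upto\<close>.\<close>

lemma bounded_linear_upto_funpow:
  assumes L: "bounded_linear_upto n L"
  shows "bounded_linear_upto n (L ^^ Suc j)"
  by (induction j) (use L bounded_linear_upto_comp in \<open>auto simp: o_def\<close>)

text \<open>Both points vary, unlike in the usual derivative. Values of f outside
  \<open>Euclidean_space n\<close> are not excluded here; results that need them inside assume this
  near w.\<close>

definition strict_deriv ::
  "nat \<Rightarrow> ((nat \<Rightarrow> real) \<Rightarrow> nat \<Rightarrow> real) \<Rightarrow> ((nat \<Rightarrow> real) \<Rightarrow> nat \<Rightarrow> real) \<Rightarrow> (nat \<Rightarrow> real) \<Rightarrow> bool" where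
  "strict_deriv n f L w \<longleftrightarrow> (\<forall>e>0. \<exists>d>0. \<forall>u\<in>ebox n w d. \<forall>v\<in>ebox n w d.
     l1 n (\<lambda>i. (f v i - f u i) - L (\<lambda>i. v i - u i) i) \<le> e * l1 n (\<lambda>i. v i - u i))"

lemma strict_derivD:
  assumes "strict_deriv n f L w" "0 < e"
  obtains d where "0 < d" "\<And>u v. u \<in> ebox n w d \<Longrightarrow> v \<in> ebox n w d \<Longrightarrow>
     l1 n (\<lambda>i. (f v i - f u i) - L (\<lambda>i. v i - u i) i) \<le> e * l1 n (\<lambda>i. v i - u i)"
  using assms unfolding strict_deriv_def by meson

lemma strict_deriv_Lipschitz:
  assumes L: "bounded_linear_upto n L" and f: "strict_deriv n f L w"
  obtains B d where "0 \<le> B" "0 < d" "\<And>u v. u \<in> ebox n w d \<Longrightarrow> v \<in> ebox n w d \<Longrightarrow>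
     l1 n (\<lambda>i. f v i - f u i) \<le> B * l1 n (\<lambda>i. v i - u i)"
proof -
  obtain C where C: "0 \<le> C" "\<And>x. l1 n (L x) \<le> C * l1 n x" using bounded_linear_uptoD(4)[OF L] by blast
  obtain d where d: "0 < d" "\<And>u v. u \<in> ebox n w d \<Longrightarrow> v \<in> ebox n w d \<Longrightarrow>
     l1 n (\<lambda>i. (f v i - f u i) - L (\<lambda>i. v i - u i) i) \<le> 1 * l1 n (\<lambda>i. v i - u i)"
    using strict_derivD[OF f zero_less_one] by blast
  have "l1 n (\<lambda>i. f v i - f u i) \<le> (C + 1) * l1 n (\<lambda>i. v i - u i)"
    if "u \<in> ebox n w d" "v \<in> ebox n w d" for u v
    using d(2)[OF that] C(2)[of "\<lambda>i. v i - u i"]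
      l1_add_le[of n "\<lambda>i. (f v i - f u i) - L (\<lambda>i. v i - u i) i" "L (\<lambda>i. v i - u i)"]
    by (simp add: algebra_simps)
  then show thesis using C(1) d(1) by (intro that[of "C + 1" d]) auto
qed

lemma strict_deriv_maps_to:
  assumes L: "bounded_linear_upto n L" and f: "strict_deriv n f L w"
    and w: "w \<in> topspace (Euclidean_space n)" and e: "0 < e"
    and E: "\<exists>d>0. \<forall>u\<in>ebox n w d. f u \<in> topspace (Euclidean_space n)"
  obtains d where "0 < d" "\<And>u. u \<in> ebox n w d \<Longrightarrow> f u \<in> ebox n (f w) e"
proof -
  obtain B d where B: "0 \<le> B" "0 < d" "\<And>u v. u \<in> ebox n w d \<Longrightarrow> v \<in> ebox n w d \<Longrightarrow>
     l1 n (\<lambda>i. f v i - f u i) \<le> B * l1 n (\<lambda>i. v i - u i)"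
    using strict_deriv_Lipschitz[OF L f] by blast
  obtain d1 where d1: "0 < d1" "\<And>u. u \<in> ebox n w d1 \<Longrightarrow> f u \<in> topspace (Euclidean_space n)" using E by blast
  \<comment> \<open>In the box of radius d2 the distance to w is at most n * d2, so f moves by at
    most B * n * d2, which is below e. The 1 keeps the denominator positive.\<close>
  define d2 where "d2 = min (min d d1) (e / (B * n + 1))"
  have pos: "0 < B * n + 1" using B(1) by (simp add: add_nonneg_pos)
  have d2: "0 < d2" "d2 \<le> d" "d2 \<le> d1" "d2 \<le> e / (B * n + 1)" using B(2) d1(1) e pos by (auto simp: d2_def)
  show thesis
  proof (rule that[OF d2(1)])
    fix u assume u: "u \<in> ebox n w d2"
    have "l1 n (\<lambda>i. u i - w i) \<le> (\<Sum>i<n. d2)"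
      unfolding l1_def using u by (intro sum_mono) (auto simp: ebox_def less_imp_le)
    then have "B * l1 n (\<lambda>i. u i - w i) \<le> B * (n * d2)"
      using B(1) by (intro mult_left_mono) auto
    also have "\<dots> < (B * n + 1) * d2" using d2(1) by (simp add: algebra_simps)
    also have "\<dots> \<le> e" using d2(4) pos by (simp add: field_simps)
    finally have "l1 n (\<lambda>i. f u i - f w i) < e"
      using B(3)[of w u] u centre_in_ebox[OF w B(2)] ebox_mono[OF d2(2)] by fastforce
    then have "\<bar>f u i - f w i\<bar> < e" if "i < n" for i
      using l1_component_le[OF that, of "\<lambda>i. f u i - f w i"] by linarith
    then show "f u \<in> ebox n (f w) e"
      using d1(2) u ebox_mono[OF d2(3)] by (force simp: ebox_def)
  qed
qed

lemma strict_deriv_comp: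
  assumes L: "bounded_linear_upto n L" and f: "strict_deriv n f L w"
    and K: "bounded_linear_upto n K" and g: "strict_deriv n g K (f w)"
    and w: "w \<in> topspace (Euclidean_space n)"
    and E: "\<exists>d>0. \<forall>u\<in>ebox n w d. f u \<in> topspace (Euclidean_space n)"
  shows "strict_deriv n (g \<circ> f) (K \<circ> L) w"
  unfolding strict_deriv_def
proof (intro allI impI)
  fix e :: real assume e: "0 < e"
  obtain C where C: "0 \<le> C" "\<And>x. l1 n (K x) \<le> C * l1 n x" using bounded_linear_uptoD(4)[OF K] by blast
  obtain B d where B: "0 \<le> B" "0 < d" "\<And>u v. u \<in> ebox n w d \<Longrightarrow> v \<in> ebox n w d \<Longrightarrow>
     l1 n (\<lambda>i. f v i - f u i) \<le> B * l1 n (\<lambda>i. v i - u i)"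
    using strict_deriv_Lipschitz[OF L f] by blast
  \<comment> \<open>The error of the composite is the error of g on the increment of f, at most e1 *
    B, plus K applied to the error of f, at most C * e2. Both products are at most e / 2.\<close>
  define e1 where "e1 = e / (2 * (B + 1))"
  define e2 where "e2 = e / (2 * (C + 1))"
  have e12: "0 < e1" "0 < e2" using e B(1) C(1) by (simp_all add: e1_def e2_def)
  obtain d1 where d1: "0 < d1" "\<And>u v. u \<in> ebox n (f w) d1 \<Longrightarrow> v \<in> ebox n (f w) d1 \<Longrightarrow>
     l1 n (\<lambda>i. (g v i - g u i) - K (\<lambda>i. v i - u i) i) \<le> e1 * l1 n (\<lambda>i. v i - u i)"
    using strict_derivD[OF g e12(1)] by blast
  obtain d2 where d2: "0 < d2" "\<And>u v. u \<in> ebox n w d2 \<Longrightarrow> v \<in> ebox n w d2 \<Longrightarrow>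
     l1 n (\<lambda>i. (f v i - f u i) - L (\<lambda>i. v i - u i) i) \<le> e2 * l1 n (\<lambda>i. v i - u i)"
    using strict_derivD[OF f e12(2)] by blast
  obtain d3 where d3: "0 < d3" "\<And>u. u \<in> ebox n w d3 \<Longrightarrow> f u \<in> ebox n (f w) d1"
    using strict_deriv_maps_to[OF L f w d1(1) E] by blast
  define d' where "d' = min d (min d2 d3)"
  have sub: "ebox n w d' \<subseteq> ebox n w d" "ebox n w d' \<subseteq> ebox n w d2" "ebox n w d' \<subseteq> ebox n w d3"
    by (auto intro!: ebox_mono simp: d'_def)
  show "\<exists>d>0. \<forall>u\<in>ebox n w d. \<forall>v\<in>ebox n w d.
       l1 n (\<lambda>i. ((g \<circ> f) v i - (g \<circ> f) u i) - (K \<circ> L) (\<lambda>i. v i - u i) i) \<le> e * l1 n (\<lambda>i. v i - u i)"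
  proof (intro exI[of _ d'] conjI ballI)
    show "0 < d'" using B(2) d2(1) d3(1) by (simp add: d'_def)
    fix u v assume uv: "u \<in> ebox n w d'" "v \<in> ebox n w d'"
    let ?x = "\<lambda>i. v i - u i" and ?y = "\<lambda>i. f v i - f u i"
    have 1: "l1 n (\<lambda>i. (g (f v) i - g (f u) i) - K ?y i) \<le> e1 * (B * l1 n ?x)"
    proof -
      have "l1 n (\<lambda>i. (g (f v) i - g (f u) i) - K ?y i) \<le> e1 * l1 n ?y"
        using d1(2) d3(2) uv sub by blast
      also have "\<dots> \<le> e1 * (B * l1 n ?x)"
        using B(3)[of u v] uv sub e12 by (intro mult_left_mono) auto
      finally show ?thesis .
    qed
    have 2: "l1 n (K (\<lambda>i. ?y i - L ?x i)) \<le> C * (e2 * l1 n ?x)"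
    proof -
      have "l1 n (K (\<lambda>i. ?y i - L ?x i)) \<le> C * l1 n (\<lambda>i. ?y i - L ?x i)" by (rule C)
      also have "\<dots> \<le> C * (e2 * l1 n ?x)"
        using d2(2)[of u v] uv sub C(1) by (intro mult_left_mono) auto
      finally show ?thesis .
    qed
    have eq: "K (\<lambda>i. ?y i - L ?x i) = (\<lambda>i. K ?y i - K (L ?x) i)"
      by (rule bounded_linear_upto_diff[OF K])
    have "e1 * B + C * e2 \<le> e"
    proof -
      have "e1 * B \<le> e / 2" "C * e2 \<le> e / 2"
        using e B(1) C(1) by (simp_all add: e1_def e2_def field_simps)
      then show ?thesis by simp
    qed
    then have "(e1 * B + C * e2) * l1 n ?x \<le> e * l1 n ?x"
      by (rule mult_right_mono) simp
    moreover have "(\<lambda>i. ((g \<circ> f) v i - (g \<circ> f) u i) - (K \<circ> L) ?x i) =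
        (\<lambda>i. ((g (f v) i - g (f u) i) - K ?y i) + K (\<lambda>i. ?y i - L ?x i) i)"
      by (simp add: eq fun_eq_iff)
    ultimately show "l1 n (\<lambda>i. ((g \<circ> f) v i - (g \<circ> f) u i) - (K \<circ> L) ?x i) \<le> e * l1 n ?x"
      using 1 2 l1_add_le[of n "\<lambda>i. (g (f v) i - g (f u) i) - K ?y i" "K (\<lambda>i. ?y i - L ?x i)"]
      by (simp only:) (simp add: algebra_simps)
  qed
qed

lemma strict_deriv_sum:
  assumes "\<And>j. j < (m::nat) \<Longrightarrow> strict_deriv n (f j) (L j) w"
  shows "strict_deriv n (\<lambda>u i. \<Sum>j<m. f j u i) (\<lambda>x i. \<Sum>j<m. L j x i) w"
  using assms
proof (induction m)
  case 0
  then show ?case by (auto simp: strict_deriv_def l1_def sum_nonneg intro!: exI[of _ 1])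
next
  case (Suc m)
  show ?case
    unfolding strict_deriv_def
  proof (intro allI impI)
    fix e :: real assume e: "0 < e"
    let ?F = "\<lambda>u i. \<Sum>j<m. f j u i" and ?L = "\<lambda>x i. \<Sum>j<m. L j x i"
    have "strict_deriv n ?F ?L w" using Suc by simp
    then obtain d1 where d1: "0 < d1" "\<And>u v. u \<in> ebox n w d1 \<Longrightarrow> v \<in> ebox n w d1 \<Longrightarrow>
      l1 n (\<lambda>i. (?F v i - ?F u i) - ?L (\<lambda>i. v i - u i) i) \<le> (e/2) * l1 n (\<lambda>i. v i - u i)"
      using e by (auto elim: strict_derivD[of _ _ _ _ "e/2"])
    have "strict_deriv n (f m) (L m) w" using Suc by simp
    then obtain d2 where d2: "0 < d2" "\<And>u v. u \<in> ebox n w d2 \<Longrightarrow> v \<in> ebox n w d2 \<Longrightarrow>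
      l1 n (\<lambda>i. (f m v i - f m u i) - L m (\<lambda>i. v i - u i) i) \<le> (e/2) * l1 n (\<lambda>i. v i - u i)"
      using e by (auto elim: strict_derivD[of _ _ _ _ "e/2"])
    have sub: "ebox n w (min d1 d2) \<subseteq> ebox n w d1" "ebox n w (min d1 d2) \<subseteq> ebox n w d2"
      by (auto intro!: ebox_mono)
    show "\<exists>d>0. \<forall>u\<in>ebox n w d. \<forall>v\<in>ebox n w d.
       l1 n (\<lambda>i. ((\<Sum>j<Suc m. f j v i) - (\<Sum>j<Suc m. f j u i)) - (\<Sum>j<Suc m. L j (\<lambda>i. v i - u i) i))
         \<le> e * l1 n (\<lambda>i. v i - u i)"
    proof (intro exI[of _ "min d1 d2"] conjI ballI)
      fix u v assume uv: "u \<in> ebox n w (min d1 d2)" "v \<in> ebox n w (min d1 d2)"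
      have 1: "l1 n (\<lambda>i. (?F v i - ?F u i) - ?L (\<lambda>i. v i - u i) i) \<le> (e/2) * l1 n (\<lambda>i. v i - u i)"
        using d1(2) uv sub by blast
      have 2: "l1 n (\<lambda>i. (f m v i - f m u i) - L m (\<lambda>i. v i - u i) i) \<le> (e/2) * l1 n (\<lambda>i. v i - u i)"
        using d2(2) uv sub by blast
      have eq: "(\<lambda>i. ((\<Sum>j<Suc m. f j v i) - (\<Sum>j<Suc m. f j u i)) - (\<Sum>j<Suc m. L j (\<lambda>i. v i - u i) i)) =
         (\<lambda>i. ((?F v i - ?F u i) - ?L (\<lambda>i. v i - u i) i) + ((f m v i - f m u i) - L m (\<lambda>i. v i - u i) i))"
        by (simp add: fun_eq_iff algebra_simps)
      show "l1 n (\<lambda>i. ((\<Sum>j<Suc m. f j v i) - (\<Sum>j<Suc m. f j u i)) - (\<Sum>j<Suc m. L j (\<lambda>i. v i - u i) i))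
         \<le> e * l1 n (\<lambda>i. v i - u i)"
        unfolding eq by (rule order_trans[OF l1_add_le]) (use 1 2 in \<open>simp add: algebra_simps\<close>)
    qed (use d1(1) d2(1) in simp)
  qed
qed

lemma strict_deriv_cong:
  assumes f: "strict_deriv n f L w" and d: "0 < d" and eq: "\<And>u. u \<in> ebox n w d \<Longrightarrow> f u = g u"
  shows "strict_deriv n g L w"
  unfolding strict_deriv_def
proof (intro allI impI)
  fix e :: real assume "0 < e"
  then obtain d1 where d1: "0 < d1" "\<And>u v. u \<in> ebox n w d1 \<Longrightarrow> v \<in> ebox n w d1 \<Longrightarrow>
      l1 n (\<lambda>i. (f v i - f u i) - L (\<lambda>i. v i - u i) i) \<le> e * l1 n (\<lambda>i. v i - u i)"
    using strict_derivD[OF f] by blast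
  have sub: "ebox n w (min d1 d) \<subseteq> ebox n w d1" "ebox n w (min d1 d) \<subseteq> ebox n w d"
    by (auto intro!: ebox_mono)
  show "\<exists>d>0. \<forall>u\<in>ebox n w d. \<forall>v\<in>ebox n w d.
       l1 n (\<lambda>i. (g v i - g u i) - L (\<lambda>i. v i - u i) i) \<le> e * l1 n (\<lambda>i. v i - u i)"
  proof (intro exI[of _ "min d1 d"] conjI ballI)
    fix u v assume "u \<in> ebox n w (min d1 d)" "v \<in> ebox n w (min d1 d)"
    then show "l1 n (\<lambda>i. (g v i - g u i) - L (\<lambda>i. v i - u i) i) \<le> e * l1 n (\<lambda>i. v i - u i)"
      using d1(2)[of u v] eq[of u] eq[of v] sub by (simp add: subset_iff)
  qed (use d d1 in simp)
qed

text \<open>The defect x - L x is homogeneous in x, so x may be scaled until w + t * x lies in the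
  box; the defect is then at most e times the norm of x for every e. This turns "a p-th iterate is
  the identity" into "the p-th power of its derivative is the identity".\<close>

lemma strict_deriv_id_unique:
  assumes L: "bounded_linear_upto n L" and f: "strict_deriv n (\<lambda>u. u) L w"
    and w: "w \<in> topspace (Euclidean_space n)" and x: "x \<in> topspace (Euclidean_space n)"
  shows "L x = x"
proof -
  have le: "l1 n (\<lambda>i. x i - L x i) \<le> e * l1 n x" if "0 < e" for e
  proof -
    obtain d where d: "0 < d" "\<And>u v. u \<in> ebox n w d \<Longrightarrow> v \<in> ebox n w d \<Longrightarrow>
       l1 n (\<lambda>i. (v i - u i) - L (\<lambda>i. v i - u i) i) \<le> e * l1 n (\<lambda>i. v i - u i)"
      using strict_derivD[OF f \<open>0 < e\<close>] by blast
    define t where "t = d / (l1 n x + 1)"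
    have pos: "0 < l1 n x + 1" by (simp add: add_nonneg_pos)
    have t: "0 < t" using d(1) pos by (simp add: t_def)
    have "t * \<bar>x i\<bar> < d" if "i < n" for i
    proof -
      have "t * \<bar>x i\<bar> < t * (l1 n x + 1)"
        using l1_component_le[OF that, of x] t by (intro mult_strict_left_mono) auto
      also have "\<dots> = d" using pos by (simp add: t_def)
      finally show ?thesis .
    qed
    then have v: "(\<lambda>i. w i + t * x i) \<in> ebox n w d"
      using w x t by (auto simp: ebox_def topspace_Euclidean_space abs_mult)
    have "t * l1 n (\<lambda>i. x i - L x i) \<le> t * (e * l1 n x)"
      using d(2)[OF centre_in_ebox[OF w d(1)] v] t l1_scale[of n t x] l1_scale[of n t "\<lambda>i. x i - L x i"]
      by (simp add: bounded_linear_uptoD(2)[OF L] algebra_simps)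
    then show ?thesis using t by simp
  qed
  have "l1 n (\<lambda>i. x i - L x i) = 0"
  proof (rule ccontr)
    assume "l1 n (\<lambda>i. x i - L x i) \<noteq> 0"
    then have pos: "0 < l1 n (\<lambda>i. x i - L x i)" using l1_nonneg[of n "\<lambda>i. x i - L x i"] by linarith
    define y where "y = l1 n (\<lambda>i. x i - L x i)"
    define z where "z = l1 n x"
    have z: "0 \<le> z" by (simp add: z_def)
    have "0 < y / (2 * (z + 1))" using pos z by (simp add: y_def)
    from le[OF this] have "y \<le> y / (2 * (z + 1)) * z" by (simp only: y_def z_def)
    also have "\<dots> \<le> y / 2" using pos z by (simp add: y_def[symmetric] field_simps)
    finally show False using pos by (simp add: y_def)
  qed
  then show ?thesis
    using l1_diff_eq_0_iff[OF x bounded_linear_uptoD(3)[OF L]] by simp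
qed

text \<open>The injectivity half of the inverse function theorem: an error of at most half of c
  times the distance cannot cancel the main term. Openness of the image comes later from invariance
  of domain.\<close>

lemma strict_deriv_inj:
  assumes f: "strict_deriv n f (\<lambda>x i. c * x i) w" and c: "0 < c"
  obtains d where "0 < d" "inj_on f (ebox n w d)"
proof -
  obtain d where d: "0 < d" "\<And>u v. u \<in> ebox n w d \<Longrightarrow> v \<in> ebox n w d \<Longrightarrow>
       l1 n (\<lambda>i. (f v i - f u i) - c * (v i - u i)) \<le> (c/2) * l1 n (\<lambda>i. v i - u i)"
    using strict_derivD[OF f, of "c/2"] c by auto
  have "inj_on f (ebox n w d)"
  proof (rule inj_onI)
    fix u v assume uv: "u \<in> ebox n w d" "v \<in> ebox n w d" "f u = f v"
    have "c * l1 n (\<lambda>i. v i - u i) \<le> (c/2) * l1 n (\<lambda>i. v i - u i)"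
      using d(2)[OF uv(1,2)] uv(3) l1_scale[of n "-c" "\<lambda>i. v i - u i"] c by simp
    then have "l1 n (\<lambda>i. v i - u i) \<le> 0" using c by simp
    then have "l1 n (\<lambda>i. v i - u i) = 0" by (rule antisym) simp
    then show "u = v" using uv l1_diff_eq_0_iff[of v n u] ebox_subset by auto
  qed
  then show thesis using that d(1) by blast
qed

section \<open>Charts and equivariant contractions\<close>

lemma Lipschitz_imp_continuous_map_real:
  assumes W: "openin (Euclidean_space n) W"
    and B: "\<And>u v. u \<in> W \<Longrightarrow> v \<in> W \<Longrightarrow> \<bar>g v - g u\<bar> \<le> B * l1 n (\<lambda>i. v i - u i)"
  shows "continuous_map (subtopology (Euclidean_space n) W) euclideanreal g"
proof -
  have tW: "topspace (subtopology (Euclidean_space n) W) = W"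
    using openin_subset[OF W] by auto
  show ?thesis
    unfolding continuous_map_def tW
  proof (intro conjI allI impI)
    fix S :: "real set" assume "openin euclideanreal S"
    then have S: "open S" by simp
    have "\<exists>T. openin (Euclidean_space n) T \<and> u \<in> T \<and> T \<subseteq> {x \<in> W. g x \<in> S}"
      if u: "u \<in> W" "g u \<in> S" for u
    proof -
      obtain e where e: "0 < e" "\<And>y. \<bar>y - g u\<bar> < e \<Longrightarrow> y \<in> S"
        using S u(2) unfolding open_dist dist_real_def by blast
      obtain d where d: "0 < d" "ebox n u d \<subseteq> W"
        using Euclidean_open_contains_ebox[OF W u(1)] .
      \<comment> \<open>No sign is assumed for B, hence the absolute value; the 1 keeps the
        denominator positive.\<close>
      define d' where "d' = min d (e / (\<bar>B\<bar> * n + 1))"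
      have pos: "0 < \<bar>B\<bar> * n + 1" by (simp add: add_nonneg_pos)
      have d': "0 < d'" "d' \<le> d" "d' \<le> e / (\<bar>B\<bar> * n + 1)" using d(1) e(1) pos by (auto simp: d'_def)
      have "g v \<in> S" if v: "v \<in> ebox n u d'" for v
      proof (rule e(2))
        have vW: "v \<in> W" using v ebox_mono[OF d'(2)] d(2) by blast
        have "l1 n (\<lambda>i. v i - u i) \<le> (\<Sum>i<n. d')"
          unfolding l1_def using v by (intro sum_mono) (auto simp: ebox_def less_imp_le)
        then have "\<bar>B\<bar> * l1 n (\<lambda>i. v i - u i) \<le> \<bar>B\<bar> * (n * d')"
          by (intro mult_left_mono) auto
        also have "\<dots> < (\<bar>B\<bar> * n + 1) * d'" using d'(1) by (simp add: algebra_simps)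
        also have "\<dots> \<le> e" using d'(3) pos by (simp add: field_simps)
        finally have "\<bar>B\<bar> * l1 n (\<lambda>i. v i - u i) < e" .
        moreover have "B * l1 n (\<lambda>i. v i - u i) \<le> \<bar>B\<bar> * l1 n (\<lambda>i. v i - u i)"
          by (intro mult_right_mono) auto
        ultimately show "\<bar>g v - g u\<bar> < e"
          using B[OF u(1) vW] by linarith
      qed
      moreover have "u \<in> topspace (Euclidean_space n)" using u(1) tW by auto
      ultimately show ?thesis
        using openin_ebox[of n u d'] centre_in_ebox[of u n d'] d' ebox_mono[OF d'(2)] d(2)
        by (intro exI[of _ "ebox n u d'"]) blast
    qed
    then have "openin (Euclidean_space n) {x \<in> W. g x \<in> S}"
      by (subst openin_subopen) auto
    then show "openin (subtopology (Euclidean_space n) W) {x \<in> W. g x \<in> S}"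
      using W by (simp add: openin_open_subtopology)
  qed auto
qed

lemma Lipschitz_imp_continuous_map_Euclidean:
  assumes W: "openin (Euclidean_space n) W"
    and B: "\<And>u v. u \<in> W \<Longrightarrow> v \<in> W \<Longrightarrow> l1 n (\<lambda>i. f v i - f u i) \<le> B * l1 n (\<lambda>i. v i - u i)"
    and E: "f \<in> W \<rightarrow> topspace (Euclidean_space n)"
  shows "continuous_map (subtopology (Euclidean_space n) W) (Euclidean_space n) f"
proof (rule continuous_map_into_Euclidean_space)
  show "f \<in> topspace (subtopology (Euclidean_space n) W) \<rightarrow> topspace (Euclidean_space n)"
    using E by auto
  fix i assume i: "i < n"
  have "\<bar>f v i - f u i\<bar> \<le> B * l1 n (\<lambda>i. v i - u i)" if "u \<in> W" "v \<in> W" for u v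
    using B[OF that] l1_component_le[OF i, of "\<lambda>i. f v i - f u i"] by linarith
  then show "continuous_map (subtopology (Euclidean_space n) W) euclideanreal (\<lambda>x. f x i)"
    by (rule Lipschitz_imp_continuous_map_real[OF W])
qed

section \<open>Charts and derivatives of smooth maps\<close>

lemma chartD:
  assumes "chart n X (U, h)"
  shows "openin X U" "U \<subseteq> topspace X" "openin (Euclidean_space n) (h ` U)" "inj_on h U"
    "continuous_map (subtopology X U) (Euclidean_space n) h"
    "\<And>W. openin X W \<Longrightarrow> W \<subseteq> U \<Longrightarrow> openin (Euclidean_space n) (h ` W)"
    "continuous_map (subtopology (Euclidean_space n) (h ` U)) X (inv_into U h)"
proof -
  show oU: "openin X U" and oh: "openin (Euclidean_space n) (h ` U)"
    using assms by (auto simp: chart_def)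
  have hm: "homeomorphic_map (subtopology X U) (subtopology (Euclidean_space n) (h ` U)) h"
    using assms by (auto simp: chart_def)
  show UX: "U \<subseteq> topspace X" using openin_subset[OF oU] .
  then have tU: "topspace (subtopology X U) = U" by auto
  show inj: "inj_on h U" using homeomorphic_imp_injective_map[OF hm] tU by simp
  show "continuous_map (subtopology X U) (Euclidean_space n) h"
    using homeomorphic_imp_continuous_map[OF hm] continuous_map_into_fulltopology by blast
  show "openin (Euclidean_space n) (h ` W)" if "openin X W" "W \<subseteq> U" for W
  proof -
    have "openin (subtopology X U) W" using that oU by (simp add: openin_open_subtopology)
    then have "openin (subtopology (Euclidean_space n) (h ` U)) (h ` W)"
      using homeomorphic_imp_open_map[OF hm] by (auto simp: open_map_def)
    then show ?thesis using openin_trans_full oh by blast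
  qed
  obtain g where g: "homeomorphic_maps (subtopology X U) (subtopology (Euclidean_space n) (h ` U)) h g"
    using hm homeomorphic_map_maps by blast
  then have gh: "g (h x) = x" if "x \<in> U" for x using that tU by (auto simp: homeomorphic_maps_def)
  have "continuous_map (subtopology (Euclidean_space n) (h ` U)) X g"
    using g continuous_map_into_fulltopology by (auto simp: homeomorphic_maps_def)
  moreover have "g u = inv_into U h u" if "u \<in> topspace (subtopology (Euclidean_space n) (h ` U))" for u
    using that gh inj by auto
  ultimately show "continuous_map (subtopology (Euclidean_space n) (h ` U)) X (inv_into U h)"
    by (rule continuous_map_eq)
qed

lemma chart_image_in_Euclidean:
  assumes "chart n X (U, h)" "x \<in> U"
  shows "h x \<in> topspace (Euclidean_space n)"
  using chartD(3)[OF assms(1)] assms(2) openin_subset by blast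

text \<open>Each coordinate function is in particular of class C^1, and its strict derivative is a
  row of the Jacobian matrix. L is that matrix padded with zeros from index n on.\<close>

lemma smooth_map_strict_deriv:
  assumes X: "smooth_manifold n X A" and f: "smooth_map n X A n X A f"
    and U: "(U, h) \<in> A" and V: "(V, k) \<in> A" and x: "x \<in> U" "f x \<in> V"
  obtains L where "bounded_linear_upto n L" "strict_deriv n (\<lambda>u. k (f (inv_into U h u))) L (h x)"
proof -
  let ?W = "h ` (U \<inter> f -` V)"
  have cU: "chart n X (U, h)" and cV: "chart n X (V, k)"
    using X U V by (auto simp: smooth_manifold_def)
  have fc: "continuous_map X X f" using f by (simp add: smooth_map_def)
  have "U \<inter> f -` V = U \<inter> {x \<in> topspace X. f x \<in> V}" using chartD(2)[OF cU] by auto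
  then have "openin X (U \<inter> f -` V)"
    using chartD(1)[OF cU] openin_continuous_map_preimage[OF fc chartD(1)[OF cV]] by auto
  then have W: "openin (Euclidean_space n) ?W" using chartD(6)[OF cU] by blast
  have w: "h x \<in> ?W" using x by auto
  let ?F = "\<lambda>u. k (f (inv_into U h u))"
  have "\<forall>i<n. smooth_fun_on n ?W (\<lambda>u. ?F u i)"
    using f U V unfolding smooth_map_def by fast
  then have C1: "Ck_on n 1 ?W (\<lambda>u. ?F u i)" if "i < n" for i
    using that unfolding smooth_fun_on_def by blast
  define P where "P = (\<lambda>i a. \<forall>e>0. \<exists>d>0. \<forall>u\<in>ebox n (h x) d. \<forall>v\<in>ebox n (h x) d.
     \<bar>?F v i - ?F u i - (\<Sum>j<n. a j * (v j - u j))\<bar> \<le> e * l1 n (\<lambda>i. v i - u i))"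
  have "\<exists>a. P i a" if "i < n" for i
    by (rule C1_strictly_differentiable[OF W w C1[OF that]]) (unfold P_def, blast)
  then have "\<forall>i\<in>{..<n}. \<exists>a. P i a" by simp
  from bchoice[OF this] obtain a where "\<forall>i\<in>{..<n}. P i (a i)" ..
  then have a: "\<exists>d>0. \<forall>u\<in>ebox n (h x) d. \<forall>v\<in>ebox n (h x) d.
     \<bar>?F v i - ?F u i - (\<Sum>j<n. a i j * (v j - u j))\<bar> \<le> e * l1 n (\<lambda>i. v i - u i)" if "i < n" "0 < e" for i e
    using that unfolding P_def by simp
  define L where "L = (\<lambda>y i. if i < n then \<Sum>j<n. a i j * y j else (0::real))"
  define C where "C = (\<Sum>i<n. \<Sum>j<n. \<bar>a i j\<bar>)"
  have Cb: "l1 n (L y) \<le> C * l1 n y" for y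
  proof -
    have le: "\<bar>\<Sum>j<n. a i j * y j\<bar> \<le> (\<Sum>j<n. \<bar>a i j\<bar>) * l1 n y" for i
    proof -
      have "\<bar>\<Sum>j<n. a i j * y j\<bar> \<le> (\<Sum>j<n. \<bar>a i j\<bar> * \<bar>y j\<bar>)"
        by (rule order_trans[OF sum_abs]) (simp add: abs_mult)
      also have "\<dots> \<le> (\<Sum>j<n. \<bar>a i j\<bar> * l1 n y)"
        by (intro sum_mono mult_left_mono l1_component_le) auto
      finally show ?thesis by (simp add: sum_distrib_right)
    qed
    have "l1 n (L y) = (\<Sum>i<n. \<bar>\<Sum>j<n. a i j * y j\<bar>)" by (simp add: l1_def L_def)
    also have "\<dots> \<le> (\<Sum>i<n. (\<Sum>j<n. \<bar>a i j\<bar>) * l1 n y)" by (intro sum_mono le)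
    finally show ?thesis by (simp add: C_def sum_distrib_right)
  qed
  have "bounded_linear_upto n L"
    unfolding bounded_linear_upto_def
  proof (intro conjI allI)
    show "\<exists>C\<ge>0. \<forall>x. l1 n (L x) \<le> C * l1 n x"
      using Cb by (intro exI[of _ C]) (auto simp: C_def intro!: sum_nonneg)
  qed (auto simp: L_def fun_eq_iff topspace_Euclidean_space distrib_left sum.distrib sum_distrib_left ac_simps)
  moreover have "strict_deriv n ?F L (h x)"
    unfolding strict_deriv_def
  proof (intro allI impI)
    fix e :: real assume e: "0 < e"
    \<comment> \<open>n coordinate errors of size e' add up to at most e; the denominator n + 1 is
      safe for n = 0.\<close>
    define e' where "e' = e / (n + 1)"
    have e': "0 < e'" using e by (simp add: e'_def)
    have "\<forall>i\<in>{..<n}. \<exists>d>0. \<forall>u\<in>ebox n (h x) d. \<forall>v\<in>ebox n (h x) d.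
       \<bar>?F v i - ?F u i - (\<Sum>j<n. a i j * (v j - u j))\<bar> \<le> e' * l1 n (\<lambda>i. v i - u i)"
      using a[OF _ e'] by simp
    from bchoice[OF this] obtain d where d0: "\<forall>i\<in>{..<n}. 0 < d i \<and> (\<forall>u\<in>ebox n (h x) (d i). \<forall>v\<in>ebox n (h x) (d i).
       \<bar>?F v i - ?F u i - (\<Sum>j<n. a i j * (v j - u j))\<bar> \<le> e' * l1 n (\<lambda>i. v i - u i))" ..
    then have d: "0 < d i" "u \<in> ebox n (h x) (d i) \<Longrightarrow> v \<in> ebox n (h x) (d i) \<Longrightarrow>
       \<bar>?F v i - ?F u i - (\<Sum>j<n. a i j * (v j - u j))\<bar> \<le> e' * l1 n (\<lambda>i. v i - u i)" if "i < n" for i u v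
      using that by simp_all
    define D where "D = Min (insert 1 (d ` {..<n}))"
    have D: "0 < D" using d(1) by (auto simp: D_def)
    have Dd: "D \<le> d i" if "i < n" for i using that by (auto simp: D_def)
    show "\<exists>d>0. \<forall>u\<in>ebox n (h x) d. \<forall>v\<in>ebox n (h x) d.
       l1 n (\<lambda>i. (?F v i - ?F u i) - L (\<lambda>i. v i - u i) i) \<le> e * l1 n (\<lambda>i. v i - u i)"
    proof (intro exI[of _ D] conjI ballI)
      fix u v assume uv: "u \<in> ebox n (h x) D" "v \<in> ebox n (h x) D"
      have "l1 n (\<lambda>i. (?F v i - ?F u i) - L (\<lambda>i. v i - u i) i) \<le> (\<Sum>i<n. e' * l1 n (\<lambda>i. v i - u i))"
        unfolding l1_def[of n "\<lambda>i. (?F v i - ?F u i) - L (\<lambda>i. v i - u i) i"]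
      proof (intro sum_mono)
        fix i assume "i \<in> {..<n}"
        then have i: "i < n" by simp
        have "u \<in> ebox n (h x) (d i)" "v \<in> ebox n (h x) (d i)" using uv ebox_mono[OF Dd[OF i]] by auto
        from d(2)[OF i this] i show "\<bar>?F v i - ?F u i - L (\<lambda>i. v i - u i) i\<bar> \<le> e' * l1 n (\<lambda>i. v i - u i)"
          by (simp add: L_def)
      qed
      also have "\<dots> = (n * e') * l1 n (\<lambda>i. v i - u i)" by simp
      also have "\<dots> \<le> e * l1 n (\<lambda>i. v i - u i)"
        using e by (intro mult_right_mono) (auto simp: e'_def field_simps)
      finally show "l1 n (\<lambda>i. (?F v i - ?F u i) - L (\<lambda>i. v i - u i) i) \<le> e * l1 n (\<lambda>i. v i - u i)" .
    qed (rule D)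
  qed
  ultimately show thesis by (rule that)
qed


lemma smooth_manifold_chart:
  assumes "smooth_manifold n X A" "x \<in> topspace X"
  obtains U h where "(U, h) \<in> A" "x \<in> U" "chart n X (U, h)"
proof -
  have "x \<in> (\<Union>(U, h)\<in>A. U)" "\<forall>c\<in>A. chart n X c" using assms by (auto simp: smooth_manifold_def)
  then show thesis using that by fast
qed

lemma continuous_map_funpow:
  assumes "continuous_map X X f"
  shows "continuous_map X X (f ^^ j)"
proof (induction j)
  case 0 show ?case by (simp add: id_def)
next
  case (Suc j)
  from continuous_map_compose[OF this assms] show ?case by (simp add: o_def)
qed

lemma openin_funpow_preimage:
  assumes "continuous_map X X f" "openin X U"
  shows "openin X {z \<in> topspace X. \<forall>j<(p::nat). (f ^^ j) z \<in> U}"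
proof -
  have "openin X {z \<in> topspace X. (f ^^ j) z \<in> U}" for j
    using openin_continuous_map_preimage[OF continuous_map_funpow[OF assms(1)] assms(2)] .
  moreover have "{z \<in> topspace X. \<forall>j<p. (f ^^ j) z \<in> U} =
    topspace X \<inter> (\<Inter>j<p. {z \<in> topspace X. (f ^^ j) z \<in> U})" by auto
  ultimately show ?thesis by (cases "p = 0") (auto intro!: openin_INT)
qed

text \<open>Near a fixed point \<open>x0\<close> the averaged chart
  \<open>H z = \<Sum>j<p. L\<^sup>p\<^sup>-\<^sup>j (h (f\<^sup>j z) - h x0)\<close>, with \<open>L\<close> the derivative of \<open>f\<close> at \<open>x0\<close>, conjugates \<open>f\<close> to
  the linear map \<open>L\<close>. Its strict derivative is \<open>p\<close> times the identity, so it is injective near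
  \<open>x0\<close> and, by invariance of domain, a homeomorphism onto an open set.\<close>

lemma linearisation_at_fixed_point:
  assumes X: "smooth_manifold n X A" and f: "smooth_map n X A n X A f" and p: "0 < p"
    and per: "\<And>x. x \<in> topspace X \<Longrightarrow> (f ^^ p) x = x"
    and x0: "x0 \<in> topspace X" "f x0 = x0"
  obtains \<Omega> H L where "openin X \<Omega>" "x0 \<in> \<Omega>" "\<forall>z\<in>\<Omega>. f z \<in> \<Omega>"
    "continuous_map (subtopology X \<Omega>) (Euclidean_space n) H" "H x0 = (\<lambda>i. 0)" "inj_on H \<Omega>"
    "openin (Euclidean_space n) (H ` \<Omega>)"
    "continuous_map (subtopology (Euclidean_space n) (H ` \<Omega>)) X (inv_into \<Omega> H)"
    "bounded_linear_upto n L" "\<forall>z\<in>\<Omega>. H (f z) = L (H z)"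
proof -
  have fc: "continuous_map X X f" using f by (simp add: smooth_map_def)
  have fX: "f z \<in> topspace X" if "z \<in> topspace X" for z
    using fc that by (auto simp: continuous_map_def)
  have fjX: "(f ^^ j) z \<in> topspace X" if "z \<in> topspace X" for j z
    using that fX by (induction j) auto
  obtain U h where Uh: "(U, h) \<in> A" "x0 \<in> U" and ch: "chart n X (U, h)"
    using smooth_manifold_chart[OF X x0(1)] .
  note chart = chartD[OF ch] and inE = chart_image_in_Euclidean[OF ch]
  define F where "F = (\<lambda>u. h (f (inv_into U h u)))"
  define w where "w = h x0"
  have wE: "w \<in> topspace (Euclidean_space n)" using inE Uh(2) by (simp add: w_def)
  obtain L where L: "bounded_linear_upto n L" and FL: "strict_deriv n F L w"
    using smooth_map_strict_deriv[OF X f Uh(1) Uh(1), of x0] Uh(2) x0(2) unfolding F_def w_def by auto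
  have FU: "F (h z) = h (f z)" if "z \<in> U" for z
    using that chart(4) by (simp add: F_def)
  have Fw: "F w = w" using FU[OF Uh(2)] x0(2) by (simp add: w_def)
  have Fjw: "(F ^^ j) w = w" for j by (induction j) (simp_all add: Fw)

  \<comment> \<open>On \<open>\<Omega>0\<close> the first p iterates, hence by periodicity the whole
    orbit, stay in the chart domain. There iterates of the coordinate map F describe iterates of
    f.\<close>
  define \<Omega>0 where "\<Omega>0 = {z \<in> topspace X. \<forall>j<p. (f ^^ j) z \<in> U}"
  have o0: "openin X \<Omega>0"
    unfolding \<Omega>0_def by (rule openin_funpow_preimage[OF fc chart(1)])
  have fj0: "(f ^^ j) x0 = x0" for j by (induction j) (simp_all add: x0)
  have x00: "x0 \<in> \<Omega>0" using x0 Uh(2) by (simp add: \<Omega>0_def fj0)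
  have \<Omega>0U: "\<Omega>0 \<subseteq> U" using p by (auto simp: \<Omega>0_def)
  have \<Omega>0j: "(f ^^ j) z \<in> U" if "z \<in> \<Omega>0" "j \<le> p" for z j
    using that per p \<Omega>0U by (cases "j = p") (auto simp: \<Omega>0_def)
  have FjU: "(F ^^ j) (h z) = h ((f ^^ j) z)" if "z \<in> \<Omega>0" "j \<le> p" for z j
    using that(2) by (induction j) (simp_all add: FU \<Omega>0j[OF that(1)])
  have W0: "openin (Euclidean_space n) (h ` \<Omega>0)" using chart(6)[OF o0 \<Omega>0U] .
  have "w \<in> h ` \<Omega>0" using x00 by (simp add: w_def)
  then obtain d0 where d0: "0 < d0" "ebox n w d0 \<subseteq> h ` \<Omega>0"
    using Euclidean_open_contains_ebox[OF W0] by blast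
  have FjE: "\<exists>d>0. \<forall>u\<in>ebox n w d. (F ^^ j) u \<in> topspace (Euclidean_space n)" if "j \<le> p" for j
  proof (intro exI[of _ d0] conjI ballI)
    fix u assume "u \<in> ebox n w d0"
    then obtain z where z: "z \<in> \<Omega>0" "u = h z" using d0(2) by blast
    then show "(F ^^ j) u \<in> topspace (Euclidean_space n)"
      using FjU[OF z(1) that] inE[OF \<Omega>0j[OF z(1) that]] by simp
  qed (rule d0)
  have Fj: "strict_deriv n (F ^^ Suc j) (L ^^ Suc j) w" if "Suc j \<le> p" for j
    using that
  proof (induction j)
    case 0 then show ?case using FL by simp
  next
    case (Suc j)
    have IH: "strict_deriv n (F ^^ Suc j) (L ^^ Suc j) w" and j: "Suc j \<le> p" using Suc by (auto simp: o_def)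
    have "strict_deriv n F L ((F ^^ Suc j) w)" using FL by (simp only: Fjw)
    from strict_deriv_comp[OF bounded_linear_upto_funpow[OF L] IH L this wE FjE[OF j]]
    show ?case by (simp add: o_def)
  qed
  \<comment> \<open>Near w the p-th iterate of F is the identity, so its derivative, the p-th power
    of L, is the identity on \<open>Euclidean_space n\<close>.\<close>
  have Lp: "(L ^^ p) x = x" if "x \<in> topspace (Euclidean_space n)" for x
  proof (rule strict_deriv_id_unique[OF _ _ wE that])
    show "bounded_linear_upto n (L ^^ p)" using bounded_linear_upto_funpow[OF L, of "p - 1"] p by simp
    have "strict_deriv n (F ^^ p) (L ^^ p) w" using Fj[of "p - 1"] p by simp
    then show "strict_deriv n (\<lambda>u. u) (L ^^ p) w"
    proof (rule strict_deriv_cong[OF _ d0(1)])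
      fix u assume "u \<in> ebox n w d0"
      then obtain z where z: "z \<in> \<Omega>0" "u = h z" using d0(2) by blast
      then show "(F ^^ p) u = u" using FjU[OF z(1) order_refl] per by (auto simp: \<Omega>0_def)
    qed
  qed
  have blk: "bounded_linear_upto n (L ^^ (p - j))" if "j < p" for j
    using bounded_linear_upto_funpow[OF L, of "p - j - 1"] that by (simp add: Suc_diff_Suc del: funpow.simps)

  \<comment> \<open>The averaged map in coordinates, to which derivatives and invariance of domain
    apply; H is the same map on X. The exponents p - j run from p down to 1, so the identity never
    occurs as a power of L.\<close>
  define Hh where "Hh = (\<lambda>u i. \<Sum>j<p. (L ^^ (p - j)) (\<lambda>i. (F ^^ j) u i - w i) i)"
  define H where "H = (\<lambda>z i. \<Sum>j<p. (L ^^ (p - j)) (\<lambda>i. h ((f ^^ j) z) i - w i) i)"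
  have HHh: "Hh (h z) = H z" if "z \<in> \<Omega>0" for z
    unfolding Hh_def H_def using FjU[OF that] by simp
  have HhE: "Hh u \<in> topspace (Euclidean_space n)" for u
    unfolding Hh_def using bounded_linear_uptoD(3)[OF blk] by (simp add: topspace_Euclidean_space)
  have Hhw: "Hh w = (\<lambda>i. 0)"
  proof -
    have "(L ^^ (p - j)) (\<lambda>i. 0) = (\<lambda>i. 0)" if "j < p" for j
      using bounded_linear_uptoD(2)[OF blk[OF that], of 0 "\<lambda>i. 0"] by simp
    then show ?thesis unfolding Hh_def by (simp add: Fjw)
  qed
  \<comment> \<open>By the chain rule the powers p - j and j of L combine to the p-th power in every
    summand, which is the identity by \<open>Lp\<close>. Hence p summands give p times the
    identity.\<close>
  have "strict_deriv n (\<lambda>u. (L ^^ (p - j)) (\<lambda>i. (F ^^ j) u i - w i)) (L ^^ p) w" if j: "j < p" for j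
  proof -
    define g where "g = (\<lambda>x. (L ^^ (p - j)) (\<lambda>i. x i - w i))"
    have "(\<lambda>i. g v i - g u i - (L ^^ (p - j)) (\<lambda>i. v i - u i) i) = (\<lambda>i. 0)" for u v
      unfolding g_def by (simp add: bounded_linear_upto_diff[OF blk[OF j]])
    then have g: "strict_deriv n g (L ^^ (p - j)) w'" for w'
      unfolding strict_deriv_def by (auto simp: l1_def sum_nonneg intro!: exI[of _ 1])
    show ?thesis
    proof (cases "j = 0")
      case True then show ?thesis using g by (simp add: g_def)
    next
      case False
      then obtain k where k: "j = Suc k" by (cases j) auto
      have "strict_deriv n (g \<circ> (F ^^ j)) ((L ^^ (p - j)) \<circ> (L ^^ j)) w"
        using strict_deriv_comp[OF bounded_linear_upto_funpow[OF L] Fj blk[OF j] g wE FjE] j unfolding k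
        by (meson less_imp_le)
      moreover have "(L ^^ (p - j)) \<circ> (L ^^ j) = L ^^ p"
        using funpow_add[of "p - j" j L] j by simp
      ultimately show ?thesis by (simp add: g_def o_def)
    qed
  qed
  then have sH: "strict_deriv n Hh (\<lambda>x i. \<Sum>j<p. (L ^^ p) x i) w"
    unfolding Hh_def by (rule strict_deriv_sum)
  have sHp: "strict_deriv n Hh (\<lambda>x i. real p * x i) w"
  proof -
    have "(L ^^ p) (\<lambda>i. v i - u i) = (\<lambda>i. v i - u i)" if "u \<in> ebox n w d" "v \<in> ebox n w d" for u v d
      using that by (intro Lp) (auto simp: ebox_def topspace_Euclidean_space)
    then show ?thesis using sH unfolding strict_deriv_def by simp
  qed
  obtain d1 where d1: "0 < d1" "inj_on Hh (ebox n w d1)"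
    using strict_deriv_inj[OF sHp] p by auto
  obtain B d2 where Bd: "0 < d2" "\<And>u v. u \<in> ebox n w d2 \<Longrightarrow> v \<in> ebox n w d2 \<Longrightarrow>
     l1 n (\<lambda>i. Hh v i - Hh u i) \<le> B * l1 n (\<lambda>i. v i - u i)"
  proof -
    obtain d where d: "0 < d" "\<And>u v. u \<in> ebox n w d \<Longrightarrow> v \<in> ebox n w d \<Longrightarrow>
      l1 n (\<lambda>i. (Hh v i - Hh u i) - real p * (v i - u i)) \<le> 1 * l1 n (\<lambda>i. v i - u i)"
      using strict_derivD[OF sHp zero_less_one] by blast
    have "l1 n (\<lambda>i. Hh v i - Hh u i) \<le> (real p + 1) * l1 n (\<lambda>i. v i - u i)"
      if "u \<in> ebox n w d" "v \<in> ebox n w d" for u v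
      using d(2)[OF that] l1_scale[of n "real p" "\<lambda>i. v i - u i"]
        l1_add_le[of n "\<lambda>i. (Hh v i - Hh u i) - real p * (v i - u i)" "\<lambda>i. real p * (v i - u i)"]
      by (simp add: algebra_simps)
    then show thesis using that d(1) by blast
  qed
  define d where "d = min d0 (min d1 d2)"
  have d: "0 < d" "ebox n w d \<subseteq> ebox n w d0" "ebox n w d \<subseteq> ebox n w d1" "ebox n w d \<subseteq> ebox n w d2"
    using d0(1) d1(1) Bd(1) ebox_mono[of d d0] ebox_mono[of d d1] ebox_mono[of d d2] by (simp_all add: d_def)
  have Hcont: "continuous_map (subtopology (Euclidean_space n) (ebox n w d)) (Euclidean_space n) Hh"
    using Bd(2) d(4) HhE by (intro Lipschitz_imp_continuous_map_Euclidean[OF openin_ebox]) blast+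

  define \<Omega>1 where "\<Omega>1 = {z \<in> topspace (subtopology X U). h z \<in> ebox n w d}"
  have o1: "openin X \<Omega>1"
    unfolding \<Omega>1_def
    using openin_trans_full[OF openin_continuous_map_preimage[OF chart(5) openin_ebox] chart(1)] .
  \<comment> \<open>Intersecting the preimages of \<open>\<Omega>1\<close> under the first p
    iterates makes the domain invariant under f, again by periodicity.\<close>
  define \<Omega> where "\<Omega> = {z \<in> topspace X. \<forall>j<p. (f ^^ j) z \<in> \<Omega>1}"
  have o\<Omega>: "openin X \<Omega>"
    unfolding \<Omega>_def by (rule openin_funpow_preimage[OF fc o1])
  have \<Omega>1U: "\<Omega>1 \<subseteq> U" by (auto simp: \<Omega>1_def)
  have \<Omega>01: "\<Omega> \<subseteq> \<Omega>0" "\<Omega> \<subseteq> \<Omega>1" using \<Omega>1U p by (auto simp: \<Omega>_def \<Omega>0_def)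
  have \<Omega>X: "\<Omega> \<subseteq> topspace X" by (auto simp: \<Omega>_def)
  have x0\<Omega>: "x0 \<in> \<Omega>"
    using x0 Uh(2) wE centre_in_ebox[OF wE d(1)] by (auto simp: \<Omega>_def \<Omega>1_def fj0 w_def)
  have \<Omega>f: "f z \<in> \<Omega>" if "z \<in> \<Omega>" for z
  proof -
    have "(f ^^ j) (f z) \<in> \<Omega>1" if "j < p" for j
    proof (cases "Suc j < p")
      case True
      then show ?thesis using \<open>z \<in> \<Omega>\<close> funpow_swap1[of f j z] by (force simp: \<Omega>_def)
    next
      case False
      then have "Suc j = p" using that by simp
      then have "(f ^^ j) (f z) = z"
        using per[of z] \<open>z \<in> \<Omega>\<close> \<Omega>X by (auto simp: funpow_swap1[symmetric])
      then show ?thesis using \<open>z \<in> \<Omega>\<close> \<Omega>01 by auto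
    qed
    then show ?thesis using that fX by (auto simp: \<Omega>_def)
  qed
  have h\<Omega>: "h ` \<Omega> \<subseteq> ebox n w d" using \<Omega>01 by (auto simp: \<Omega>1_def)
  have oh\<Omega>: "openin (Euclidean_space n) (h ` \<Omega>)"
    using chart(6)[OF o\<Omega>] \<Omega>01 \<Omega>1U by blast
  have Hinj: "inj_on H \<Omega>"
  proof (rule inj_onI)
    fix y z assume yz: "y \<in> \<Omega>" "z \<in> \<Omega>" "H y = H z"
    then have "Hh (h y) = Hh (h z)" using HHh[of y] HHh[of z] \<Omega>01(1) by (metis subsetD)
    then have "h y = h z" using yz h\<Omega> d(3) d1(2) by (meson image_subset_iff inj_onD subsetD)
    then show "y = z" using chart(4) yz \<Omega>01 \<Omega>1U by (meson inj_onD subsetD)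
  qed
  have HL: "H (f z) = L (H z)" if z: "z \<in> \<Omega>" for z
  proof -
    \<comment> \<open>The summands of L (H z) are T 0, ..., T (p - 1) and those of H (f z) are T 1,
      ..., T p. The sums agree because T 0 = T p, by periodicity of f and of L.\<close>
    define T where "T = (\<lambda>j. (L ^^ (Suc p - j)) (\<lambda>i. h ((f ^^ j) z) i - w i))"
    have zX: "z \<in> topspace X" using z \<Omega>X by auto
    have zw: "(\<lambda>i. h z i - w i) \<in> topspace (Euclidean_space n)"
      using inE[of z] z \<Omega>01 \<Omega>1U wE by (auto simp: topspace_Euclidean_space)
    have "T 0 = L ((L ^^ p) (\<lambda>i. h z i - w i))" by (simp add: T_def)
    also have "\<dots> = T p" using per[OF zX] Lp[OF zw] by (simp add: T_def Suc_diff_le)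
    finally have T0: "T 0 = T p" .
    have 1: "L (H z) = (\<lambda>i. \<Sum>j<p. T j i)"
      unfolding H_def bounded_linear_upto_sum[OF L]
      by (rule ext, rule sum.cong) (simp_all add: T_def Suc_diff_le)
    have 2: "H (f z) = (\<lambda>i. \<Sum>j<p. T (Suc j) i)"
      unfolding H_def T_def by (simp add: funpow_swap1)
    have "(\<Sum>j<p. T (Suc j) i) - (\<Sum>j<p. T j i) = 0" for i
      unfolding sum_subtractf[symmetric] using sum_lessThan_telescope[of "\<lambda>j. T j i" p] T0 by simp
    then show ?thesis unfolding 1 2 by (simp add: fun_eq_iff)
  qed

  have Hh\<Omega>: "Hh ` h ` \<Omega> = H ` \<Omega>" using HHh \<Omega>01 by (force simp: image_iff)
  have cHh\<Omega>: "continuous_map (subtopology (Euclidean_space n) (h ` \<Omega>)) (Euclidean_space n) Hh"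
    using continuous_map_from_subtopology_mono[OF Hcont h\<Omega>] .
  have iHh\<Omega>: "inj_on Hh (h ` \<Omega>)"
    using d1(2) d(3) h\<Omega> inj_on_subset by (metis subset_trans)
  have oH\<Omega>: "openin (Euclidean_space n) (H ` \<Omega>)"
    using invariance_of_domain_Euclidean_space[OF oh\<Omega> cHh\<Omega> iHh\<Omega>] Hh\<Omega> by simp
  have H0: "H x0 = (\<lambda>i. 0)" using HHh[OF x00] Hhw by (simp add: w_def)
  define G where "G = inv_into \<Omega> H"
  have GH: "G (H z) = z" if "z \<in> \<Omega>" for z using that Hinj by (simp add: G_def)
  have cH: "continuous_map (subtopology X \<Omega>) (Euclidean_space n) H"
  proof (rule continuous_map_eq)
    have "continuous_map (subtopology X \<Omega>) (subtopology (Euclidean_space n) (h ` \<Omega>)) h"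
      using continuous_map_from_subtopology_mono[OF chart(5)] \<Omega>01 \<Omega>1U
      by (auto simp: continuous_map_in_subtopology)
    then show "continuous_map (subtopology X \<Omega>) (Euclidean_space n) (Hh \<circ> h)"
      using cHh\<Omega> continuous_map_compose by blast
  qed (use HHh \<Omega>01 in auto)
  have cG: "continuous_map (subtopology (Euclidean_space n) (H ` \<Omega>)) X G"
  proof -
    \<comment> \<open>Invariance of domain supplies the continuous inverse, so no inverse function
      theorem enters.\<close>
    have "embedding_map (subtopology (Euclidean_space n) (h ` \<Omega>)) (Euclidean_space n) Hh"
      by (rule invariance_of_domain_Euclidean_space_embedding_map[OF oh\<Omega> cHh\<Omega> iHh\<Omega>])
    then have "homeomorphic_map (subtopology (Euclidean_space n) (h ` \<Omega>)) (subtopology (Euclidean_space n) (H ` \<Omega>)) Hh"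
      using openin_subset[OF oh\<Omega>] Hh\<Omega> by (simp add: embedding_map_def Int_absorb1)
    then obtain k where k: "homeomorphic_maps (subtopology (Euclidean_space n) (h ` \<Omega>)) (subtopology (Euclidean_space n) (H ` \<Omega>)) Hh k"
      using homeomorphic_map_maps by blast
    have th: "topspace (subtopology (Euclidean_space n) (h ` \<Omega>)) = h ` \<Omega>"
      using openin_subset[OF oh\<Omega>] by auto
    have tH: "topspace (subtopology (Euclidean_space n) (H ` \<Omega>)) = H ` \<Omega>"
      using openin_subset[OF oH\<Omega>] by auto
    have "continuous_map (subtopology (Euclidean_space n) (H ` \<Omega>)) (subtopology (Euclidean_space n) (h ` U)) k"
      using k \<Omega>01 \<Omega>1U unfolding homeomorphic_maps_def continuous_map_in_subtopology by fastforce
    then have "continuous_map (subtopology (Euclidean_space n) (H ` \<Omega>)) X (inv_into U h \<circ> k)"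
      using chart(7) continuous_map_compose by blast
    then show ?thesis
    proof (rule continuous_map_eq)
      fix v assume "v \<in> topspace (subtopology (Euclidean_space n) (H ` \<Omega>))"
      then obtain z where z: "z \<in> \<Omega>" "v = H z" using tH by auto
      have "k (Hh (h z)) = h z" using k z th by (auto simp: homeomorphic_maps_def)
      then show "(inv_into U h \<circ> k) v = G v"
        using z HHh[of z] \<Omega>01 \<Omega>1U chart(4) GH[OF z(1)] by (simp add: subset_iff)
    qed
  qed

  show thesis
    by (rule that[of \<Omega> H L]) (use o\<Omega> x0\<Omega> \<Omega>f cH H0 Hinj oH\<Omega> cG L HL in \<open>simp_all add: G_def\<close>)
qed

text \<open>In linearised coordinates f is linear and commutes with scaling towards the origin. V is
  cut out by a box, which L need not preserve, so equivariance is claimed only where both z and f z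
  lie in V. For f = id the result is an ordinary contraction of a neighbourhood.\<close>

lemma equivariant_contraction:
  assumes X: "smooth_manifold n X A" and f: "smooth_map n X A n X A f" and p: "0 < p"
    and per: "\<And>x. x \<in> topspace X \<Longrightarrow> (f ^^ p) x = x"
    and x0: "x0 \<in> topspace X" "f x0 = x0"
  obtains V c where "openin X V" "x0 \<in> V"
    "continuous_map (prod_topology (top_of_set {0..1::real}) (subtopology X V)) X (\<lambda>(t, z). c t z)"
    "\<And>z. z \<in> V \<Longrightarrow> c 0 z = z" "\<And>z. z \<in> V \<Longrightarrow> c 1 z = x0"
    "\<And>t z. t \<in> {0..1} \<Longrightarrow> z \<in> V \<Longrightarrow> f z \<in> V \<Longrightarrow> c t (f z) = f (c t z)"
proof -
  obtain \<Omega> H L where \<Omega>: "openin X \<Omega>" "x0 \<in> \<Omega>" and \<Omega>f: "\<forall>z\<in>\<Omega>. f z \<in> \<Omega>"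
    and cH: "continuous_map (subtopology X \<Omega>) (Euclidean_space n) H" and H0: "H x0 = (\<lambda>i. 0)"
    and Hinj: "inj_on H \<Omega>" and oH\<Omega>: "openin (Euclidean_space n) (H ` \<Omega>)"
    and cG: "continuous_map (subtopology (Euclidean_space n) (H ` \<Omega>)) X (inv_into \<Omega> H)"
    and L: "bounded_linear_upto n L" and HL: "\<forall>z\<in>\<Omega>. H (f z) = L (H z)"
    by (rule linearisation_at_fixed_point[OF X f p per x0])
  define G where "G = inv_into \<Omega> H"
  have GH: "G (H z) = z" if "z \<in> \<Omega>" for z using that Hinj by (simp add: G_def)
  have HG: "H (G v) = v" "G v \<in> \<Omega>" if "v \<in> H ` \<Omega>" for v
    using that by (simp_all add: G_def f_inv_into_f inv_into_into)
  have \<Omega>X: "\<Omega> \<subseteq> topspace X" using openin_subset[OF \<Omega>(1)] .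
  have "(\<lambda>i. 0) \<in> H ` \<Omega>" using H0 \<Omega>(2) by (metis image_eqI)
  then obtain r where r: "0 < r" "ebox n (\<lambda>i. 0) r \<subseteq> H ` \<Omega>"
    using Euclidean_open_contains_ebox[OF oH\<Omega>] by blast
  \<comment> \<open>A box around the origin is closed under the scalings by 1 - t, so the
    contraction stays in the range of the linearising map.\<close>
  define V where "V = {z \<in> topspace (subtopology X \<Omega>). H z \<in> ebox n (\<lambda>i. 0) r}"
  define c where "c = (\<lambda>t z. G (\<lambda>i. (1 - t) * H z i))"
  have V\<Omega>: "V \<subseteq> \<Omega>" by (auto simp: V_def)
  have inbox: "(\<lambda>i. (1 - t) * H z i) \<in> ebox n (\<lambda>i. 0) r" if "t \<in> {0..1}" "z \<in> V" for t z
  proof -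
    have "\<bar>(1 - t) * H z i\<bar> < r" if "i < n" for i
    proof -
      have "\<bar>(1 - t) * H z i\<bar> \<le> 1 * \<bar>H z i\<bar>"
        unfolding abs_mult using \<open>t \<in> {0..1}\<close> by (intro mult_right_mono) auto
      also have "\<dots> < r" using \<open>z \<in> V\<close> that by (auto simp: V_def ebox_def)
      finally show ?thesis .
    qed
    then show ?thesis using that by (auto simp: V_def ebox_def topspace_Euclidean_space)
  qed
  show thesis
  proof (rule that[of V c])
    show "openin X V"
      unfolding V_def by (rule openin_trans_full[OF openin_continuous_map_preimage[OF cH openin_ebox] \<Omega>(1)])
    show "x0 \<in> V"
      using \<Omega>(2) \<Omega>X H0 r(1) by (auto simp: V_def ebox_def topspace_Euclidean_space)
    show "c 0 z = z" if "z \<in> V" for z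
      using GH[of z] that V\<Omega> by (auto simp: c_def)
    show "c 1 z = x0" if "z \<in> V" for z
      using GH[OF \<Omega>(2)] H0 by (simp add: c_def)
    show "c t (f z) = f (c t z)" if tz: "t \<in> {0..1}" "z \<in> V" "f z \<in> V" for t z
    proof -
      have 1: "(\<lambda>i. (1 - t) * H z i) \<in> H ` \<Omega>" "(\<lambda>i. (1 - t) * H (f z) i) \<in> H ` \<Omega>"
        using inbox tz r(2) by blast+
      have "H (f (c t z)) = L (H (c t z))" using HG(2)[OF 1(1)] by (simp add: HL c_def)
      also have "\<dots> = (\<lambda>i. (1 - t) * L (H z) i)"
        using HG(1)[OF 1(1)] by (simp add: c_def bounded_linear_uptoD(2)[OF L])
      also have "\<dots> = H (c t (f z))"
        using HG(1)[OF 1(2)] tz V\<Omega> by (simp add: c_def HL subset_iff)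
      finally show ?thesis
        using Hinj HG(2)[OF 1(1)] HG(2)[OF 1(2)] \<Omega>f by (auto simp: c_def dest!: inj_onD)
    qed
    let ?P = "prod_topology (top_of_set {0..1::real}) (subtopology X V)"
    have tP: "topspace ?P = {0..1} \<times> V" using V\<Omega> \<Omega>X by auto
    have "continuous_map ?P (subtopology (Euclidean_space n) (H ` \<Omega>)) (\<lambda>(t, z) i. (1 - t) * H z i)"
      unfolding continuous_map_in_subtopology
    proof
      show "(\<lambda>(t, z) i. (1 - t) * H z i) \<in> topspace ?P \<rightarrow> H ` \<Omega>"
        using inbox r(2) unfolding tP by auto
      show "continuous_map ?P (Euclidean_space n) (\<lambda>(t, z) i. (1 - t) * H z i)"
      proof (rule continuous_map_into_Euclidean_space)
        show "(\<lambda>(t, z) i. (1 - t) * H z i) \<in> topspace ?P \<rightarrow> topspace (Euclidean_space n)"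
          using inbox ebox_subset[of n "\<lambda>i. 0" r] unfolding tP by (auto simp: subset_iff)
        fix i assume i: "i < n"
        have "continuous_map (subtopology X V) (Euclidean_space n) H"
          using continuous_map_from_subtopology_mono[OF cH V\<Omega>] .
        then have "continuous_map (subtopology X V) euclideanreal (\<lambda>z. H z i)"
          using continuous_map_compose[OF _ continuous_map_Euclidean_coordinate] by (simp add: o_def)
        from continuous_map_compose[OF continuous_map_snd this]
        have "continuous_map ?P euclideanreal (\<lambda>q. H (snd q) i)" by (simp add: o_def)
        moreover have "continuous_map ?P euclideanreal fst"
          using continuous_map_fst continuous_map_into_fulltopology by blast
        ultimately have "continuous_map ?P euclideanreal (\<lambda>q. (1 - fst q) * H (snd q) i)"
          by (intro continuous_intros)
        then show "continuous_map ?P euclideanreal (\<lambda>q. (case q of (t, z) \<Rightarrow> \<lambda>i. (1 - t) * H z i) i)"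
          by (simp add: case_prod_unfold)
      qed
    qed
    from continuous_map_compose[OF this cG] show "continuous_map ?P X (\<lambda>(t, z). c t z)"
      by (simp add: o_def c_def G_def case_prod_unfold)
  qed
qed

section \<open>The infinite cyclic cover of the mapping torus\<close>

text \<open>Openness passes to products, whereas being a quotient map does not in general. This is
  why the projection to M is proved open before M x M and M x M x [0,1] are considered.\<close>

lemma open_map_prod:
  assumes "open_map X X' f" "open_map Y Y' g"
  shows "open_map (prod_topology X Y) (prod_topology X' Y') (\<lambda>(x, y). (f x, g y))"
  unfolding open_map_def
proof (intro allI impI)
  fix W assume W: "openin (prod_topology X Y) W"
  show "openin (prod_topology X' Y') ((\<lambda>(x, y). (f x, g y)) ` W)"
    unfolding openin_prod_topology_alt
  proof (intro allI impI)
    fix a b assume "(a, b) \<in> (\<lambda>(x, y). (f x, g y)) ` W"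
    then obtain x y where xy: "(x, y) \<in> W" "a = f x" "b = g y" by auto
    then obtain U V where UV: "openin X U" "openin Y V" "x \<in> U" "y \<in> V" "U \<times> V \<subseteq> W"
      using W[unfolded openin_prod_topology_alt, rule_format, OF xy(1)] by blast
    show "\<exists>U V. openin X' U \<and> openin Y' V \<and> a \<in> U \<and> b \<in> V \<and> U \<times> V \<subseteq> (\<lambda>(x, y). (f x, g y)) ` W"
    proof (intro exI conjI)
      show "openin X' (f ` U)" "openin Y' (g ` V)" using UV assms by (auto simp: open_map_def)
      show "a \<in> f ` U" "b \<in> g ` V" using UV xy by auto
      show "f ` U \<times> g ` V \<subseteq> (\<lambda>(x, y). (f x, g y)) ` W" using UV(5) by fastforce
    qed
  qed
qed

locale periodic_map =
  fixes X :: "'a topology" and \<phi> :: "'a \<Rightarrow> 'a" and p :: nat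
  assumes cont: "continuous_map X X \<phi>" and p_pos: "0 < p"
    and period: "\<And>x. x \<in> topspace X \<Longrightarrow> (\<phi> ^^ p) x = x"
begin

text \<open>The integer powers of \<open>\<phi>\<close>. Reducing the exponent modulo the period
  makes negative powers available without an inverse function.\<close>

definition \<psi> :: "int \<Rightarrow> 'a \<Rightarrow> 'a" where
  "\<psi> k = \<phi> ^^ nat (k mod int p)"

lemma funpow_in: "x \<in> topspace X \<Longrightarrow> (\<phi> ^^ j) x \<in> topspace X"
  using cont by (induction j) (auto simp: continuous_map_def)

lemma funpow_mod: "x \<in> topspace X \<Longrightarrow> (\<phi> ^^ (j mod p)) x = (\<phi> ^^ j) x"
proof (induction j rule: less_induct)
  case (less j)
  show ?case
  proof (cases "j < p")
    case False
    then have "(\<phi> ^^ j) x = (\<phi> ^^ (j - p)) ((\<phi> ^^ p) x)"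
      by (metis comp_apply funpow_add le_add_diff_inverse2 not_less)
    also have "\<dots> = (\<phi> ^^ (j mod p)) x"
      using less.IH[of "j - p"] less.prems period False p_pos by (simp add: le_mod_geq)
    finally show ?thesis by simp
  qed simp
qed

lemma \<psi>_in: "x \<in> topspace X \<Longrightarrow> \<psi> k x \<in> topspace X"
  by (simp add: \<psi>_def funpow_in)

lemma \<psi>_of_nat: "x \<in> topspace X \<Longrightarrow> \<psi> (int j) x = (\<phi> ^^ j) x"
  by (simp add: \<psi>_def funpow_mod zmod_int[symmetric])

lemma \<psi>_0 [simp]: "\<psi> 0 = id"
  by (simp add: \<psi>_def id_def)

lemma \<psi>_1: "x \<in> topspace X \<Longrightarrow> \<psi> 1 x = \<phi> x"
  using \<psi>_of_nat[of x 1] by simp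

lemma \<psi>_add: "x \<in> topspace X \<Longrightarrow> \<psi> (k + l) x = \<psi> k (\<psi> l x)"
proof -
  assume x: "x \<in> topspace X"
  have "\<psi> k (\<psi> l x) = (\<phi> ^^ (nat (k mod p) + nat (l mod p))) x"
    by (simp add: \<psi>_def funpow_add)
  also have "\<dots> = (\<phi> ^^ ((nat (k mod p) + nat (l mod p)) mod p)) x"
    by (simp add: funpow_mod x)
  also have "(nat (k mod p) + nat (l mod p)) mod p = nat ((k + l) mod p)"
  proof -
    have "int ((nat (k mod p) + nat (l mod p)) mod p) = int (nat ((k + l) mod p))"
      using p_pos by (simp add: zmod_int mod_add_eq)
    then show ?thesis by linarith
  qed
  finally show ?thesis by (simp add: \<psi>_def)
qed

lemma \<psi>_inverse [simp]: "x \<in> topspace X \<Longrightarrow> \<psi> (- k) (\<psi> k x) = x" "x \<in> topspace X \<Longrightarrow> \<psi> k (\<psi> (- k) x) = x"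
  using \<psi>_add[of x "- k" k] \<psi>_add[of x k "- k"] by simp_all

lemma continuous_\<psi>: "continuous_map X X (\<psi> k)"
  unfolding \<psi>_def by (rule continuous_map_funpow[OF cont])

text \<open>The deck transformations of the infinite cyclic cover. The sign is forced by the gluing:
  \<open>shift (-1)\<close> sends (1, x) to (0, \<open>\<phi>\<close> x).\<close>

definition shift :: "int \<Rightarrow> real \<times> 'a \<Rightarrow> real \<times> 'a" where
  "shift k a = (fst a + of_int k, \<psi> (- k) (snd a))"

definition line :: "(real \<times> 'a) topology" where
  "line = prod_topology euclideanreal X"

lemma topspace_line [simp]: "topspace line = UNIV \<times> topspace X"
  by (simp add: line_def)

lemma shift_in: "a \<in> topspace line \<Longrightarrow> shift k a \<in> topspace line"
  by (auto simp: shift_def \<psi>_in)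

lemma shift_shift: "a \<in> topspace line \<Longrightarrow> shift k (shift l a) = shift (k + l) a"
  by (auto simp: shift_def \<psi>_add[symmetric] algebra_simps)

lemma shift_0 [simp]: "shift 0 a = a"
  by (simp add: shift_def)

lemma shift_inverse: "a \<in> topspace line \<Longrightarrow> shift (- k) (shift k a) = a" "a \<in> topspace line \<Longrightarrow> shift k (shift (- k) a) = a"
  by (simp_all add: shift_shift del: topspace_line)

lemma continuous_shift: "continuous_map line line (shift k)"
proof -
  have "continuous_map line X (\<psi> (- k) \<circ> snd)"
    unfolding line_def by (rule continuous_map_compose[OF continuous_map_snd continuous_\<psi>])
  moreover have "continuous_map line euclideanreal (\<lambda>a. fst a + of_int k)"
    unfolding line_def by (intro continuous_intros)
  ultimately show ?thesis
    unfolding shift_def[abs_def] by (subst (2) line_def) (simp add: continuous_map_pairedI o_def)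
qed

lemma openin_shift_image:
  assumes "openin line W" shows "openin line (shift k ` W)"
proof -
  have "shift k ` W = {a \<in> topspace line. shift (- k) a \<in> W}"
    using openin_subset[OF assms] shift_inverse shift_in
    by (auto simp: image_iff subset_iff simp del: topspace_line) metis+
  then show ?thesis using openin_continuous_map_preimage[OF continuous_shift assms] by simp
qed

text \<open>Replaces a generated equivalence by a group action. Between points of [0,1] x X only k =
  -1, 0, 1 can occur, and k = 1 or -1 forces the two ends of the interval, which is a single gluing
  step.\<close>

lemma mapping_torus_rel_iff:
  assumes a: "a \<in> {0..1} \<times> topspace X" and b: "b \<in> {0..1} \<times> topspace X"
  shows "(a, b) \<in> mapping_torus_rel X \<phi> \<longleftrightarrow> (\<exists>k. b = shift k a)"
proof
  let ?r = "\<lambda>a b. \<exists>x\<in>topspace X. a = (1::real, x) \<and> b = (0, \<phi> x)"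
  assume "(a, b) \<in> mapping_torus_rel X \<phi>"
  then have "equivclp ?r a b" by (simp add: mapping_torus_rel_def)
  \<comment> \<open>The induction also carries membership in the cover, since
    \<open>shift_shift\<close> holds only there.\<close>
  then have "b \<in> topspace line \<and> (\<exists>k. b = shift k a)"
  proof (induction rule: equivclp_induct)
    case base
    show ?case using a by (auto intro!: exI[of _ 0])
  next
    case (step y z)
    then obtain k where k: "y \<in> topspace line" "y = shift k a" by blast
    have "\<exists>l. z = shift l y \<and> z \<in> topspace line"
      using step.hyps(2)
    proof
      assume "?r y z"
      then obtain x where "x \<in> topspace X" "y = (1, x)" "z = (0, \<phi> x)" by blast
      then show ?thesis
        using funpow_in[of x 1] by (intro exI[of _ "-1"]) (simp add: shift_def \<psi>_1)
    next
      assume "?r z y"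
      then obtain x where "x \<in> topspace X" "z = (1, x)" "y = (0, \<phi> x)" by blast
      then show ?thesis
        using \<psi>_inverse(1)[of x 1] by (intro exI[of _ 1]) (simp add: shift_def \<psi>_1)
    qed
    then obtain l where l: "z = shift l y" "z \<in> topspace line" by blast
    have "a \<in> topspace line" using a by auto
    then have "z = shift (l + k) a" using l(1) k(2) shift_shift by simp
    then show ?case using l(2) by blast
  qed
  then show "\<exists>k. b = shift k a" by blast
next
  let ?r = "\<lambda>a b. \<exists>x\<in>topspace X. a = (1::real, x) \<and> b = (0, \<phi> x)"
  assume "\<exists>k. b = shift k a"
  then obtain k where k: "b = shift k a" by blast
  obtain t x where tx: "a = (t, x)" "0 \<le> t" "t \<le> 1" "x \<in> topspace X" using a by auto
  have "0 \<le> t + of_int k" "t + of_int k \<le> 1" using b k tx by (auto simp: shift_def)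
  with tx have "- 1 \<le> real_of_int k" "real_of_int k \<le> 1" by linarith+
  then have "k = -1 \<or> k = 0 \<or> k = 1" by linarith
  then have "equivclp ?r a b"
  proof (elim disjE)
    assume k1: "k = -1"
    then have "t = 1" using \<open>0 \<le> t + of_int k\<close> tx by simp
    then have "?r a b" using k k1 tx by (auto simp: shift_def \<psi>_1)
    then show ?thesis by (rule r_into_equivclp)
  next
    assume "k = 0"
    then show ?thesis using k by simp
  next
    assume k1: "k = 1"
    then have "t = 0" using \<open>t + of_int k \<le> 1\<close> tx by simp
    then have "?r b a" using k k1 tx \<psi>_in \<psi>_inverse(2)[of x 1]
      by (auto simp: shift_def \<psi>_1[symmetric])
    then show ?thesis by (rule equivclp_sym[OF r_into_equivclp])
  qed
  then show "(a, b) \<in> mapping_torus_rel X \<phi>"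
    using a b by (simp add: mapping_torus_rel_def)
qed

abbreviation M :: "(real \<times> 'a) set topology" where
  "M \<equiv> mapping_torus X \<phi>"

text \<open>The class of \<open>a\<close>, described by deck transformations so that it makes sense on all of \<open>\<real> \<times> X\<close>.\<close>

definition q :: "real \<times> 'a \<Rightarrow> (real \<times> 'a) set" where
  "q a = {b \<in> {0..1} \<times> topspace X. \<exists>k. b = shift k a}"

lemma q_shift:
  assumes a: "a \<in> topspace line"
  shows "q (shift k a) = q a"
proof -
  have "(\<exists>l. b = shift l (shift k a)) \<longleftrightarrow> (\<exists>l. b = shift l a)" for b
    using shift_shift[OF a] by (metis diff_add_cancel)
  then show ?thesis by (simp add: q_def)
qed

lemma q_rel: "a \<in> {0..1} \<times> topspace X \<Longrightarrow> mapping_torus_rel X \<phi> `` {a} = q a"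
  using mapping_torus_rel_iff[of a] by (auto simp: q_def mapping_torus_rel_def)

lemma representative:
  assumes "a \<in> topspace line"
  shows "shift (- \<lfloor>fst a\<rfloor>) a \<in> {0..<1} \<times> topspace X"
proof -
  have "fst a - of_int \<lfloor>fst a\<rfloor> < 1" "0 \<le> fst a - of_int \<lfloor>fst a\<rfloor>" by linarith+
  then show ?thesis using assms by (auto simp: shift_def \<psi>_in)
qed

lemma q_eq_iff:
  assumes a: "a \<in> topspace line" and b: "b \<in> topspace line"
  shows "q a = q b \<longleftrightarrow> (\<exists>k. b = shift k a)"
proof
  assume eq: "q a = q b"
  have "shift (- \<lfloor>fst a\<rfloor>) a \<in> q a"
    using representative[OF a] by (auto simp: q_def)
  then have "shift (- \<lfloor>fst a\<rfloor>) a \<in> q b" using eq by simp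
  then obtain l where "shift (- \<lfloor>fst a\<rfloor>) a = shift l b" by (auto simp: q_def)
  then have "b = shift (- l) (shift (- \<lfloor>fst a\<rfloor>) a)" using shift_inverse[OF b] by simp
  then show "\<exists>k. b = shift k a" using shift_shift[OF a] by auto
qed (use q_shift[OF a] in auto)

lemma quotient_map_unit:
  "quotient_map (prod_topology (top_of_set {0..1}) X) M q"
proof -
  let ?U = "prod_topology (top_of_set {0..1::real}) X"
  have t: "topspace ?U = {0..1} \<times> topspace X" by simp
  have "equiv (topspace ?U) (mapping_torus_rel X \<phi>)"
    unfolding t by (rule equiv_mapping_torus_rel)
  from quotient_map_quotient_topology[OF this]
  have "quotient_map ?U M (\<lambda>a. mapping_torus_rel X \<phi> `` {a})" by (simp add: mapping_torus_def)
  then show ?thesis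
    by (rule quotient_map_eq) (use q_rel t in auto)
qed

lemma q_image_unit: "q ` ({0..1} \<times> topspace X) = topspace M"
  using quotient_imp_surjective_map[OF quotient_map_unit] by simp

lemma q_image: "q ` topspace line = topspace M"
proof -
  have "q ` topspace line \<subseteq> q ` ({0..1} \<times> topspace X)"
  proof
    fix z assume "z \<in> q ` topspace line"
    then obtain a where a: "a \<in> topspace line" "z = q a" by blast
    then have "z = q (shift (- \<lfloor>fst a\<rfloor>) a)" by (simp add: q_shift del: topspace_line)
    then show "z \<in> q ` ({0..1} \<times> topspace X)" using representative[OF a(1)] by force
  qed
  moreover have "q ` ({0..1} \<times> topspace X) \<subseteq> q ` topspace line" by (intro image_mono) auto
  ultimately show ?thesis using q_image_unit by auto
qed

text \<open>The quotient construction gives continuity on the strip [0,1] x X. The translates of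
  this strip are a locally finite closed cover, and on the k-th one q agrees with q after shifting
  back by k.\<close>

lemma continuous_q: "continuous_map line M q"
proof (rule pasting_lemma_locally_finite[where I = "UNIV :: int set"
      and T = "\<lambda>k. {of_int k..of_int k + 1} \<times> topspace X" and f = "\<lambda>_. q"])
  fix a assume a: "a \<in> topspace line"
  show "\<exists>V. openin line V \<and> a \<in> V \<and> finite {k \<in> UNIV. {of_int k..of_int k + 1} \<times> topspace X \<inter> V \<noteq> {}}"
  proof (intro exI[of _ "{fst a - 1<..<fst a + 1} \<times> topspace X"] conjI)
    show "openin line ({fst a - 1<..<fst a + 1} \<times> topspace X)"
      unfolding line_def by (simp add: openin_prod_Times_iff)
    have "{k \<in> UNIV. {of_int k..of_int k + 1} \<times> topspace X \<inter> {fst a - 1<..<fst a + 1} \<times> topspace X \<noteq> {}}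
        \<subseteq> {\<lfloor>fst a\<rfloor> - 3..\<lfloor>fst a\<rfloor> + 3}"
    proof
      fix k :: int
      assume "k \<in> {k \<in> UNIV. {of_int k..of_int k + 1} \<times> topspace X \<inter> {fst a - 1<..<fst a + 1} \<times> topspace X \<noteq> {}}"
      then obtain t where "of_int k \<le> t" "t \<le> of_int k + 1" "fst a - 1 < t" "t < fst a + 1" by auto
      then have "\<bar>of_int k - fst a\<bar> \<le> 2" by linarith
      then show "k \<in> {\<lfloor>fst a\<rfloor> - 3..\<lfloor>fst a\<rfloor> + 3}" by simp linarith
    qed
    then show "finite {k \<in> UNIV. {of_int k..of_int k + 1} \<times> topspace X \<inter> {fst a - 1<..<fst a + 1} \<times> topspace X \<noteq> {}}"
      using finite_subset by blast
  qed (use a in auto)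
next
  fix k :: int
  show "closedin line ({of_int k..of_int k + 1} \<times> topspace X)"
    unfolding line_def by (simp add: closedin_prod_Times_iff)
  let ?T = "subtopology line ({of_int k..of_int k + 1} \<times> topspace X)"
  have "continuous_map ?T line (shift (- k))"
    using continuous_shift continuous_map_from_subtopology by blast
  then have "continuous_map ?T (prod_topology (top_of_set {0..1}) X) (shift (- k))"
    unfolding line_def continuous_map_pairwise continuous_map_in_subtopology
    by (auto simp: shift_def)
  from continuous_map_compose[OF this quotient_imp_continuous_map[OF quotient_map_unit]]
  have "continuous_map ?T M (q \<circ> shift (- k))" .
  then show "continuous_map ?T M q"
    by (rule continuous_map_eq) (simp add: q_shift)
next
  fix a assume "a \<in> topspace line"
  then show "\<exists>k. k \<in> UNIV \<and> a \<in> {of_int k..of_int k + 1} \<times> topspace X \<and> q a = q a"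
    by (intro exI[of _ "\<lfloor>fst a\<rfloor>"]) (auto simp: less_imp_le[OF floor_less_iff[THEN iffD1]] mem_Times_iff)
qed auto

text \<open>As for every quotient by a group of homeomorphisms: the saturation of an open W is the
  union of its translates, hence open, and its trace on the unit strip decides openness in
  M.\<close>

lemma open_map_q: "open_map line M q"
  unfolding open_map_def
proof (intro allI impI)
  fix W assume W: "openin line W"
  let ?U = "prod_topology (top_of_set {0..1::real}) X"
  have sub: "?U = subtopology line ({0..1} \<times> topspace X)"
    unfolding line_def by (simp add: prod_topology_subtopology(1) Int_commute subtopology_subtopology)
  have WM: "q ` W \<subseteq> topspace M" using openin_subset[OF W] q_image by blast
  have "{a \<in> topspace ?U. q a \<in> q ` W} = ({0..1} \<times> topspace X) \<inter> (\<Union>k. shift k ` W)"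
  proof -
    have iff: "q a \<in> q ` W \<longleftrightarrow> (\<exists>k. a \<in> shift k ` W)" if a: "a \<in> topspace line" for a
    proof
      assume "q a \<in> q ` W"
      then obtain w where w: "w \<in> W" "q w = q a" by (metis imageE)
      then have "w \<in> topspace line" using openin_subset[OF W] by blast
      then show "\<exists>k. a \<in> shift k ` W" using q_eq_iff[OF _ a] w by blast
    next
      assume "\<exists>k. a \<in> shift k ` W"
      then obtain k w where w: "w \<in> W" "a = shift k w" by blast
      then have "w \<in> topspace line" using openin_subset[OF W] by blast
      then show "q a \<in> q ` W" using q_shift w by simp
    qed
    show ?thesis
    proof (rule Set.set_eqI)
      fix a
      have "a \<in> {0..1} \<times> topspace X \<Longrightarrow> a \<in> topspace line" by auto
      then show "a \<in> {a \<in> topspace ?U. q a \<in> q ` W} \<longleftrightarrow> a \<in> ({0..1} \<times> topspace X) \<inter> (\<Union>k. shift k ` W)"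
        using iff[of a] by (cases "a \<in> {0..1} \<times> topspace X") simp_all
    qed
  qed
  moreover have "openin line (\<Union>k. shift k ` W)" using openin_shift_image[OF W] by blast
  ultimately have "openin ?U {a \<in> topspace ?U. q a \<in> q ` W}"
    unfolding sub by (auto simp: openin_subtopology)
  then show "openin M (q ` W)"
    using quotient_map_unit WM unfolding quotient_map_def by blast
qed

lemma compact_M: "compact_space X \<Longrightarrow> compact_space M"
proof -
  assume "compact_space X"
  then have "compact_space (prod_topology (top_of_set {0..1::real}) X)"
    by (simp add: compact_space_prod_topology compact_space_subtopology)
  then have "compactin (prod_topology (top_of_set {0..1::real}) X) ({0..1} \<times> topspace X)"
    by (simp add: compact_space_def)
  from image_compactin[OF this quotient_imp_continuous_map[OF quotient_map_unit]]
  show "compact_space M" unfolding compact_space_def q_image_unit .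
qed

end

section \<open>An invariant metric with polynomially many small balls\<close>

text \<open>R stands for a pseudometric such as the distance between values of a function. The bound
  is local at h x, so it survives a change of chart.\<close>

definition Lipschitz_in_chart ::
  "nat \<Rightarrow> ('a \<Rightarrow> 'a \<Rightarrow> real) \<Rightarrow> 'a set \<Rightarrow> ('a \<Rightarrow> nat \<Rightarrow> real) \<Rightarrow> 'a \<Rightarrow> bool" where
  "Lipschitz_in_chart n R U h x \<longleftrightarrow> (\<exists>B\<ge>0. \<exists>d>0. ebox n (h x) d \<subseteq> h ` U \<and>
     (\<forall>u\<in>ebox n (h x) d. \<forall>v\<in>ebox n (h x) d.
        R (inv_into U h u) (inv_into U h v) \<le> B * l1 n (\<lambda>i. v i - u i)))"

lemma Lipschitz_in_chartI:
  assumes "0 \<le> B" "0 < d" "ebox n (h x) d \<subseteq> h ` U"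
    and "\<And>u v. u \<in> ebox n (h x) d \<Longrightarrow> v \<in> ebox n (h x) d \<Longrightarrow>
        R (inv_into U h u) (inv_into U h v) \<le> B * l1 n (\<lambda>i. v i - u i)"
  shows "Lipschitz_in_chart n R U h x"
  using assms unfolding Lipschitz_in_chart_def by meson

lemma Lipschitz_in_chart_add:
  assumes "Lipschitz_in_chart n R U h x" "Lipschitz_in_chart n S U h x"
  shows "Lipschitz_in_chart n (\<lambda>y z. R y z + S y z) U h x"
proof -
  obtain B d where 1: "0 \<le> B" "0 < d" "ebox n (h x) d \<subseteq> h ` U"
    "\<forall>u\<in>ebox n (h x) d. \<forall>v\<in>ebox n (h x) d. R (inv_into U h u) (inv_into U h v) \<le> B * l1 n (\<lambda>i. v i - u i)"
    using assms(1) unfolding Lipschitz_in_chart_def by meson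
  obtain B' d' where 2: "0 \<le> B'" "0 < d'" "ebox n (h x) d' \<subseteq> h ` U"
    "\<forall>u\<in>ebox n (h x) d'. \<forall>v\<in>ebox n (h x) d'. S (inv_into U h u) (inv_into U h v) \<le> B' * l1 n (\<lambda>i. v i - u i)"
    using assms(2) unfolding Lipschitz_in_chart_def by meson
  have sub: "ebox n (h x) (min d d') \<subseteq> ebox n (h x) d" "ebox n (h x) (min d d') \<subseteq> ebox n (h x) d'"
    by (simp_all add: ebox_mono)
  show ?thesis
  proof (rule Lipschitz_in_chartI[of "B + B'" "min d d'"])
    fix u v assume "u \<in> ebox n (h x) (min d d')" "v \<in> ebox n (h x) (min d d')"
    then have "R (inv_into U h u) (inv_into U h v) \<le> B * l1 n (\<lambda>i. v i - u i)"
      "S (inv_into U h u) (inv_into U h v) \<le> B' * l1 n (\<lambda>i. v i - u i)"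
      using 1(4) 2(4) sub by (meson subsetD)+
    then show "R (inv_into U h u) (inv_into U h v) + S (inv_into U h u) (inv_into U h v)
        \<le> (B + B') * l1 n (\<lambda>i. v i - u i)"
      by (simp add: distrib_right)
  qed (use 1 2 sub in auto)
qed

lemma Lipschitz_in_chart_sum:
  assumes "finite I" "\<And>i. i \<in> I \<Longrightarrow> Lipschitz_in_chart n (R i) U h x"
    and ch: "chart n X (U, h)" and x: "x \<in> U"
  shows "Lipschitz_in_chart n (\<lambda>y z. \<Sum>i\<in>I. R i y z) U h x"
  using assms(1,2)
proof (induction I)
  case empty
  have "h x \<in> h ` U" using x by simp
  then obtain d where "0 < d" "ebox n (h x) d \<subseteq> h ` U"
    using Euclidean_open_contains_ebox[OF chartD(3)[OF ch]] by blast
  then show ?case by (intro Lipschitz_in_chartI[of 0 d]) auto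
next
  case (insert i I)
  then show ?case using Lipschitz_in_chart_add[of n "R i" U h x "\<lambda>y z. \<Sum>i\<in>I. R i y z"] by simp
qed

text \<open>A strictly differentiable coordinate expression is Lipschitz near the point. With f = id
  this is independence of the chart; with \<open>\<phi>\<close> it permits averaging.\<close>

lemma Lipschitz_in_chart_pullback:
  assumes X: "smooth_manifold n X A" and f: "smooth_map n X A n X A f"
    and U: "(U, h) \<in> A" and V: "(V, k) \<in> A" and x: "x \<in> U" "f x \<in> V"
    and R: "Lipschitz_in_chart n R V k (f x)"
  shows "Lipschitz_in_chart n (\<lambda>y z. R (f y) (f z)) U h x"
proof -
  have cU: "chart n X (U, h)" and cV: "chart n X (V, k)"
    using X U V by (auto simp: smooth_manifold_def)
  have fc: "continuous_map X X f" using f by (simp add: smooth_map_def)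
  let ?D = "U \<inter> {y \<in> topspace X. f y \<in> V}"
  have oD: "openin X ?D"
    using chartD(1)[OF cU] openin_continuous_map_preimage[OF fc chartD(1)[OF cV]] by auto
  have ohD: "openin (Euclidean_space n) (h ` ?D)" by (rule chartD(6)[OF cU oD]) auto
  have "h x \<in> h ` ?D" using x chartD(2)[OF cU] by auto
  then obtain d0 where d0: "0 < d0" "ebox n (h x) d0 \<subseteq> h ` ?D"
    using Euclidean_open_contains_ebox[OF ohD] by blast
  define G where "G = (\<lambda>u. k (f (inv_into U h u)))"
  have inv: "inv_into U h u \<in> U" "f (inv_into U h u) \<in> V" if "u \<in> ebox n (h x) d0" for u
    using that d0(2) chartD(4)[OF cU] by auto
  have wE: "h x \<in> topspace (Euclidean_space n)" using chart_image_in_Euclidean[OF cU x(1)] .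
  have GE: "\<exists>d>0. \<forall>u\<in>ebox n (h x) d. G u \<in> topspace (Euclidean_space n)"
    using d0(1) inv(2) chart_image_in_Euclidean[OF cV] unfolding G_def by blast
  obtain L where L: "bounded_linear_upto n L" "strict_deriv n G L (h x)"
    using smooth_map_strict_deriv[OF X f U V x] unfolding G_def by blast
  obtain B d where B: "0 \<le> B" "0 < d" "ebox n (k (f x)) d \<subseteq> k ` V"
    "\<And>u v. u \<in> ebox n (k (f x)) d \<Longrightarrow> v \<in> ebox n (k (f x)) d \<Longrightarrow>
       R (inv_into V k u) (inv_into V k v) \<le> B * l1 n (\<lambda>i. v i - u i)"
    using R unfolding Lipschitz_in_chart_def by meson
  have Gx: "G (h x) = k (f x)" using x chartD(4)[OF cU] by (simp add: G_def)
  obtain d1 where d1: "0 < d1" "\<And>u. u \<in> ebox n (h x) d1 \<Longrightarrow> G u \<in> ebox n (k (f x)) d"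
    using strict_deriv_maps_to[OF L wE B(2) GE] Gx by metis
  obtain C d2 where C: "0 \<le> C" "0 < d2" "\<And>u v. u \<in> ebox n (h x) d2 \<Longrightarrow> v \<in> ebox n (h x) d2 \<Longrightarrow>
     l1 n (\<lambda>i. G v i - G u i) \<le> C * l1 n (\<lambda>i. v i - u i)"
    using strict_deriv_Lipschitz[OF L] by blast
  define d3 where "d3 = min d0 (min d1 d2)"
  have sub: "ebox n (h x) d3 \<subseteq> ebox n (h x) d0" "ebox n (h x) d3 \<subseteq> ebox n (h x) d1"
    "ebox n (h x) d3 \<subseteq> ebox n (h x) d2"
    by (simp_all add: d3_def ebox_mono)
  show ?thesis
  proof (rule Lipschitz_in_chartI[of "B * C" d3])
    show "0 \<le> B * C" "0 < d3" using B C d0 d1 by (auto simp: d3_def)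
    show "ebox n (h x) d3 \<subseteq> h ` U" using sub(1) d0(2) by blast
    fix u v assume uv: "u \<in> ebox n (h x) d3" "v \<in> ebox n (h x) d3"
    then have "R (inv_into V k (G u)) (inv_into V k (G v)) \<le> B * l1 n (\<lambda>i. G v i - G u i)"
      using B(4) d1(2) sub(2) by blast
    moreover have "inv_into V k (G u) = f (inv_into U h u)" "inv_into V k (G v) = f (inv_into U h v)"
      using uv sub(1) inv(2) chartD(4)[OF cV] by (auto simp: G_def)
    moreover have "B * l1 n (\<lambda>i. G v i - G u i) \<le> B * (C * l1 n (\<lambda>i. v i - u i))"
      using C(3) uv sub(3) B(1) by (intro mult_left_mono) blast+
    ultimately show "R (f (inv_into U h u)) (f (inv_into U h v)) \<le> B * C * l1 n (\<lambda>i. v i - u i)"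
      by (simp add: mult.assoc)
  qed
qed

section \<open>Locally Lipschitz functions on a manifold\<close>

definition chartwise_Lipschitz ::
  "nat \<Rightarrow> 'a topology \<Rightarrow> ('a set \<times> ('a \<Rightarrow> nat \<Rightarrow> real)) set \<Rightarrow> ('a \<Rightarrow> real) \<Rightarrow> bool" where
  "chartwise_Lipschitz n X A F \<longleftrightarrow> continuous_map X euclideanreal F \<and>
     (\<forall>x\<in>topspace X. \<forall>(U, h)\<in>A. x \<in> U \<longrightarrow> Lipschitz_in_chart n (\<lambda>y z. \<bar>F y - F z\<bar>) U h x)"

lemma chartwise_Lipschitz_comp:
  assumes X: "smooth_manifold n X A" and f: "smooth_map n X A n X A f" and F: "chartwise_Lipschitz n X A F"
  shows "chartwise_Lipschitz n X A (F \<circ> f)"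
proof -
  have fc: "continuous_map X X f" using f by (simp add: smooth_map_def)
  have "Lipschitz_in_chart n (\<lambda>y z. \<bar>F (f y) - F (f z)\<bar>) U h x"
    if x: "x \<in> topspace X" and U: "(U, h) \<in> A" "x \<in> U" for x U h
  proof -
    have fx: "f x \<in> topspace X" using fc x by (auto simp: continuous_map_def)
    obtain V k where V: "(V, k) \<in> A" "f x \<in> V" using smooth_manifold_chart[OF X fx] .
    then have "Lipschitz_in_chart n (\<lambda>y z. \<bar>F y - F z\<bar>) V k (f x)"
      using F fx unfolding chartwise_Lipschitz_def by blast
    from Lipschitz_in_chart_pullback[OF X f U(1) V(1) U(2) V(2) this] show ?thesis .
  qed
  moreover have "continuous_map X euclideanreal (F \<circ> f)"
    using F continuous_map_compose[OF fc] by (auto simp: chartwise_Lipschitz_def)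
  ultimately show ?thesis by (auto simp: chartwise_Lipschitz_def)
qed

lemma chartwise_Lipschitz_funpow:
  assumes X: "smooth_manifold n X A" and f: "smooth_map n X A n X A f" and F: "chartwise_Lipschitz n X A F"
  shows "chartwise_Lipschitz n X A (F \<circ> (f ^^ k))"
proof (induction k)
  case 0 show ?case using F by (simp add: id_def[symmetric])
next
  case (Suc k)
  have "F \<circ> (f ^^ Suc k) = (F \<circ> (f ^^ k)) \<circ> f" by (simp add: fun_eq_iff funpow_swap1)
  then show ?case using chartwise_Lipschitz_comp[OF X f Suc] by (simp only:)
qed

lemma compactin_closed_box:
  assumes "w \<in> topspace (Euclidean_space n)"
  shows "compactin (Euclidean_space n) {u \<in> topspace (Euclidean_space n). \<forall>i<n. \<bar>u i - w i\<bar> \<le> r}"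
proof -
  have eq: "{u \<in> topspace (Euclidean_space n). \<forall>i<n. \<bar>u i - w i\<bar> \<le> r} =
      PiE UNIV (\<lambda>i. if i < n then {w i - r..w i + r} else {0})" (is "?C = ?P")
  proof (rule Set.set_eqI)
    fix u show "u \<in> ?C \<longleftrightarrow> u \<in> ?P"
      by (auto simp: topspace_Euclidean_space PiE_iff abs_le_iff not_less)
  qed
  have "compactin (powertop_real UNIV) ?P"
    unfolding compactin_PiE by (auto simp: compactin_euclidean_iff)
  then show ?thesis
    unfolding eq Euclidean_space_def compactin_subtopology
    using eq by (auto simp: topspace_Euclidean_space)
qed

text \<open>Compactness of the box makes its preimage closed in the Hausdorff space \<open>X\<close>, so extending by
  zero is continuous.\<close>

lemma chartwise_Lipschitz_extend:
  assumes X: "smooth_manifold n X A" and U: "(U, h) \<in> A" and x0: "x0 \<in> U"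
    and r: "ebox n (h x0) R \<subseteq> h ` U" "r < R"
    and g: "\<And>u v. u \<in> topspace (Euclidean_space n) \<Longrightarrow> v \<in> topspace (Euclidean_space n) \<Longrightarrow>
      \<bar>g v - g u\<bar> \<le> l1 n (\<lambda>i. v i - u i)"
    and supp: "\<And>u. u \<in> topspace (Euclidean_space n) \<Longrightarrow> g u \<noteq> 0 \<Longrightarrow> \<forall>i<n. \<bar>u i - h x0 i\<bar> \<le> r"
  shows "chartwise_Lipschitz n X A (\<lambda>y. if y \<in> U then g (h y) else 0)"
proof -
  let ?F = "\<lambda>y. if y \<in> U then g (h y) else 0"
  have cU: "chart n X (U, h)" using X U by (auto simp: smooth_manifold_def)
  have idsm: "smooth_map n X A n X A id" using X by (simp add: smooth_manifold_def)
  have haus: "Hausdorff_space X" using X by (simp add: smooth_manifold_def topological_manifold_def)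
  have wE: "h x0 \<in> topspace (Euclidean_space n)" using chart_image_in_Euclidean[OF cU x0] .
  define C where "C = {u \<in> topspace (Euclidean_space n). \<forall>i<n. \<bar>u i - h x0 i\<bar> \<le> r}"
  define K where "K = inv_into U h ` C"
  have ChU: "C \<subseteq> h ` U"
  proof -
    have "C \<subseteq> ebox n (h x0) R" using r(2) by (force simp: C_def ebox_def)
    then show ?thesis using r(1) by blast
  qed
  have "compactin (subtopology (Euclidean_space n) (h ` U)) C"
    using compactin_closed_box[OF wE, of r] ChU by (simp add: compactin_subtopology C_def)
  then have "compactin X K"
    unfolding K_def by (rule image_compactin[OF _ chartD(7)[OF cU]])
  then have K: "closedin X K" using compactin_imp_closedin[OF haus] by blast
  have KU: "K \<subseteq> U" using ChU by (auto simp: K_def inv_into_into)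
  have F0: "?F y = 0" if "y \<notin> K" for y
  proof (rule ccontr)
    assume "?F y \<noteq> 0"
    then have y: "y \<in> U" "g (h y) \<noteq> 0" by (auto split: if_splits)
    then have "h y \<in> C" using supp chart_image_in_Euclidean[OF cU] by (auto simp: C_def)
    then have "inv_into U h (h y) \<in> K" by (simp add: K_def)
    then show False using that y(1) chartD(4)[OF cU] by simp
  qed
  have gc: "continuous_map (Euclidean_space n) euclideanreal g"
  proof -
    have "continuous_map (subtopology (Euclidean_space n) (topspace (Euclidean_space n))) euclideanreal g"
      using g by (intro Lipschitz_imp_continuous_map_real[where B = 1]) auto
    then show ?thesis by simp
  qed
  have Fc: "continuous_map X euclideanreal ?F"
  proof (rule pasting_lemma[where I = "{True, False}" and T = "\<lambda>b. if b then U else topspace X - K"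
        and f = "\<lambda>b. if b then g \<circ> h else (\<lambda>_. 0)"])
    show "openin X (if b then U else topspace X - K)" for b
      using chartD(1)[OF cU] K by auto
    show "continuous_map (subtopology X (if b then U else topspace X - K)) euclideanreal
       (if b then g \<circ> h else (\<lambda>_. 0))" for b
      using continuous_map_compose[OF chartD(5)[OF cU] gc] by auto
  next
    fix i j x assume "i \<in> {True, False}" "j \<in> {True, False}"
      "x \<in> topspace X \<inter> (if i then U else topspace X - K) \<inter> (if j then U else topspace X - K)"
    then show "(if i then g \<circ> h else (\<lambda>_. 0)) x = (if j then g \<circ> h else (\<lambda>_. 0)) x"
      using F0[of x] by (auto split: if_splits)
  next
    fix x assume "x \<in> topspace X"
    then show "\<exists>j. j \<in> {True, False} \<and> x \<in> (if j then U else topspace X - K) \<and>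
        ?F x = (if j then g \<circ> h else (\<lambda>_. 0)) x"
      using KU by (cases "x \<in> U") auto
  qed
  have inU: "Lipschitz_in_chart n (\<lambda>y z. \<bar>?F y - ?F z\<bar>) U h x" if "x \<in> U" for x
  proof -
    have "h x \<in> h ` U" using that by simp
    then obtain d where d: "0 < d" "ebox n (h x) d \<subseteq> h ` U"
      using Euclidean_open_contains_ebox[OF chartD(3)[OF cU]] by blast
    show ?thesis
    proof (rule Lipschitz_in_chartI[of 1 d])
      fix u v assume uv: "u \<in> ebox n (h x) d" "v \<in> ebox n (h x) d"
      then have "inv_into U h u \<in> U" "inv_into U h v \<in> U" "h (inv_into U h u) = u" "h (inv_into U h v) = v"
        using d(2) by (auto simp: inv_into_into f_inv_into_f)
      then show "\<bar>?F (inv_into U h u) - ?F (inv_into U h v)\<bar> \<le> 1 * l1 n (\<lambda>i. v i - u i)"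
        using g[of u v] uv ebox_subset by (simp add: abs_minus_commute subset_iff)
    qed (use d in auto)
  qed
  have "Lipschitz_in_chart n (\<lambda>y z. \<bar>?F y - ?F z\<bar>) V k x"
    if x: "x \<in> topspace X" and V: "(V, k) \<in> A" "x \<in> V" for x V k
  proof (cases "x \<in> U")
    case True
    \<comment> \<open>A second chart at a point of U is reached by pulling back along the identity,
      that is, by the transition map.\<close>
    from Lipschitz_in_chart_pullback[OF X idsm V(1) U V(2), of "\<lambda>y z. \<bar>?F y - ?F z\<bar>"] inU[OF True] True
    show ?thesis by (simp only: id_apply)
  next
    case False
    have cV: "chart n X (V, k)" using X V by (auto simp: smooth_manifold_def)
    have "openin X (V - K)" using chartD(1)[OF cV] K by (rule openin_diff)
    then have o: "openin (Euclidean_space n) (k ` (V - K))" by (rule chartD(6)[OF cV]) auto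
    have "k x \<in> k ` (V - K)" using V(2) False KU by auto
    then obtain d where d: "0 < d" "ebox n (k x) d \<subseteq> k ` (V - K)"
      using Euclidean_open_contains_ebox[OF o] by blast
    have z: "?F (inv_into V k u) = 0" if u: "u \<in> ebox n (k x) d" for u
    proof -
      obtain y where "y \<in> V - K" "u = k y" using d(2) u by blast
      then have "inv_into V k u \<notin> K" using chartD(4)[OF cV] by simp
      then show ?thesis by (rule F0)
    qed
    show ?thesis
      by (rule Lipschitz_in_chartI[of 0 d]) (use d z in auto)
  qed
  then show ?thesis using Fc unfolding chartwise_Lipschitz_def by blast
qed

text \<open>Substitutes for coordinates that are defined on all of X: a bump recognises the points
  near x0, and clipped coordinates then identify them. Since z ranges over the whole space, finitely
  many such families separate a compact X globally.\<close>

lemma locally_separating_functions: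
  assumes X: "smooth_manifold n X A" and x0: "x0 \<in> topspace X"
  obtains \<F> N where "finite \<F>" "openin X N" "x0 \<in> N" "\<And>F. F \<in> \<F> \<Longrightarrow> chartwise_Lipschitz n X A F"
    "\<And>y z. y \<in> N \<Longrightarrow> z \<in> topspace X \<Longrightarrow> (\<And>F. F \<in> \<F> \<Longrightarrow> F y = F z) \<Longrightarrow> y = z"
proof -
  obtain U h where U: "(U, h) \<in> A" "x0 \<in> U" and cU: "chart n X (U, h)"
    using smooth_manifold_chart[OF X x0] .
  define w where "w = h x0"
  have wE: "w \<in> topspace (Euclidean_space n)" using chart_image_in_Euclidean[OF cU U(2)] by (simp add: w_def)
  have "w \<in> h ` U" using U(2) by (simp add: w_def)
  then obtain R where R: "0 < R" "ebox n w R \<subseteq> h ` U"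
    using Euclidean_open_contains_ebox[OF chartD(3)[OF cU]] by blast
  define r where "r = R / 2"
  have r: "0 < r" "r < R" using R(1) by (auto simp: r_def)
  \<comment> \<open>b is a tent of height r, and \<open>T i\<close> is the i-th coordinate clipped
    to the interval from -b to b. Both have Lipschitz constant 1 and vanish outside the closed box
    of radius r, so they extend by zero.\<close>
  define b where "b = (\<lambda>u. max 0 (r - l1 n (\<lambda>i. u i - w i)))"
  define T where "T = (\<lambda>i u. max (- b u) (min (b u) (u i - w i)))"
  define ext where "ext = (\<lambda>g y. if y \<in> U then g (h y) else (0::real))"
  have bL: "\<bar>b v - b u\<bar> \<le> l1 n (\<lambda>i. v i - u i)" for u v
  proof -
    have "l1 n (\<lambda>i. v i - w i) \<le> l1 n (\<lambda>i. v i - u i) + l1 n (\<lambda>i. u i - w i)"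
      using l1_add_le[of n "\<lambda>i. v i - u i" "\<lambda>i. u i - w i"] by simp
    moreover have "l1 n (\<lambda>i. u i - w i) \<le> l1 n (\<lambda>i. v i - u i) + l1 n (\<lambda>i. v i - w i)"
      using l1_add_le[of n "\<lambda>i. u i - v i" "\<lambda>i. v i - w i"] l1_commute[of n u v] by simp
    ultimately show ?thesis unfolding b_def by linarith
  qed
  have TL: "\<bar>T i v - T i u\<bar> \<le> l1 n (\<lambda>i. v i - u i)" if "i < n" for i u v
    using bL[of v u] l1_component_le[OF that, of "\<lambda>i. v i - u i"] unfolding T_def by linarith
  have bsupp: "\<forall>i<n. \<bar>u i - w i\<bar> \<le> r" if "b u \<noteq> 0" for u
  proof (intro allI impI)
    fix i assume "i < n"
    then show "\<bar>u i - w i\<bar> \<le> r"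
      using l1_component_le[of i n "\<lambda>i. u i - w i"] that by (auto simp: b_def)
  qed
  have Tsupp: "\<forall>i<n. \<bar>u i - w i\<bar> \<le> r" if "T i u \<noteq> 0" for i u
    using that by (intro bsupp) (auto simp: T_def)
  have Fb: "chartwise_Lipschitz n X A (ext b)"
    unfolding ext_def
    by (rule chartwise_Lipschitz_extend[OF X U, of R r]) (use R r bL bsupp in \<open>auto simp: w_def\<close>)
  have FT: "chartwise_Lipschitz n X A (ext (T i))" if "i < n" for i
    unfolding ext_def
    by (rule chartwise_Lipschitz_extend[OF X U, of R r]) (use R r TL[OF that] Tsupp in \<open>auto simp: w_def\<close>)
  \<comment> \<open>Within distance r / 2 of the centre b exceeds r / 2 and hence every coordinate
    difference, so no clipping takes place. Equality of b forces z into the same region.\<close>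
  define N where "N = {y \<in> topspace (subtopology X U). l1 n (\<lambda>i. h y i - w i) \<in> {..<r/2}}"
  have "continuous_map (subtopology X U) euclideanreal (\<lambda>y. l1 n (\<lambda>i. h y i - w i))"
  proof -
    have "continuous_map (subtopology X U) euclideanreal (\<lambda>y. h y i)" for i
      using continuous_map_compose[OF chartD(5)[OF cU] continuous_map_Euclidean_coordinate] by (simp add: o_def)
    then show ?thesis unfolding l1_def by (intro continuous_intros) auto
  qed
  from openin_continuous_map_preimage[OF this, of "{..<r/2}"]
  have "openin (subtopology X U) N" by (simp only: N_def open_openin[symmetric] open_lessThan)
  then have "openin X N" using openin_trans_full chartD(1)[OF cU] by blast
  moreover have "x0 \<in> N" using U(2) x0 r(1) by (simp add: N_def w_def l1_def)
  moreover have "y = z" if y: "y \<in> N" and z: "z \<in> topspace X"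
    and eq: "\<And>F. F \<in> insert (ext b) ((\<lambda>i. ext (T i)) ` {..<n}) \<Longrightarrow> F y = F z" for y z
  proof -
    have yU: "y \<in> U" and yr: "l1 n (\<lambda>i. h y i - w i) < r / 2" using y by (auto simp: N_def)
    have bh: "b (h y) = r - l1 n (\<lambda>i. h y i - w i)" using yr r(1) by (simp add: b_def)
    have e1: "ext b y = ext b z" using eq by blast
    have zU: "z \<in> U"
    proof (rule ccontr)
      assume "z \<notin> U"
      then show False using e1 bh yU yr r(1) by (simp add: ext_def)
    qed
    have bz: "b (h z) = b (h y)" using e1 yU zU by (simp add: ext_def)
    then have zr: "l1 n (\<lambda>i. h z i - w i) < r / 2" using bh yr r(1) unfolding b_def by linarith
    have Teq: "T i (h x) = h x i - w i" if "i < n" "b (h x) > r / 2" "l1 n (\<lambda>i. h x i - w i) < r / 2" for i x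
      using l1_component_le[OF that(1), of "\<lambda>i. h x i - w i"] that unfolding T_def by linarith
    have "h y i = h z i" if i: "i < n" for i
    proof -
      have "ext (T i) y = ext (T i) z" using eq i by blast
      then have "T i (h y) = T i (h z)" using yU zU by (simp add: ext_def)
      moreover have "b (h y) > r / 2" using bh yr by linarith
      ultimately show ?thesis using Teq[OF i, of y] Teq[OF i, of z] bz yr zr by simp
    qed
    then have "l1 n (\<lambda>i. h y i - h z i) = 0" by (simp add: l1_def)
    then have "h y = h z"
      using l1_diff_eq_0_iff chart_image_in_Euclidean[OF cU] yU zU by blast
    then show ?thesis using chartD(4)[OF cU] yU zU by (meson inj_onD)
  qed
  ultimately show thesis
    using Fb FT by (intro that[of "insert (ext b) ((\<lambda>i. ext (T i)) ` {..<n})" N]) auto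
qed

text \<open>A coordinate box is divided into cubes, and the Lipschitz bound converts their side
  length into a bound for R.\<close>

lemma local_covering_number:
  assumes ch: "chart n X (U, h)" and x: "x \<in> U" and R: "Lipschitz_in_chart n R U h x"
  obtains N C where "openin X N" "x \<in> N"
    "\<And>K::nat. 1 \<le> K \<Longrightarrow> \<exists>\<S>. finite \<S> \<and> card \<S> \<le> C * K ^ n \<and> N \<subseteq> \<Union>\<S> \<and>
       (\<forall>S\<in>\<S>. \<forall>y\<in>S. \<forall>z\<in>S. R y z \<le> 1 / K)"
proof -
  define w where "w = h x"
  obtain B d where B: "0 \<le> B" "0 < d" "ebox n w d \<subseteq> h ` U"
    "\<And>u v. u \<in> ebox n w d \<Longrightarrow> v \<in> ebox n w d \<Longrightarrow>
       R (inv_into U h u) (inv_into U h v) \<le> B * l1 n (\<lambda>i. v i - u i)"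
    using R unfolding Lipschitz_in_chart_def w_def by meson
  define N where "N = {y \<in> topspace (subtopology X U). h y \<in> ebox n w d}"
  have RN: "R y z \<le> B * l1 n (\<lambda>i. h z i - h y i)" if "y \<in> N" "z \<in> N" for y z
    using B(4)[of "h y" "h z"] that chartD(4)[OF ch] by (simp add: N_def)
  \<comment> \<open>A cube of side 2 * d / (c * K) has R-diameter at most B * n * 2 * d / (c * K),
    which this c makes at most 1 / K.\<close>
  define c where "c = nat \<lceil>B * n * (2 * d)\<rceil> + 1"
  have c: "B * n * (2 * d) \<le> c" "0 < c" unfolding c_def by linarith+
  show thesis
  proof (rule that[of N "c ^ n"])
    show "openin X N"
      unfolding N_def
      by (rule openin_trans_full[OF openin_continuous_map_preimage[OF chartD(5)[OF ch] openin_ebox] chartD(1)[OF ch]])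
    show "x \<in> N"
      using x chartD(2)[OF ch] centre_in_ebox[OF chart_image_in_Euclidean[OF ch x] B(2)] by (auto simp: N_def w_def)
    fix K :: nat assume K: "1 \<le> K"
    define L where "L = c * K"
    have L: "0 < real L" using K c(2) by (simp add: L_def)
    \<comment> \<open>Coordinates rescaled from the box to the range from 0 to L; their integer
      parts number the cubes.\<close>
    define \<kappa> where "\<kappa> = (\<lambda>y i. (h y i - w i + d) * (L / (2 * d)))"
    define S where "S = (\<lambda>a. {y \<in> N. \<forall>i<n. \<lfloor>\<kappa> y i\<rfloor> = int (a i)})"
    define \<S> where "\<S> = S ` ({..<n} \<rightarrow>\<^sub>E {..<L})"
    show "\<exists>\<S>. finite \<S> \<and> card \<S> \<le> c ^ n * K ^ n \<and> N \<subseteq> \<Union>\<S> \<and>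
       (\<forall>S\<in>\<S>. \<forall>y\<in>S. \<forall>z\<in>S. R y z \<le> 1 / K)"
    proof (intro exI[of _ \<S>] conjI)
      show "finite \<S>" by (auto simp: \<S>_def intro!: finite_PiE)
      have "card \<S> \<le> card ({..<n} \<rightarrow>\<^sub>E {..<L})"
        unfolding \<S>_def by (intro card_image_le finite_PiE) auto
      then show "card \<S> \<le> c ^ n * K ^ n"
        by (simp add: card_PiE L_def power_mult_distrib)
      show "N \<subseteq> \<Union>\<S>"
      proof
        fix y assume y: "y \<in> N"
        have \<kappa>: "0 \<le> \<kappa> y i" "\<kappa> y i < L" if "i < n" for i
        proof -
          have i: "0 < h y i - w i + d" "h y i - w i + d < 2 * d"
            using y that by (auto simp: N_def ebox_def abs_less_iff)
          then show "0 \<le> \<kappa> y i" using L B(2) by (simp add: \<kappa>_def)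
          have "\<kappa> y i < (2 * d) * (L / (2 * d))"
            unfolding \<kappa>_def using i L B(2) by (intro mult_strict_right_mono) auto
          then show "\<kappa> y i < L" using B(2) by simp
        qed
        define a where "a = (\<lambda>i\<in>{..<n}. nat \<lfloor>\<kappa> y i\<rfloor>)"
        have "a \<in> {..<n} \<rightarrow>\<^sub>E {..<L}"
          using \<kappa> by (auto simp: a_def nat_less_iff floor_less_iff)
        moreover have "y \<in> S a" using y \<kappa> by (simp add: S_def a_def)
        ultimately show "y \<in> \<Union>\<S>" by (auto simp: \<S>_def)
      qed
      show "\<forall>S\<in>\<S>. \<forall>y\<in>S. \<forall>z\<in>S. R y z \<le> 1 / K"
      proof (intro ballI)
        fix T y z assume "T \<in> \<S>" "y \<in> T" "z \<in> T"
        then obtain a where a: "y \<in> S a" "z \<in> S a" by (auto simp: \<S>_def)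
        have "\<bar>h z i - h y i\<bar> \<le> 2 * d / L" if "i < n" for i
        proof -
          have "\<lfloor>\<kappa> y i\<rfloor> = \<lfloor>\<kappa> z i\<rfloor>" using a that by (simp add: S_def)
          then have "\<bar>\<kappa> z i - \<kappa> y i\<bar> < 1" by linarith
          moreover have "\<kappa> z i - \<kappa> y i = (h z i - h y i) * (L / (2 * d))"
            unfolding \<kappa>_def left_diff_distrib[symmetric] by simp
          ultimately have "\<bar>h z i - h y i\<bar> * (L / (2 * d)) < 1"
            using L B(2) by (simp add: abs_mult)
          then show ?thesis using L B(2) by (simp add: field_simps)
        qed
        then have "l1 n (\<lambda>i. h z i - h y i) \<le> (\<Sum>i<n. 2 * d / L)"
          unfolding l1_def by (intro sum_mono) auto
        then have "B * l1 n (\<lambda>i. h z i - h y i) \<le> B * (n * (2 * d / L))"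
          using B(1) by (intro mult_left_mono) auto
        also have "\<dots> = (B * n * (2 * d)) / L" by simp
        also have "\<dots> \<le> c / L" using c(1) L by (intro divide_right_mono) auto
        also have "\<dots> = 1 / K" using c(2) by (simp add: L_def)
        finally show "R y z \<le> 1 / K" using RN[of y z] a by (simp add: S_def)
      qed
    qed
  qed
qed

section \<open>Invariant metrics on closed manifolds\<close>

lemma compact_space_finite_cover:
  assumes X: "compact_space X" and N: "\<And>x. x \<in> topspace X \<Longrightarrow> openin X (N x) \<and> x \<in> N x"
  obtains T where "finite T" "T \<subseteq> topspace X" "topspace X \<subseteq> (\<Union>x\<in>T. N x)"
proof -
  have "\<forall>U\<in>N ` topspace X. openin X U" "topspace X \<subseteq> \<Union>(N ` topspace X)" using N by blast+
  then obtain \<F> where "finite \<F>" "\<F> \<subseteq> N ` topspace X" "topspace X \<subseteq> \<Union>\<F>"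
    using X unfolding compact_space_def compactin_def by meson
  then show thesis using that finite_subset_image[of \<F> N "topspace X"] by metis
qed

text \<open>Joint continuity is the only stated link between \<open>\<rho>\<close> and the topology.
  That balls form neighbourhood bases follows from compactness, in
  \<open>open_contains_ball_at\<close>.\<close>

locale periodic_metric = periodic_map +
  fixes \<rho> :: "'a \<Rightarrow> 'a \<Rightarrow> real"
  assumes compact_X: "compact_space X"
    and \<rho>_nonneg: "0 \<le> \<rho> x y" and \<rho>_refl: "\<rho> x x = 0" and \<rho>_sym: "\<rho> x y = \<rho> y x"
    and \<rho>_tri: "\<rho> x z \<le> \<rho> x y + \<rho> y z"
    and \<rho>_eq: "x \<in> topspace X \<Longrightarrow> y \<in> topspace X \<Longrightarrow> \<rho> x y = 0 \<Longrightarrow> x = y"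
    and \<rho>_\<phi>: "x \<in> topspace X \<Longrightarrow> y \<in> topspace X \<Longrightarrow> \<rho> (\<phi> x) (\<phi> y) = \<rho> x y"
    and \<rho>_cont: "continuous_map (prod_topology X X) euclideanreal (\<lambda>(x, y). \<rho> x y)"

text \<open>The upper box-counting dimension is at most n, in quantitative form with constant
  C.\<close>

definition small_covers :: "'a topology \<Rightarrow> ('a \<Rightarrow> 'a \<Rightarrow> real) \<Rightarrow> nat \<Rightarrow> nat \<Rightarrow> bool" where
  "small_covers X \<rho> C n \<longleftrightarrow> (\<forall>K::nat. 1 \<le> K \<longrightarrow> (\<exists>\<S>. finite \<S> \<and> card \<S> \<le> C * K ^ n \<and> topspace X \<subseteq> \<Union>\<S> \<and>
     (\<forall>S\<in>\<S>. \<forall>y\<in>S. \<forall>z\<in>S. \<rho> y z \<le> 1 / K)))"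

text \<open>A finite separating family of Lipschitz functions gives the metric s. Summing s over p
  powers of f makes it invariant, and each summand is still Lipschitz in charts, so the cube count
  keeps the exponent n.\<close>

lemma invariant_metric:
  assumes X: "closed_smooth_manifold n X A" and f: "smooth_map n X A n X A f"
    and per: "\<And>x. x \<in> topspace X \<Longrightarrow> (f ^^ p) x = x" and p: "0 < p"
  obtains \<rho> C where "periodic_metric X f p \<rho>" "small_covers X \<rho> C n"
proof -
  have Xs: "smooth_manifold n X A" and Xc: "compact_space X"
    using X by (auto simp: closed_smooth_manifold_def)
  define sep where "sep = (\<lambda>x \<F> N. finite \<F> \<and> openin X N \<and> x \<in> N \<and> (\<forall>F\<in>\<F>. chartwise_Lipschitz n X A F) \<and>
    (\<forall>y\<in>N. \<forall>z\<in>topspace X. (\<forall>F\<in>\<F>. F y = F z) \<longrightarrow> y = z))"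
  have "\<exists>\<F> N. sep x \<F> N" if x: "x \<in> topspace X" for x
  proof -
    obtain \<F> N where FN: "finite \<F>" "openin X N" "x \<in> N" "\<And>F. F \<in> \<F> \<Longrightarrow> chartwise_Lipschitz n X A F"
      "\<And>y z. y \<in> N \<Longrightarrow> z \<in> topspace X \<Longrightarrow> (\<And>F. F \<in> \<F> \<Longrightarrow> F y = F z) \<Longrightarrow> y = z"
      by (rule locally_separating_functions[OF Xs x]) blast
    have "sep x \<F> N"
      unfolding sep_def
    proof (intro conjI ballI impI)
      fix y z assume "y \<in> N" "z \<in> topspace X" "\<forall>F\<in>\<F>. F y = F z"
      then show "y = z" using FN(5) by simp
    qed (use FN(1-4) in simp_all)
    then show ?thesis by blast
  qed
  then obtain \<F>' N where sep: "\<And>x. x \<in> topspace X \<Longrightarrow> sep x (\<F>' x) (N x)" by metis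
  obtain T where T: "finite T" "T \<subseteq> topspace X" "topspace X \<subseteq> (\<Union>x\<in>T. N x)"
    using compact_space_finite_cover[OF Xc, of N] sep unfolding sep_def by blast
  define \<F> where "\<F> = (\<Union>x\<in>T. \<F>' x)"
  have fin: "finite \<F>" using T sep by (auto simp: \<F>_def sep_def)
  have FL: "chartwise_Lipschitz n X A F" if "F \<in> \<F>" for F
    using that T(2) sep by (auto simp: \<F>_def sep_def)
  have Fsep: "y = z" if y: "y \<in> topspace X" and z: "z \<in> topspace X" and eq: "\<And>F. F \<in> \<F> \<Longrightarrow> F y = F z" for y z
  proof -
    obtain x where x: "x \<in> T" "y \<in> N x" using y T(3) by blast
    then have "sep x (\<F>' x) (N x)" using T(2) sep by blast
    moreover have "\<forall>F\<in>\<F>' x. F y = F z" using eq x(1) by (auto simp: \<F>_def)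
    ultimately show ?thesis using x(2) z unfolding sep_def by blast
  qed
  define s where "s = (\<lambda>y z. \<Sum>F\<in>\<F>. \<bar>F y - F z\<bar>)"
  define \<rho> where "\<rho> = (\<lambda>y z. \<Sum>k<p. s ((f ^^ k) y) ((f ^^ k) z))"
  have s_tri: "s x z \<le> s x y + s y z" for x y z
    unfolding s_def sum.distrib[symmetric] by (intro sum_mono) auto
  have s_nonneg: "0 \<le> s y z" for y z unfolding s_def by (simp add: sum_nonneg)
  have Lip: "Lipschitz_in_chart n \<rho> U h x" if "x \<in> topspace X" "(U, h) \<in> A" "x \<in> U" for U h x
  proof -
    have ch: "chart n X (U, h)" using Xs that(2) by (auto simp: smooth_manifold_def)
    have "Lipschitz_in_chart n (\<lambda>y z. \<bar>F ((f ^^ k) y) - F ((f ^^ k) z)\<bar>) U h x" if "F \<in> \<F>" for F k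
      using chartwise_Lipschitz_funpow[OF Xs f FL[OF that], of k] \<open>x \<in> topspace X\<close> \<open>(U, h) \<in> A\<close> \<open>x \<in> U\<close>
      unfolding chartwise_Lipschitz_def by auto
    then show ?thesis
      unfolding \<rho>_def s_def using ch \<open>x \<in> U\<close> fin
      by (intro Lipschitz_in_chart_sum[where X = X]) auto
  qed
  define cov where "cov = (\<lambda>x N C. openin X N \<and> x \<in> N \<and> (\<forall>K\<ge>1. \<exists>\<S>. finite \<S> \<and> card \<S> \<le> C * K ^ n \<and> N \<subseteq> \<Union>\<S> \<and>
       (\<forall>S\<in>\<S>. \<forall>y\<in>S. \<forall>z\<in>S. \<rho> y z \<le> 1 / real K)))"
  have "\<exists>N C. cov x N C" if x: "x \<in> topspace X" for x
  proof -
    obtain U h where U: "(U, h) \<in> A" "x \<in> U" and ch: "chart n X (U, h)" using smooth_manifold_chart[OF Xs x] .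
    obtain N C where "openin X N" "x \<in> N"
      and "\<And>K::nat. 1 \<le> K \<Longrightarrow> \<exists>\<S>. finite \<S> \<and> card \<S> \<le> C * K ^ n \<and> N \<subseteq> \<Union>\<S> \<and>
       (\<forall>S\<in>\<S>. \<forall>y\<in>S. \<forall>z\<in>S. \<rho> y z \<le> 1 / K)"
      by (rule local_covering_number[OF ch U(2) Lip[OF x U]]) blast
    then have "cov x N C" unfolding cov_def by simp
    then show ?thesis by blast
  qed
  then obtain N' C' where cov: "\<And>x. x \<in> topspace X \<Longrightarrow> cov x (N' x) (C' x)" by metis
  obtain T' where T': "finite T'" "T' \<subseteq> topspace X" "topspace X \<subseteq> (\<Union>x\<in>T'. N' x)"
    using compact_space_finite_cover[OF Xc, of N'] cov unfolding cov_def by blast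
  have "periodic_metric X f p \<rho>"
  proof
    show "continuous_map X X f" using f by (simp add: smooth_map_def)
    show "0 < p" "compact_space X" by (rule p Xc)+
    show "(f ^^ p) x = x" if "x \<in> topspace X" for x using per[OF that] .
    show "0 \<le> \<rho> x y" "\<rho> x x = 0" for x y by (auto simp: \<rho>_def s_def intro!: sum_nonneg)
    show "\<rho> x y = \<rho> y x" for x y by (simp add: \<rho>_def s_def abs_minus_commute)
    show "\<rho> x z \<le> \<rho> x y + \<rho> y z" for x y z
      unfolding \<rho>_def sum.distrib[symmetric] by (intro sum_mono s_tri)
    show "x = y" if "x \<in> topspace X" "y \<in> topspace X" "\<rho> x y = 0" for x y
    proof (rule Fsep)
      have "\<forall>k\<in>{..<p}. s ((f ^^ k) x) ((f ^^ k) y) = 0"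
        using that(3) s_nonneg unfolding \<rho>_def by (subst (asm) sum_nonneg_eq_0_iff) auto
      from bspec[OF this, of 0] p have "s x y = 0" by simp
      then show "F x = F y" if "F \<in> \<F>" for F
        using that fin by (simp add: s_def sum_nonneg_eq_0_iff)
    qed (use that in auto)
    show "\<rho> (f x) (f y) = \<rho> x y" if "x \<in> topspace X" "y \<in> topspace X" for x y
    proof -
      let ?a = "\<lambda>k. s ((f ^^ k) x) ((f ^^ k) y)"
      have "\<rho> (f x) (f y) = (\<Sum>k<p. ?a (Suc k))" by (simp add: \<rho>_def funpow_swap1)
      \<comment> \<open>Applying f shifts the index of the sum; only the two end terms change, and
        they coincide by periodicity.\<close>
      moreover have "(\<Sum>k<p. ?a (Suc k)) - (\<Sum>k<p. ?a k) = ?a p - ?a 0"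
        unfolding sum_subtractf[symmetric] by (rule sum_lessThan_telescope)
      ultimately show ?thesis using per that by (simp add: \<rho>_def)
    qed
    show "continuous_map (prod_topology X X) euclideanreal (\<lambda>(x, y). \<rho> x y)"
    proof -
      have c: "continuous_map X euclideanreal (F \<circ> (f ^^ k))" if "F \<in> \<F>" for F k
        using chartwise_Lipschitz_funpow[OF Xs f FL[OF that]] by (simp add: chartwise_Lipschitz_def)
      have "continuous_map (prod_topology X X) euclideanreal
          (\<lambda>q. \<Sum>k<p. \<Sum>F\<in>\<F>. \<bar>(F \<circ> (f ^^ k)) (fst q) - (F \<circ> (f ^^ k)) (snd q)\<bar>)"
        using continuous_map_compose[OF continuous_map_fst c] continuous_map_compose[OF continuous_map_snd c] fin
        by (intro continuous_intros) (auto simp: o_def)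
      then show ?thesis by (simp add: \<rho>_def s_def case_prod_unfold)
    qed
  qed
  moreover have "small_covers X \<rho> (\<Sum>x\<in>T'. C' x) n"
    unfolding small_covers_def
  proof (intro allI impI)
    fix K :: nat assume K: "1 \<le> K"
    have "\<forall>x\<in>T'. \<exists>\<S>. finite \<S> \<and> card \<S> \<le> C' x * K ^ n \<and> N' x \<subseteq> \<Union>\<S> \<and>
       (\<forall>S\<in>\<S>. \<forall>y\<in>S. \<forall>z\<in>S. \<rho> y z \<le> 1 / real K)"
      using cov T'(2) K unfolding cov_def by blast
    from bchoice[OF this] obtain \<S> where S: "\<forall>x\<in>T'. finite (\<S> x) \<and> card (\<S> x) \<le> C' x * K ^ n \<and> N' x \<subseteq> \<Union>(\<S> x) \<and>
       (\<forall>S\<in>\<S> x. \<forall>y\<in>S. \<forall>z\<in>S. \<rho> y z \<le> 1 / real K)" ..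
    show "\<exists>\<S>. finite \<S> \<and> card \<S> \<le> (\<Sum>x\<in>T'. C' x) * K ^ n \<and> topspace X \<subseteq> \<Union>\<S> \<and>
       (\<forall>S\<in>\<S>. \<forall>y\<in>S. \<forall>z\<in>S. \<rho> y z \<le> 1 / K)"
    proof (intro exI[of _ "\<Union>x\<in>T'. \<S> x"] conjI)
      show "finite (\<Union>x\<in>T'. \<S> x)" using T'(1) S by blast
      have "card (\<Union>x\<in>T'. \<S> x) \<le> (\<Sum>x\<in>T'. card (\<S> x))" by (rule card_UN_le[OF T'(1)])
      also have "\<dots> \<le> (\<Sum>x\<in>T'. C' x * K ^ n)" using S by (intro sum_mono) blast
      finally show "card (\<Union>x\<in>T'. \<S> x) \<le> (\<Sum>x\<in>T'. C' x) * K ^ n" by (simp add: sum_distrib_right)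
      show "topspace X \<subseteq> \<Union>(\<Union>x\<in>T'. \<S> x)"
      proof
        fix y assume "y \<in> topspace X"
        then obtain x where x: "x \<in> T'" "y \<in> N' x" using T'(3) by blast
        then have "y \<in> \<Union>(\<S> x)" using S by (metis subsetD)
        then show "y \<in> \<Union>(\<Union>x\<in>T'. \<S> x)" using x(1) by blast
      qed
      show "\<forall>S\<in>\<Union>x\<in>T'. \<S> x. \<forall>y\<in>S. \<forall>z\<in>S. \<rho> y z \<le> 1 / K" using S by blast
    qed
  qed
  ultimately show thesis by (rule that)
qed

section \<open>The mapping torus is a manifold\<close>

lemma second_countable_prod_topology:
  assumes "second_countable X" "second_countable Y"
  shows "second_countable (prod_topology X Y)"
proof -
  obtain \<B> where B: "countable \<B>" "\<And>V. V \<in> \<B> \<Longrightarrow> openin X V"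
    "\<And>U x. openin X U \<Longrightarrow> x \<in> U \<Longrightarrow> \<exists>V\<in>\<B>. x \<in> V \<and> V \<subseteq> U"
    using assms(1) unfolding second_countable_def by meson
  obtain \<C> where C: "countable \<C>" "\<And>V. V \<in> \<C> \<Longrightarrow> openin Y V"
    "\<And>U x. openin Y U \<Longrightarrow> x \<in> U \<Longrightarrow> \<exists>V\<in>\<C>. x \<in> V \<and> V \<subseteq> U"
    using assms(2) unfolding second_countable_def by meson
  define \<D> where "\<D> = (\<lambda>(V, W). V \<times> W) ` (\<B> \<times> \<C>)"
  have "countable \<D>" using B(1) C(1) by (auto simp: \<D>_def)
  moreover have "openin (prod_topology X Y) D" if "D \<in> \<D>" for D
    using that B(2) C(2) by (auto simp: \<D>_def openin_prod_Times_iff)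
  moreover have "\<exists>D\<in>\<D>. z \<in> D \<and> D \<subseteq> U" if U: "openin (prod_topology X Y) U" and z: "z \<in> U" for U z
  proof -
    obtain x y where xy: "z = (x, y)" by fastforce
    obtain V W where VW: "openin X V" "openin Y W" "x \<in> V" "y \<in> W" "V \<times> W \<subseteq> U"
      using U[unfolded openin_prod_topology_alt, rule_format, of x y] z xy by blast
    obtain V' where V': "V' \<in> \<B>" "x \<in> V'" "V' \<subseteq> V" using B(3) VW(1,3) by blast
    obtain W' where W': "W' \<in> \<C>" "y \<in> W'" "W' \<subseteq> W" using C(3) VW(2,4) by blast
    have "V' \<times> W' \<in> \<D>" using V' W' by (auto simp: \<D>_def)
    moreover have "z \<in> V' \<times> W'" using xy V' W' by simp
    moreover have "V' \<times> W' \<subseteq> U" by (rule subset_trans[OF Sigma_mono[OF V'(3)] VW(5)]) (rule W'(3))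
    ultimately show ?thesis by (intro bexI[of _ "V' \<times> W'"] conjI)
  qed
  ultimately show ?thesis unfolding second_countable_def by (intro exI[of _ \<D>]) simp
qed

lemma second_countable_euclideanreal: "second_countable (euclidean :: real topology)"
proof -
  obtain B :: "real set set" where B: "countable B" "topological_basis B"
    using ex_countable_basis by blast
  show ?thesis
    unfolding second_countable_def
  proof (intro exI[of _ B] conjI ballI allI impI)
    fix V assume "V \<in> B"
    then show "openin euclidean V" using topological_basis_open[OF B(2)] by simp
  next
    fix U :: "real set" and x assume "openin euclidean U \<and> x \<in> U"
    then show "\<exists>V\<in>B. x \<in> V \<and> V \<subseteq> U" using topological_basisE[OF B(2)] by (metis open_openin)
  qed (rule B(1))
qed

context periodic_map
begin

text \<open>Two points of an open strip of length 1 with the same image differ by a shift with |k| <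
  1, hence k = 0.\<close>

lemma inj_on_q:
  assumes "B \<subseteq> {t - 1/2<..<t + 1/2} \<times> topspace X"
  shows "inj_on q B"
proof (rule inj_onI)
  fix a b assume ab: "a \<in> B" "b \<in> B" "q a = q b"
  then have in_line: "a \<in> topspace line" "b \<in> topspace line" using assms by auto
  then obtain k where k: "b = shift k a" using q_eq_iff ab(3) by blast
  have "t - 1/2 < fst a" "fst a < t + 1/2" "t - 1/2 < fst b" "fst b < t + 1/2"
    using ab assms by auto
  then have "- 1 < real_of_int k" "real_of_int k < 1" using k by (auto simp: shift_def)
  then have "k = 0" by linarith
  then show "a = b" using k by simp
qed

lemma Hausdorff_M:
  assumes X: "Hausdorff_space X"
  shows "Hausdorff_space M"
  unfolding Hausdorff_space_def
proof (intro allI impI)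
  fix y z assume yz: "y \<in> topspace M \<and> z \<in> topspace M \<and> y \<noteq> z"
  then obtain a b where a: "a \<in> topspace line" "y = q a" and b: "b \<in> topspace line" "z = q b"
    using q_image by (metis imageE)
  have ne: "shift k a \<noteq> b" for k using yz a b q_shift by blast
  have haus: "Hausdorff_space line"
    using X by (simp add: line_def Hausdorff_space_prod_topology)
  \<comment> \<open>With half-width 1/4, \<open>meet\<close> places k within 1/2 of the difference
    of the real coordinates. At most one deck transformation can then bring the two neighbourhoods
    together, and only that one has to be separated.\<close>
  define I where "I = (\<lambda>c::real \<times> 'a. {fst c - 1/4<..<fst c + 1/4} \<times> topspace X)"
  have oI: "openin line (I c)" for c
    unfolding I_def line_def by (simp add: openin_prod_Times_iff)
  have meet: "\<bar>fst a + of_int k - fst b\<bar> < 1/2" if "c \<in> I a" "shift k c \<in> I b" for c k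
  proof -
    have "fst a - 1/4 < fst c" "fst c < fst a + 1/4" "fst b - 1/4 < fst c + of_int k" "fst c + of_int k < fst b + 1/4"
      using that by (auto simp: I_def shift_def)
    then show ?thesis by linarith
  qed
  obtain A B where AB: "openin line A" "openin line B" "a \<in> A" "b \<in> B" "A \<subseteq> I a" "B \<subseteq> I b"
    "\<And>c k. c \<in> A \<Longrightarrow> shift k c \<notin> B"
  proof (cases "\<exists>k::int. \<bar>fst a + of_int k - fst b\<bar> < 1/2")
    case False
    then show thesis
      using that[OF oI oI, of a b] meet a(1) b(1) by (auto simp: I_def mem_Times_iff)
  next
    case True
    then obtain k :: int where k: "\<bar>fst a + of_int k - fst b\<bar> < 1/2" by blast
    obtain A' B' where A': "openin line A'" "openin line B'" "shift k a \<in> A'" "b \<in> B'" "A' \<inter> B' = {}"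
      using haus ne[of k] shift_in[OF a(1)] b(1) unfolding Hausdorff_space_def disjnt_def by meson
    let ?A = "I a \<inter> {c \<in> topspace line. shift k c \<in> A'}" and ?B = "I b \<inter> B'"
    show thesis
    proof (rule that[of ?A ?B])
      show "openin line ?A"
        by (rule openin_Int[OF oI openin_continuous_map_preimage[OF continuous_shift A'(1)]])
      show "openin line ?B" by (rule openin_Int[OF oI A'(2)])
      show "a \<in> ?A" "b \<in> ?B" using a b A' by (auto simp: I_def mem_Times_iff)
      fix c l assume c: "c \<in> ?A"
      show "shift l c \<notin> ?B"
      proof
        assume l: "shift l c \<in> ?B"
        then have "\<bar>fst a + of_int l - fst b\<bar> < 1/2" using meet c by blast
        then have "\<bar>real_of_int l - real_of_int k\<bar> < 1" using k by linarith
        then have "l = k" by linarith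
        then have "shift k c \<in> A'" "shift k c \<in> B'" using c l by simp_all
        then show False using A'(5) by blast
      qed
    qed auto
  qed
  have "q ` A \<inter> q ` B = {}"
  proof (rule ccontr)
    assume "q ` A \<inter> q ` B \<noteq> {}"
    then obtain c d where cd: "c \<in> A" "d \<in> B" "q c = q d" by blast
    then have "c \<in> topspace line" "d \<in> topspace line" using AB(1,2) openin_subset by blast+
    then show False using cd AB(7) q_eq_iff by blast
  qed
  then show "\<exists>U V. openin M U \<and> openin M V \<and> y \<in> U \<and> z \<in> V \<and> disjnt U V"
  proof (intro exI conjI)
    show "openin M (q ` A)" "openin M (q ` B)" using AB(1,2) open_map_q by (simp_all add: open_map_def)
  qed (use AB(3,4) a(2) b(2) in \<open>simp_all add: disjnt_def\<close>)
qed

end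

text \<open>The real coordinate is stored at index n, where h y vanishes; setting that entry back to
  0 recovers h y.\<close>

lemma homeomorphic_map_cylinder_chart:
  fixes h :: "'a \<Rightarrow> nat \<Rightarrow> real"
  assumes ch: "chart n X (U, h)" and J: "open J"
  defines "k \<equiv> \<lambda>(s, y). (h y)(n := s)"
  shows "openin (Euclidean_space (Suc n)) (k ` (J \<times> U))"
    "homeomorphic_map (subtopology (prod_topology euclideanreal X) (J \<times> U))
       (subtopology (Euclidean_space (Suc n)) (k ` (J \<times> U))) k"
proof -
  note chart = chartD[OF ch]
  let ?P = "subtopology (prod_topology euclideanreal X) (J \<times> U)"
  let ?E = "Euclidean_space (Suc n)"
  define \<pi> where "\<pi> = (\<lambda>v::nat \<Rightarrow> real. v(n := 0))"
  have hE: "h y \<in> topspace (Euclidean_space n)" if "y \<in> U" for y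
    using chart_image_in_Euclidean[OF ch that] .
  have \<pi>c: "continuous_map ?E (Euclidean_space n) \<pi>"
  proof (rule continuous_map_into_Euclidean_space)
    show "continuous_map ?E euclideanreal (\<lambda>x. \<pi> x i)" if "i < n" for i
      using that continuous_map_Euclidean_coordinate[of "Suc n" i] by (simp add: \<pi>_def)
  qed (auto simp: \<pi>_def topspace_Euclidean_space)
  have kE: "k z \<in> topspace ?E" if "z \<in> J \<times> U" for z
    using that hE by (fastforce simp: k_def topspace_Euclidean_space)
  have img: "k ` (J \<times> U) = {v \<in> topspace ?E. v n \<in> J} \<inter> {v \<in> topspace ?E. \<pi> v \<in> h ` U}"
  proof (intro equalityI subsetI)
    fix v assume "v \<in> k ` (J \<times> U)"
    then obtain s y where sy: "s \<in> J" "y \<in> U" "v = (h y)(n := s)" by (auto simp: k_def)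
    then have "\<pi> v = h y" using hE[OF sy(2)] by (auto simp: \<pi>_def topspace_Euclidean_space)
    then show "v \<in> {v \<in> topspace ?E. v n \<in> J} \<inter> {v \<in> topspace ?E. \<pi> v \<in> h ` U}"
      using sy kE[of "(s, y)"] by (auto simp: k_def)
  next
    fix v assume v: "v \<in> {v \<in> topspace ?E. v n \<in> J} \<inter> {v \<in> topspace ?E. \<pi> v \<in> h ` U}"
    then obtain y where y: "y \<in> U" "\<pi> v = h y" by auto
    then have "v = k (v n, y)" by (auto simp: k_def \<pi>_def fun_eq_iff) (metis fun_upd_apply)
    then show "v \<in> k ` (J \<times> U)" using v y by blast
  qed
  have "openin ?E {v \<in> topspace ?E. v n \<in> J}"
    using openin_continuous_map_preimage[OF continuous_map_Euclidean_coordinate, of J] J by simp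
  moreover have "openin ?E {v \<in> topspace ?E. \<pi> v \<in> h ` U}"
    by (rule openin_continuous_map_preimage[OF \<pi>c chart(3)])
  ultimately show "openin ?E (k ` (J \<times> U))" unfolding img by (rule openin_Int)
  define k' where "k' = (\<lambda>v. (v n, inv_into U h (\<pi> v)))"
  have tP: "topspace ?P = J \<times> U" using chart(2) by auto
  have tE: "topspace (subtopology ?E (k ` (J \<times> U))) = k ` (J \<times> U)" using kE by auto
  have kk: "k' (k z) = z" if z: "z \<in> J \<times> U" for z
  proof -
    obtain s y where sy: "z = (s, y)" "s \<in> J" "y \<in> U" using z by auto
    then have "\<pi> (k z) = h y" using hE[OF sy(3)] by (auto simp: \<pi>_def k_def topspace_Euclidean_space)
    then show ?thesis using sy chart(4) by (simp add: k'_def k_def)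
  qed
  have kc: "continuous_map ?P ?E k"
  proof (rule continuous_map_into_Euclidean_space)
    show "k \<in> topspace ?P \<rightarrow> topspace ?E" using kE tP by auto
    fix i assume "i < Suc n"
    show "continuous_map ?P euclideanreal (\<lambda>z. k z i)"
    proof (cases "i = n")
      case True
      have "continuous_map ?P euclideanreal fst"
        by (rule continuous_map_from_subtopology[OF continuous_map_fst])
      then show ?thesis using True by (simp add: k_def case_prod_unfold)
    next
      case False
      have "continuous_map ?P X snd" by (rule continuous_map_from_subtopology[OF continuous_map_snd])
      moreover have "snd \<in> topspace ?P \<rightarrow> U" unfolding tP by auto
      ultimately have "continuous_map ?P (subtopology X U) snd"
        unfolding continuous_map_in_subtopology by (rule conjI)
      from continuous_map_compose[OF continuous_map_compose[OF this chart(5)] continuous_map_Euclidean_coordinate]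
      show ?thesis using False by (simp add: k_def case_prod_unfold o_def)
    qed
  qed
  have k'c: "continuous_map (subtopology ?E (k ` (J \<times> U))) (prod_topology euclideanreal X) k'"
  proof -
    have "continuous_map (subtopology ?E (k ` (J \<times> U))) euclideanreal (\<lambda>v. v n)"
      by (rule continuous_map_from_subtopology[OF continuous_map_Euclidean_coordinate])
    moreover have "continuous_map (subtopology ?E (k ` (J \<times> U))) (subtopology (Euclidean_space n) (h ` U)) \<pi>"
      unfolding continuous_map_in_subtopology
      using continuous_map_from_subtopology[OF \<pi>c] tE img by auto
    from continuous_map_compose[OF this chart(7)]
    have "continuous_map (subtopology ?E (k ` (J \<times> U))) X (\<lambda>v. inv_into U h (\<pi> v))" by (simp add: o_def)
    ultimately show ?thesis unfolding k'_def by (rule continuous_map_pairedI)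
  qed
  have "homeomorphic_maps ?P (subtopology ?E (k ` (J \<times> U))) k k'"
    unfolding homeomorphic_maps_def
  proof (intro conjI ballI)
    show "continuous_map ?P (subtopology ?E (k ` (J \<times> U))) k"
      unfolding continuous_map_in_subtopology using kc tP by auto
    show "continuous_map (subtopology ?E (k ` (J \<times> U))) ?P k'"
      unfolding continuous_map_in_subtopology using k'c kk tE by auto
    show "k' (k z) = z" if "z \<in> topspace ?P" for z using kk that tP by blast
    show "k (k' v) = v" if "v \<in> topspace (subtopology ?E (k ` (J \<times> U)))" for v
      using that kk tE by auto
  qed
  then show "homeomorphic_map ?P (subtopology ?E (k ` (J \<times> U))) k"
    by (rule homeomorphic_maps_imp_map)
qed

text \<open>This gives \<open>manifold_dim M\<close> its value. Charts come from strips of length 1,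
  on which the open map q is injective.\<close>

lemma (in periodic_map) topological_manifold_M:
  assumes X: "topological_manifold n X"
  shows "topological_manifold (Suc n) M"
  unfolding topological_manifold_def
proof (intro conjI ballI)
  show "Hausdorff_space M" using X Hausdorff_M by (simp add: topological_manifold_def)
  have "second_countable line"
    unfolding line_def using X second_countable_prod_topology second_countable_euclideanreal
    by (auto simp: topological_manifold_def)
  from second_countable_open_map_image[OF continuous_q open_map_q q_image this]
  show "second_countable M" .
  fix z assume "z \<in> topspace M"
  then obtain a where a: "a \<in> topspace line" "z = q a" using q_image by (metis imageE)
  obtain t x where "a = (t, x)" by (rule prod.exhaust)
  with a have tx: "x \<in> topspace X" "z = q (t, x)" by auto
  then obtain U h where U: "x \<in> U" "chart n X (U, h)"
    using X unfolding topological_manifold_def by blast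
  define J where "J = {t - 1/2<..<t + 1/2}"
  define B where "B = J \<times> U"
  define k where "k = (\<lambda>(s, y). (h y)(n := s))"
  have oB: "openin line B"
    unfolding B_def J_def line_def using chartD(1)[OF U(2)] by (simp add: openin_prod_Times_iff)
  have tB: "topspace (subtopology line B) = B" using openin_subset[OF oB] by auto
  have oqB: "openin M (q ` B)" using open_map_q oB by (simp add: open_map_def)
  have tqB: "topspace (subtopology M (q ` B)) = q ` B" using openin_subset[OF oqB] by auto
  have inj: "inj_on q B"
    by (rule inj_on_q[of _ t]) (use chartD(2)[OF U(2)] in \<open>auto simp: B_def J_def\<close>)
  have hq: "homeomorphic_map (subtopology line B) (subtopology M (q ` B)) q"
  proof (rule bijective_open_imp_homeomorphic_map)
    show "continuous_map (subtopology line B) (subtopology M (q ` B)) q"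
      unfolding continuous_map_in_subtopology
      using continuous_map_from_subtopology[OF continuous_q] tB by auto
    show "open_map (subtopology line B) (subtopology M (q ` B)) q"
      by (rule open_map_into_subtopology[OF open_map_from_subtopology[OF open_map_q oB]]) (use tB in auto)
  qed (use tB tqB inj in auto)
  obtain g where g: "homeomorphic_maps (subtopology line B) (subtopology M (q ` B)) q g"
    using hq homeomorphic_map_maps by blast
  then have hg: "homeomorphic_map (subtopology M (q ` B)) (subtopology line B) g"
    using homeomorphic_maps_map by blast
  have gB: "g ` q ` B = B"
    using homeomorphic_imp_surjective_map[OF hg] tB tqB by simp
  have okB: "openin (Euclidean_space (Suc n)) (k ` B)"
    unfolding k_def B_def by (rule homeomorphic_map_cylinder_chart(1)[OF U(2)]) (simp add: J_def)
  have "homeomorphic_map (subtopology line B) (subtopology (Euclidean_space (Suc n)) (k ` B)) k"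
    unfolding k_def B_def line_def by (rule homeomorphic_map_cylinder_chart(2)[OF U(2)]) (simp add: J_def)
  moreover have im: "(k \<circ> g) ` q ` B = k ` B" by (simp only: image_comp[symmetric] gB)
  ultimately have "chart (Suc n) M (q ` B, k \<circ> g)"
    unfolding chart_def prod.case im using oqB okB homeomorphic_map_compose[OF hg] by blast
  moreover have "z \<in> q ` B" using tx U(1) by (auto simp: B_def J_def)
  ultimately show "\<exists>U h. z \<in> U \<and> chart (Suc n) M (U, h)" by blast
qed

section \<open>Open covers from generic thresholds\<close>

text \<open>The exponential law. The set of z whose path maps K into V has as complement the
  projection of a closed set along the compact K, and such projections are closed maps for arbitrary
  Z.\<close>

lemma continuous_map_into_path_space:
  assumes F: "continuous_map (prod_topology Z (top_of_set {0..1::real})) Y (\<lambda>(z, t). F z t)"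
  shows "continuous_map Z (path_space Y) (\<lambda>z. restrict (F z) {0..1})"
proof -
  have path: "restrict (F z) {0..1} \<in> paths Y" if "z \<in> topspace Z" for z
  proof -
    have "continuous_map (top_of_set {0..1}) (prod_topology Z (top_of_set {0..1::real})) (\<lambda>t. (z, t))"
      using that by (simp add: continuous_map_pairedI)
    from continuous_map_compose[OF this F] have "continuous_map (top_of_set {0..1}) Y (F z)"
      by (simp add: o_def)
    then have "continuous_map (top_of_set {0..1}) Y (restrict (F z) {0..1})"
      by (rule continuous_map_eq) auto
    then show ?thesis by (simp add: paths_def pathin_def)
  qed
  have op: "openin Z {z \<in> topspace Z. \<forall>t\<in>K. F z t \<in> V}"
    if K: "compact K" "K \<subseteq> {0..1}" and V: "openin Y V" for K V
  proof -
    let ?P = "prod_topology Z (top_of_set K)"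
    have "continuous_map ?P (prod_topology Z (top_of_set {0..1})) (\<lambda>(z, t). (z, t))"
      unfolding continuous_map_prod_top
      using K(2) by (simp add: continuous_map_in_subtopology subset_iff)
    from continuous_map_compose[OF this F] have "continuous_map ?P Y (\<lambda>(z, t). F z t)"
      by (simp add: o_def case_prod_unfold)
    then have c: "closedin ?P {a \<in> topspace ?P. (\<lambda>(z, t). F z t) a \<in> topspace Y - V}"
      using V by (intro closedin_continuous_map_preimage) auto
    have "compact_space (top_of_set K)" using K(1) by (simp add: compact_space_subtopology)
    then have "closed_map ?P Z fst" by (rule closed_map_fst)
    then have "closedin Z (fst ` {a \<in> topspace ?P. (\<lambda>(z, t). F z t) a \<in> topspace Y - V})"
      using c unfolding closed_map_def by blast
    then have "openin Z (topspace Z - fst ` {a \<in> topspace ?P. (\<lambda>(z, t). F z t) a \<in> topspace Y - V})"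
      by blast
    also have "topspace Z - fst ` {a \<in> topspace ?P. (\<lambda>(z, t). F z t) a \<in> topspace Y - V} =
        {z \<in> topspace Z. \<forall>t\<in>K. F z t \<in> V}"
    proof -
      have "F z t \<in> topspace Y" if "z \<in> topspace Z" "t \<in> K" for z t
        using F that K(2) by (force simp: continuous_map_def)
      then show ?thesis by (force simp: image_iff)
    qed
    finally show ?thesis .
  qed
  show ?thesis
    unfolding path_space_def continuous_on_generated_topo_iff
  proof (intro conjI allI impI)
    fix W assume "W \<in> {{\<gamma> \<in> paths Y. \<gamma> ` K \<subseteq> U} |K U. compact K \<and> K \<subseteq> {0..1} \<and> openin Y U}"
    then obtain K U where KU: "W = {\<gamma> \<in> paths Y. \<gamma> ` K \<subseteq> U}" "compact K" "K \<subseteq> {0..1}" "openin Y U"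
      by blast
    have "(\<lambda>z. restrict (F z) {0..1}) -` W \<inter> topspace Z = {z \<in> topspace Z. \<forall>t\<in>K. F z t \<in> U}"
      using path KU(3) unfolding KU(1) by (auto simp: image_subset_iff subset_iff)
    then show "openin Z ((\<lambda>z. restrict (F z) {0..1}) -` W \<inter> topspace Z)"
      using op[OF KU(2-4)] by simp
  next
    have "topspace (path_space Y) = paths Y" by (rule topspace_path_space)
    then have U: "\<Union>{{\<gamma> \<in> paths Y. \<gamma> ` K \<subseteq> U} |K U. compact K \<and> K \<subseteq> {0..1} \<and> openin Y U} = paths Y"
      by (simp add: path_space_def topology_generated_by_topspace)
    show "(\<lambda>z. restrict (F z) {0..1}) ` topspace Z \<subseteq>
      \<Union>{{\<gamma> \<in> paths Y. \<gamma> ` K \<subseteq> U} |K U. compact K \<and> K \<subseteq> {0..1} \<and> openin Y U}"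
      unfolding U using path by blast
  qed
qed

section \<open>Motion planners on disjoint unions\<close>

definition has_motion_planner :: "'a topology \<Rightarrow> ('a \<times> 'a) set \<Rightarrow> bool" where
  "has_motion_planner Y U \<longleftrightarrow> (\<exists>s. continuous_map (subtopology (prod_topology Y Y) U) (path_space Y) s \<and>
     (\<forall>z\<in>U. path_ends (s z) = z))"

lemma has_motion_planner_subset:
  "has_motion_planner Y U \<Longrightarrow> V \<subseteq> U \<Longrightarrow> has_motion_planner Y V"
  unfolding has_motion_planner_def by (meson continuous_map_from_subtopology_mono subsetD)

text \<open>Any number of disjoint open pieces counts as one set of the cover, since the separate
  planners paste without compatibility conditions.\<close>

lemma has_motion_planner_disjoint_Union:
  assumes op: "\<And>V. V \<in> \<V> \<Longrightarrow> openin (prod_topology Y Y) V"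
    and mp: "\<And>V. V \<in> \<V> \<Longrightarrow> has_motion_planner Y V"
    and dis: "\<And>V W. V \<in> \<V> \<Longrightarrow> W \<in> \<V> \<Longrightarrow> V \<noteq> W \<Longrightarrow> V \<inter> W = {}"
  shows "has_motion_planner Y (\<Union>\<V>)"
proof -
  let ?S = "subtopology (prod_topology Y Y) (\<Union>\<V>)"
  obtain s where s: "\<And>V. V \<in> \<V> \<Longrightarrow> continuous_map (subtopology (prod_topology Y Y) V) (path_space Y) (s V)"
     "\<And>V z. V \<in> \<V> \<Longrightarrow> z \<in> V \<Longrightarrow> path_ends (s V z) = z"
    using mp unfolding has_motion_planner_def by metis
  define g where "g = (\<lambda>z. s (SOME V. V \<in> \<V> \<and> z \<in> V) z)"
  have g: "g z = s V z" if "V \<in> \<V>" "z \<in> V" for V z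
  proof -
    have "(SOME V. V \<in> \<V> \<and> z \<in> V) = V"
      by (rule some_equality) (use that dis in blast)+
    then show ?thesis by (simp add: g_def)
  qed
  have "continuous_map ?S (path_space Y) g"
  proof (rule pasting_lemma[where I = \<V> and T = id and f = s])
    fix V assume V: "V \<in> \<V>"
    show "openin ?S (id V)"
      using op[OF V] V by (auto simp: openin_subtopology)
    have "\<Union>\<V> \<inter> V = V" using V by auto
    then show "continuous_map (subtopology ?S (id V)) (path_space Y) (s V)"
      using s(1)[OF V] by (simp add: subtopology_subtopology)
  next
    fix V W x assume "V \<in> \<V>" "W \<in> \<V>" "x \<in> topspace ?S \<inter> id V \<inter> id W"
    then show "s V x = s W x" using g by (metis IntD1 IntD2 id_apply)
  next
    fix x assume "x \<in> topspace ?S"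
    then show "\<exists>V. V \<in> \<V> \<and> x \<in> id V \<and> g x = s V x" using g by auto
  qed
  moreover have "\<forall>z\<in>\<Union>\<V>. path_ends (g z) = z" using s(2) g by auto
  ultimately show ?thesis unfolding has_motion_planner_def by blast
qed

section \<open>Counting argument for generic thresholds\<close>

lemma card_PiE_prescribed_le:
  fixes a :: "nat \<Rightarrow> nat"
  assumes J: "J \<subseteq> {..<m}"
  shows "card {i \<in> {..<m} \<rightarrow>\<^sub>E {..<K}. \<forall>j\<in>J. i j = a j} \<le> K ^ (m - card J)"
proof -
  let ?A = "{i \<in> {..<m} \<rightarrow>\<^sub>E {..<K}. \<forall>j\<in>J. i j = a j}" and ?B = "({..<m} - J) \<rightarrow>\<^sub>E {..<K}"
  have "inj_on (\<lambda>i. restrict i ({..<m} - J)) ?A"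
  proof (rule inj_onI)
    fix i i' assume ii: "i \<in> ?A" "i' \<in> ?A" "restrict i ({..<m} - J) = restrict i' ({..<m} - J)"
    show "i = i'"
    proof (rule PiE_ext[of i "{..<m}" "\<lambda>_. {..<K}" i'])
      fix l assume l: "l \<in> {..<m}"
      show "i l = i' l"
      proof (cases "l \<in> J")
        case True then show ?thesis using ii by simp
      next
        case False
        then show ?thesis using fun_cong[OF ii(3), of l] l by simp
      qed
    qed (use ii in auto)
  qed
  moreover have "(\<lambda>i. restrict i ({..<m} - J)) ` ?A \<subseteq> ?B" by auto
  ultimately have "card ?A \<le> card ?B"
    by (intro card_inj_on_le) (auto intro!: finite_PiE)
  also have "card ?B = K ^ (m - card J)"
    using J by (simp add: card_PiE card_Diff_subset finite_subset)
  finally show ?thesis .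
qed

text \<open>Thresholds are drawn from a grid with \<open>K\<^sup>m\<close> points. A piece of the cover on which all \<open>f j\<close> vary by
  less than the mesh rules out at most \<open>K\<^sup>m\<^sup>-\<^sup>d\<^sup>-\<^sup>1\<close> of them per set of \<open>d + 1\<close> indices, and there are only
  \<open>O(K\<^sup>d)\<close> pieces, so some grid point survives.\<close>

lemma generic_thresholds:
  fixes f :: "nat \<Rightarrow> 'z \<Rightarrow> real"
  assumes cov: "\<And>K::nat. 1 \<le> K \<Longrightarrow> \<exists>\<S>. finite \<S> \<and> card \<S> \<le> C * K ^ d \<and> Z \<subseteq> \<Union>\<S> \<and>
      (\<forall>S\<in>\<S>. \<forall>x\<in>S \<inter> Z. \<forall>y\<in>S \<inter> Z. \<forall>j<m. \<bar>f j x - f j y\<bar> < 1 / K)"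
  obtains c where "\<And>j. 1 \<le> c j" "\<And>j. j < m \<Longrightarrow> c j < 2"
    "\<And>z J. z \<in> Z \<Longrightarrow> J \<subseteq> {..<m} \<Longrightarrow> card J = Suc d \<Longrightarrow> \<exists>j\<in>J. f j z \<noteq> c j"
proof -
  \<comment> \<open>There are at most 2^m index sets and C * K^d pieces, each pair excluding at most
    K^(m - d - 1) grid points. K just exceeds 2^m * C, so the total stays below K^m.\<close>
  define K where "K = 2 ^ m * C + 1"
  have K: "1 \<le> K" by (simp add: K_def)
  obtain \<S> where S: "finite \<S>" "card \<S> \<le> C * K ^ d" "Z \<subseteq> \<Union>\<S>"
    "\<And>S x y j. S \<in> \<S> \<Longrightarrow> x \<in> S \<inter> Z \<Longrightarrow> y \<in> S \<inter> Z \<Longrightarrow> j < m \<Longrightarrow> \<bar>f j x - f j y\<bar> < 1 / K"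
    using cov[OF K] by meson
  define \<J> where "\<J> = {J. J \<subseteq> {..<m} \<and> card J = Suc d}"
  have finJ: "finite \<J>" and cardJ: "card \<J> \<le> 2 ^ m"
  proof -
    have "\<J> \<subseteq> Pow {..<m}" by (auto simp: \<J>_def)
    then show "finite \<J>" "card \<J> \<le> 2 ^ m"
      using finite_subset[of \<J> "Pow {..<m}"] card_mono[of "Pow {..<m}" \<J>] by (simp_all add: card_Pow)
  qed
  define Q where "Q = {..<m} \<rightarrow>\<^sub>E {..<K}"
  define Bad where "Bad = (\<lambda>J S. {i \<in> Q. \<exists>z\<in>S \<inter> Z. \<forall>j\<in>J. f j z = 1 + real (i j) / real K})"
  have finQ: "finite Q" by (auto simp: Q_def intro!: finite_PiE)
  have cardQ: "card Q = K ^ m" by (simp add: Q_def card_PiE)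
  have bad: "card (Bad J S) \<le> K ^ (m - Suc d)" if J: "J \<in> \<J>" and "S \<in> \<S>" for J S
  proof (cases "Bad J S = {}")
    case False
    then obtain a where a: "a \<in> Bad J S" by blast
    have "Bad J S \<subseteq> {i \<in> {..<m} \<rightarrow>\<^sub>E {..<K}. \<forall>j\<in>J. i j = a j}"
    proof (intro subsetI CollectI conjI ballI)
      fix i assume i: "i \<in> Bad J S"
      then show "i \<in> {..<m} \<rightarrow>\<^sub>E {..<K}" by (simp add: Bad_def Q_def)
      fix j assume j: "j \<in> J"
      \<comment> \<open>f j takes a grid value at y and at z, two points of a piece where it varies
        by less than one mesh width 1 / K. Hence the two grid points agree on J.\<close>
      obtain y z where "y \<in> S \<inter> Z" "z \<in> S \<inter> Z" "f j y = 1 + real (a j) / real K" "f j z = 1 + real (i j) / real K"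
        using a i j by (auto simp: Bad_def)
      moreover have "j < m" using j J by (auto simp: \<J>_def)
      ultimately have "\<bar>real (a j) / K - real (i j) / K\<bar> < 1 / K"
        using S(4)[OF \<open>S \<in> \<S>\<close>] by fastforce
      then have "\<bar>real (a j) - real (i j)\<bar> < 1"
        using K by (simp add: diff_divide_distrib[symmetric] field_simps)
      then show "i j = a j" by linarith
    qed
    then have "card (Bad J S) \<le> card {i \<in> {..<m} \<rightarrow>\<^sub>E {..<K}. \<forall>j\<in>J. i j = a j}"
      using finQ by (intro card_mono) (auto simp: Q_def)
    also have "\<dots> \<le> K ^ (m - card J)"
      using J by (intro card_PiE_prescribed_le) (simp add: \<J>_def)
    finally show ?thesis using J by (simp add: \<J>_def)
  qed simp
  define B where "B = (\<Union>J\<in>\<J>. \<Union>S\<in>\<S>. Bad J S)"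
  have BQ: "B \<subseteq> Q" by (auto simp: B_def Bad_def)
  have "card B < card Q"
  proof (cases "\<J> = {}")
    case True
    then show ?thesis using K by (simp add: B_def cardQ)
  next
    case False
    then obtain J where "J \<subseteq> {..<m}" "card J = Suc d" by (auto simp: \<J>_def)
    then have md: "Suc d \<le> m" using card_mono[of "{..<m}" J] by simp
    have "card B \<le> (\<Sum>J\<in>\<J>. card (\<Union>S\<in>\<S>. Bad J S))"
      unfolding B_def by (rule card_UN_le[OF finJ])
    also have "\<dots> \<le> (\<Sum>J\<in>\<J>. \<Sum>S\<in>\<S>. card (Bad J S))"
      by (intro sum_mono card_UN_le S(1))
    also have "\<dots> \<le> (\<Sum>J\<in>\<J>. \<Sum>S\<in>\<S>. K ^ (m - Suc d))"
      by (intro sum_mono bad)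
    also have "\<dots> = card \<J> * (card \<S> * K ^ (m - Suc d))" by simp
    also have "\<dots> \<le> 2 ^ m * ((C * K ^ d) * K ^ (m - Suc d))"
      by (intro mult_mono cardJ S(2)) auto
    also have "\<dots> = (2 ^ m * C) * K ^ (m - 1)"
      using md by (simp add: power_add[symmetric])
    also have "\<dots> < K * K ^ (m - 1)"
      using K by (simp add: K_def)
    also have "\<dots> = K ^ m" using md by (simp add: power_Suc[symmetric] del: power_Suc)
    finally show ?thesis by (simp add: cardQ)
  qed
  then obtain i where i: "i \<in> Q" "i \<notin> B"
    using BQ by (metis less_irrefl subsetI subset_antisym)
  show thesis
  proof (rule that[of "\<lambda>j. 1 + real (i j) / real K"])
    show "1 + real (i j) / real K < 2" if "j < m" for j
      using i(1) that K by (auto simp: Q_def PiE_iff)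
    show "\<exists>j\<in>J. f j z \<noteq> 1 + real (i j) / real K" if "z \<in> Z" "J \<subseteq> {..<m}" "card J = Suc d" for z J
      using i S(3) that by (auto simp: B_def Bad_def \<J>_def)
  qed simp
qed

lemma openin_less:
  assumes "continuous_map Z euclideanreal f" "continuous_map Z euclideanreal g"
  shows "openin Z {z \<in> topspace Z. f z < g z}"
proof -
  have "continuous_map Z euclideanreal (\<lambda>z. g z - f z)" by (intro continuous_intros assms)
  from openin_continuous_map_preimage[OF this, of "{0<..}"] show ?thesis by simp
qed

lemma openin_finite_Ball:
  assumes "finite A" "\<And>j. j \<in> A \<Longrightarrow> openin Z {z \<in> topspace Z. Q j z}"
  shows "openin Z {z \<in> topspace Z. \<forall>j\<in>A. Q j z}"
  using assms
proof (induction A)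
  case (insert a A)
  have "{z \<in> topspace Z. \<forall>j\<in>insert a A. Q j z} =
    {z \<in> topspace Z. Q a z} \<inter> {z \<in> topspace Z. \<forall>j\<in>A. Q j z}" by auto
  then show ?case using insert by (simp add: openin_Int)
qed simp

text \<open>The \<open>k\<close>-th set consists of the points for which some \<open>k\<close> of the values \<open>\<bar>f j z - c j\<bar>\<close> are
  smaller than all the others. The choice of these \<open>k\<close> indices, together with the signs of the
  remaining differences, splits it into disjoint open pieces.\<close>

lemma motion_planner_cover_of_thresholds:
  fixes f :: "nat \<Rightarrow> 'a \<times> 'a \<Rightarrow> real"
  assumes f: "\<And>j. j < m \<Longrightarrow> continuous_map (prod_topology Y Y) euclideanreal (f j)"
    and gen: "\<And>z J. z \<in> topspace (prod_topology Y Y) \<Longrightarrow> J \<subseteq> {..<m} \<Longrightarrow> card J = Suc d \<Longrightarrow> \<exists>j\<in>J. f j z \<noteq> c j"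
    and cov: "\<And>z. z \<in> topspace (prod_topology Y Y) \<Longrightarrow> \<exists>j<m. f j z < c j"
    and mp: "\<And>j. j < m \<Longrightarrow> has_motion_planner Y {z \<in> topspace (prod_topology Y Y). f j z < c j}"
  shows "motion_planner_cover Y (Suc d)"
proof -
  let ?Z = "prod_topology Y Y"
  define v where "v = (\<lambda>j z. \<bar>f j z - c j\<bar>)"
  have vc: "continuous_map ?Z euclideanreal (v j)" if "j < m" for j
    unfolding v_def by (intro continuous_intros f that)
  define W where "W = (\<lambda>J I. {z \<in> topspace ?Z. (\<forall>j\<in>J. \<forall>l\<in>{..<m} - J. v j z < v l z) \<and>
      (\<forall>l\<in>I. f l z < c l) \<and> (\<forall>l\<in>{..<m} - J - I. c l < f l z)})"
  \<comment> \<open>Nonemptiness of I places every piece in some sublevel set, which is where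
    planners are given.\<close>
  define \<V> where "\<V> = (\<lambda>k. {W J I |J I. J \<subseteq> {..<m} \<and> card J = k \<and> I \<subseteq> {..<m} - J \<and> I \<noteq> {}})"
  have oW: "openin ?Z (W J I)" if JI: "J \<subseteq> {..<m}" "I \<subseteq> {..<m} - J" for J I
  proof -
    have fin: "finite J" "finite I" using JI by (meson finite_Diff finite_lessThan finite_subset)+
    have "openin ?Z {z \<in> topspace ?Z. \<forall>j\<in>J. \<forall>l\<in>{..<m} - J. v j z < v l z}"
      using JI fin by (intro openin_finite_Ball openin_less vc) auto
    moreover have "openin ?Z {z \<in> topspace ?Z. \<forall>l\<in>I. f l z < c l}"
      using JI fin by (intro openin_finite_Ball openin_less f) auto
    moreover have "openin ?Z {z \<in> topspace ?Z. \<forall>l\<in>{..<m} - J - I. c l < f l z}"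
      using JI fin by (intro openin_finite_Ball openin_less f) auto
    moreover have "W J I = {z \<in> topspace ?Z. \<forall>j\<in>J. \<forall>l\<in>{..<m} - J. v j z < v l z} \<inter>
        {z \<in> topspace ?Z. \<forall>l\<in>I. f l z < c l} \<inter> {z \<in> topspace ?Z. \<forall>l\<in>{..<m} - J - I. c l < f l z}"
      by (auto simp: W_def)
    ultimately show ?thesis by (simp add: openin_Int)
  qed
  have disW: "J = J' \<and> I = I'" if "J \<subseteq> {..<m}" "J' \<subseteq> {..<m}" "card J = card J'" "I \<subseteq> {..<m} - J"
    "I' \<subseteq> {..<m} - J'" "z \<in> W J I" "z \<in> W J' I'" for J J' I I' z
  proof -
    have fin: "finite J" "finite J'" using that finite_subset[of _ "{..<m}"] by auto
    have JJ: "J = J'"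
    proof (rule ccontr)
      assume ne: "J \<noteq> J'"
      then have "\<not> J \<subseteq> J'" "\<not> J' \<subseteq> J"
        \<comment> \<open>Of two different sets of equal size each has an index that the other
          lacks, and the corresponding two strict inequalities contradict each other.\<close>
        using card_subset_eq[OF fin(2), of J] card_subset_eq[OF fin(1), of J'] that(3) by auto
      then obtain j l where jl: "j \<in> J" "j \<notin> J'" "l \<in> J'" "l \<notin> J" by blast
      then have "v j z < v l z" "v l z < v j z"
        using that by (auto simp: W_def)
      then show False by simp
    qed
    have "l \<in> I \<longleftrightarrow> l \<in> I'" for l
    proof (cases "l \<in> {..<m} - J")
      case True
      then show ?thesis using that JJ unfolding W_def by (smt (verit) DiffI mem_Collect_eq)
    next
      case False
      then show ?thesis using that JJ by blast
    qed
    then show ?thesis using JJ by auto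
  qed
  have "(\<Union>k<Suc d. \<Union>(\<V> k)) = topspace ?Z"
  proof
    show "(\<Union>k<Suc d. \<Union>(\<V> k)) \<subseteq> topspace ?Z" by (auto simp: \<V>_def W_def)
    show "topspace ?Z \<subseteq> (\<Union>k<Suc d. \<Union>(\<V> k))"
    proof
      fix z assume z: "z \<in> topspace ?Z"
      \<comment> \<open>These are the indices with |f j z - c j| = 0, strictly below all others.
        Genericity allows at most d of them, so the sizes 0, ..., d suffice.\<close>
      define J where "J = {j\<in>{..<m}. f j z = c j}"
      define I where "I = {j\<in>{..<m}. f j z < c j}"
      have finJ: "finite J" by (simp add: J_def)
      have "card J < Suc d"
      proof (rule ccontr)
        assume "\<not> card J < Suc d"
        then obtain J' where J': "J' \<subseteq> J" "card J' = Suc d"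
          using obtain_subset_with_card_n[of "Suc d" J] by (metis not_less)
        then show False using gen[OF z, of J'] by (auto simp: J_def)
      qed
      moreover have "W J I \<in> \<V> (card J)"
      proof -
        have "J \<subseteq> {..<m}" "I \<subseteq> {..<m} - J" "I \<noteq> {}" using cov[OF z] by (auto simp: J_def I_def)
        then show ?thesis unfolding \<V>_def by blast
      qed
      moreover have "z \<in> W J I"
        using z by (auto simp: W_def J_def I_def v_def)
      ultimately show "z \<in> (\<Union>k<Suc d. \<Union>(\<V> k))" by blast
    qed
  qed
  moreover have "openin ?Z (\<Union>(\<V> k)) \<and> has_motion_planner Y (\<Union>(\<V> k))" for k
  proof
    have op: "openin ?Z V" if "V \<in> \<V> k" for V using that oW by (auto simp: \<V>_def)
    then show "openin ?Z (\<Union>(\<V> k))" by blast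
    show "has_motion_planner Y (\<Union>(\<V> k))"
    proof (rule has_motion_planner_disjoint_Union[OF op])
      fix V assume "V \<in> \<V> k"
      then obtain J I l where "V = W J I" "I \<subseteq> {..<m} - J" "l \<in> I" by (auto simp: \<V>_def)
      then have "V \<subseteq> {z \<in> topspace ?Z. f l z < c l}" "l < m" by (auto simp: W_def)
      then show "has_motion_planner Y V" using mp has_motion_planner_subset by blast
    next
      fix V V' assume V: "V \<in> \<V> k" "V' \<in> \<V> k" "V \<noteq> V'"
      show "V \<inter> V' = {}"
      proof (rule ccontr)
        assume "V \<inter> V' \<noteq> {}"
        then obtain z where "z \<in> V" "z \<in> V'" by blast
        moreover obtain J I where JI: "V = W J I" "J \<subseteq> {..<m}" "card J = k" "I \<subseteq> {..<m} - J"
          using V(1) by (auto simp: \<V>_def)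
        moreover obtain J' I' where JI': "V' = W J' I'" "J' \<subseteq> {..<m}" "card J' = k" "I' \<subseteq> {..<m} - J'"
          using V(2) by (auto simp: \<V>_def)
        ultimately have "J = J' \<and> I = I'" by (intro disW[of J J' I I' z]) simp_all
        then show False using V(3) JI(1) JI'(1) by simp
      qed
    qed
  qed
  ultimately show ?thesis
    unfolding motion_planner_cover_def has_motion_planner_def[symmetric]
    by (intro exI[of _ "\<lambda>k. \<Union>(\<V> k)"]) simp
qed

section \<open>Local equivariant planners\<close>

text \<open>Three thirds: contract x to x0, follow the path to y0, and run the contraction of y
  backwards.\<close>

lemma continuous_map_concat_contractions:
  assumes c: "continuous_map (prod_topology (top_of_set {0..1::real}) (subtopology X V)) X (\<lambda>(t, z). c t z)"
    and d: "continuous_map (prod_topology (top_of_set {0..1::real}) (subtopology X W)) X (\<lambda>(t, z). d t z)"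
    and \<sigma>: "pathin X \<sigma>" "\<sigma> 0 = x0" "\<sigma> 1 = y0"
    and VW: "V \<subseteq> topspace X" "W \<subseteq> topspace X"
    and c1: "\<And>z. z \<in> V \<Longrightarrow> c 1 z = x0" and d1: "\<And>z. z \<in> W \<Longrightarrow> d 1 z = y0"
  shows "continuous_map (prod_topology (prod_topology (subtopology X V) (subtopology X W)) (top_of_set {0..1::real})) X
    (\<lambda>((x, y), t). if t \<le> 1/3 then c (3 * t) x else if t \<le> 2/3 then \<sigma> (3 * t - 1) else d (3 - 3 * t) y)"
proof -
  let ?P = "prod_topology (prod_topology (subtopology X V) (subtopology X W)) (top_of_set {0..1::real})"
  have tP: "topspace ?P = (V \<times> W) \<times> {0..1}" using VW by auto
  have f1: "continuous_map ?P (subtopology X V) (\<lambda>z. fst (fst z))"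
    using continuous_map_compose[OF continuous_map_fst continuous_map_fst] by (simp add: o_def)
  have f2: "continuous_map ?P (subtopology X W) (\<lambda>z. snd (fst z))"
    using continuous_map_compose[OF continuous_map_fst continuous_map_snd] by (simp add: o_def)
  have f3: "continuous_map ?P euclideanreal snd"
    using continuous_map_snd continuous_map_into_fulltopology by blast
  have unit: "continuous_map (subtopology ?P S) (top_of_set {0..1}) (\<lambda>z. a * snd z + b)"
    if "\<And>z. z \<in> topspace ?P \<Longrightarrow> z \<in> S \<Longrightarrow> a * snd z + b \<in> {0..1}" for S a b
  proof -
    have "continuous_map ?P euclideanreal (\<lambda>z. a * snd z + b)" by (intro continuous_intros f3)
    then have "continuous_map (subtopology ?P S) euclideanreal (\<lambda>z. a * snd z + b)"
      by (rule continuous_map_from_subtopology)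
    moreover have "(\<lambda>z. a * snd z + b) \<in> topspace (subtopology ?P S) \<rightarrow> {0..1}"
      using that by (simp add: Pi_iff del: topspace_prod_topology)
    ultimately show ?thesis unfolding continuous_map_in_subtopology by (rule conjI)
  qed
  let ?g = "\<lambda>z. if snd z \<le> 2/3 then \<sigma> (3 * snd z - 1) else d (3 - 3 * snd z) (snd (fst z))"
  have "continuous_map ?P X
      (\<lambda>z. if snd z \<le> 1/3 then c (3 * snd z) (fst (fst z)) else ?g z)"
  proof (rule continuous_map_cases_le[OF f3])
    show "continuous_map ?P euclideanreal (\<lambda>z. 1/3)" by simp
    let ?S = "subtopology ?P {z \<in> topspace ?P. snd z \<le> 1/3}"
    have "continuous_map ?S (top_of_set {0..1}) (\<lambda>z. 3 * snd z + 0)"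
      by (rule unit) (auto simp: tP)
    from continuous_map_compose[OF continuous_map_pairedI[OF this continuous_map_from_subtopology[OF f1]] c]
    show "continuous_map ?S X (\<lambda>z. c (3 * snd z) (fst (fst z)))" by (simp add: o_def)
    let ?S' = "subtopology ?P {z \<in> topspace ?P. 1/3 \<le> snd z}"
    have tS': "topspace ?S' = {z \<in> (V \<times> W) \<times> {0..1}. 1/3 \<le> snd z}" using tP by auto
    show "continuous_map ?S' X ?g"
    proof (rule continuous_map_cases_le[OF continuous_map_from_subtopology[OF f3]])
      show "continuous_map ?S' euclideanreal (\<lambda>z. 2/3)" by simp
      let ?T = "subtopology ?S' {z \<in> topspace ?S'. snd z \<le> 2/3}"
      have "continuous_map ?T (top_of_set {0..1}) (\<lambda>z. 3 * snd z + - 1)"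
        unfolding subtopology_subtopology by (rule unit) (auto simp: tP)
      from continuous_map_compose[OF this \<sigma>(1)[unfolded pathin_def]]
      show "continuous_map ?T X (\<lambda>z. \<sigma> (3 * snd z - 1))" by (simp add: o_def)
      let ?T' = "subtopology ?S' {z \<in> topspace ?S'. 2/3 \<le> snd z}"
      have "continuous_map ?T' (top_of_set {0..1}) (\<lambda>z. - 3 * snd z + 3)"
        unfolding subtopology_subtopology by (rule unit) (auto simp: tP)
      moreover have "continuous_map ?T' (subtopology X W) (\<lambda>z. snd (fst z))"
        by (intro continuous_map_from_subtopology f2)
      ultimately have "continuous_map ?T' X (\<lambda>z. d (- 3 * snd z + 3) (snd (fst z)))"
        using continuous_map_compose[OF continuous_map_pairedI d] by (simp add: o_def)
      then show "continuous_map ?T' X (\<lambda>z. d (3 - 3 * snd z) (snd (fst z)))" by simp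
      fix z assume z: "z \<in> topspace ?S'" "snd z = 2/3"
      have "3 * snd z - 1 = 1" "3 - 3 * snd z = 1" "snd (fst z) \<in> W" using z unfolding tS' by auto
      then show "\<sigma> (3 * snd z - 1) = d (3 - 3 * snd z) (snd (fst z))"
        using \<sigma>(3) d1 by (simp only:)
    qed
    fix z assume z: "z \<in> topspace ?P" "snd z = 1/3"
    have "3 * snd z - 1 = 0" "3 * snd z = 1" "snd z \<le> 2/3" "fst (fst z) \<in> V" using z unfolding tP by auto
    then show "c (3 * snd z) (fst (fst z)) = ?g z"
      using \<sigma>(2) c1 by (simp only: if_True)
  qed
  then show ?thesis by (simp add: case_prod_unfold)
qed

lemma funpow_mult_fixed: "(f ^^ j) x = x \<Longrightarrow> (f ^^ (j * k)) x = x"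
  by (induction k) (simp_all add: funpow_add)

text \<open>By Bezout j * a = p * b + 1 for some a and b, so one more application of f after p * b
  of them is a power that fixes x.\<close>

lemma prime_period_fixed:
  assumes p: "prime p" and per: "(f ^^ p) x = x" and j: "0 < j" "j < p" "(f ^^ j) x = x"
  shows "f x = x"
proof -
  have "\<not> p dvd j" using j nat_dvd_not_less by blast
  then have "gcd j p = 1" using prime_imp_coprime[OF p] by (simp add: coprime_commute coprime_iff_gcd_eq_1[symmetric])
  moreover obtain a b where "j * a = p * b + gcd j p" using bezout_nat[of j p] j(1) by auto
  ultimately have ab: "j * a = Suc (p * b)" by simp
  have "f ((f ^^ (p * b)) x) = (f ^^ (j * a)) x" by (simp add: ab)
  then show ?thesis using funpow_mult_fixed[OF per, of b] funpow_mult_fixed[OF j(3), of a] by simp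
qed

text \<open>Upgrades connectedness of X to path-connectedness, which provides the middle third of a
  planner.\<close>

lemma locally_path_connected_manifold:
  assumes X: "topological_manifold n X"
  shows "locally_path_connected_space X"
  unfolding locally_path_connected_space
proof (intro allI impI)
  fix V x assume Vx: "openin X V \<and> x \<in> V"
  then obtain U h where U: "x \<in> U" and ch: "chart n X (U, h)"
    using X openin_subset unfolding topological_manifold_def by blast
  have "locally_path_connected_space (subtopology (Euclidean_space n) (h ` U))"
    using locally_path_connected_space_open_subset[OF locally_path_connected_Euclidean_space chartD(3)[OF ch]] .
  moreover have "subtopology X U homeomorphic_space subtopology (Euclidean_space n) (h ` U)"
    using ch by (auto simp: chart_def dest: homeomorphic_map_imp_homeomorphic_space)
  ultimately have "locally_path_connected_space (subtopology X U)"
    by (simp add: homeomorphic_locally_path_connected_space)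
  moreover have "openin (subtopology X U) (U \<inter> V)" "x \<in> U \<inter> V"
    using Vx U chartD(1)[OF ch] by (auto simp: openin_subtopology)
  ultimately obtain W where W: "openin (subtopology X U) W" "path_connectedin (subtopology X U) W"
    "x \<in> W" "W \<subseteq> U \<inter> V"
    unfolding locally_path_connected_space by blast
  then show "\<exists>W. openin X W \<and> path_connectedin X W \<and> x \<in> W \<and> W \<subseteq> V"
    using openin_trans_full[OF W(1) chartD(1)[OF ch]] by (auto simp: path_connectedin_subtopology)
qed

context periodic_metric
begin

definition ball_at :: "'a \<Rightarrow> real \<Rightarrow> 'a set" where
  "ball_at x r = {y \<in> topspace X. \<rho> x y < r}"

lemma \<rho>_funpow: "x \<in> topspace X \<Longrightarrow> y \<in> topspace X \<Longrightarrow> \<rho> ((\<phi> ^^ j) x) ((\<phi> ^^ j) y) = \<rho> x y"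
  by (induction j) (simp_all add: \<rho>_\<phi> funpow_in)

lemma \<rho>_\<psi>: "x \<in> topspace X \<Longrightarrow> y \<in> topspace X \<Longrightarrow> \<rho> (\<psi> k x) (\<psi> k y) = \<rho> x y"
  by (simp add: \<psi>_def \<rho>_funpow)

lemma \<rho>_cont1: "x \<in> topspace X \<Longrightarrow> continuous_map X euclideanreal (\<rho> x)"
  using continuous_map_compose[OF continuous_map_pairedI[of X X "\<lambda>_. x" X "\<lambda>y. y"] \<rho>_cont] by (simp add: o_def)

lemma ball_at_subset: "ball_at x r \<subseteq> topspace X"
  by (auto simp: ball_at_def)

text \<open>The distance to x attains a positive minimum on the compact complement of U, and this
  minimum serves as the radius.\<close>

lemma open_contains_ball_at:
  assumes U: "openin X U" and x: "x \<in> U"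
  obtains r where "0 < r" "ball_at x r \<subseteq> U"
proof (cases "topspace X - U = {}")
  case True
  then show thesis using that[of 1] by (auto simp: ball_at_def)
next
  case False
  have xX: "x \<in> topspace X" using openin_subset[OF U] x by blast
  have "compactin X (topspace X - U)"
    using compact_X U by (simp add: closedin_compact_space closedin_diff)
  from image_compactin[OF this \<rho>_cont1[OF xX]] have "compact (\<rho> x ` (topspace X - U))" by simp
  then obtain s where s: "s \<in> topspace X - U" "\<And>t. t \<in> topspace X - U \<Longrightarrow> \<rho> x s \<le> \<rho> x t"
    using compact_attains_inf[of "\<rho> x ` (topspace X - U)"] False by auto
  have "\<rho> x s \<noteq> 0" using \<rho>_eq[OF xX] s(1) x by auto
  then have "0 < \<rho> x s" using \<rho>_nonneg[of x s] by simp
  moreover have "ball_at x (\<rho> x s) \<subseteq> U"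
  proof
    fix y assume y: "y \<in> ball_at x (\<rho> x s)"
    then show "y \<in> U" using s(2)[of y] by (force simp: ball_at_def)
  qed
  ultimately show thesis by (rule that)
qed

text \<open>The same power acts on both end points, as it does along simultaneous deck
  transformations. Equivariance is demanded only when the pair returns to the product of balls,
  because the balls need not be invariant.\<close>

definition local_planner :: "'a \<Rightarrow> 'a \<Rightarrow> real \<Rightarrow> ('a \<Rightarrow> 'a \<Rightarrow> real \<Rightarrow> 'a) \<Rightarrow> bool" where
  "local_planner x0 y0 r \<gamma> \<longleftrightarrow> 0 < r \<and>
     continuous_map (prod_topology (prod_topology (subtopology X (ball_at x0 r)) (subtopology X (ball_at y0 r)))
       (top_of_set {0..1})) X (\<lambda>((x, y), t). \<gamma> x y t) \<and>
     (\<forall>x\<in>ball_at x0 r. \<forall>y\<in>ball_at y0 r. \<gamma> x y 0 = x \<and> \<gamma> x y 1 = y) \<and>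
     (\<forall>m. \<forall>x\<in>ball_at x0 r. \<forall>y\<in>ball_at y0 r. \<psi> m x \<in> ball_at x0 r \<longrightarrow> \<psi> m y \<in> ball_at y0 r \<longrightarrow>
        (\<forall>t\<in>{0..1}. \<gamma> (\<psi> m x) (\<psi> m y) t = \<psi> m (\<gamma> x y t)))"

end

lemma (in periodic_metric) exists_local_planner:
  assumes X: "smooth_manifold n X A" and sm: "smooth_map n X A n X A \<phi>"
    and pc: "path_connected_space X" and p: "prime p"
    and fix_conn: "path_connectedin X {x \<in> topspace X. \<phi> x = x}"
    and x0: "x0 \<in> topspace X" and y0: "y0 \<in> topspace X"
  obtains r \<gamma> where "local_planner x0 y0 r \<gamma>"
proof -
  define fixed where "fixed \<longleftrightarrow> \<phi> x0 = x0 \<and> \<phi> y0 = y0"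
  \<comment> \<open>One construction serves both cases: with f = id the contraction and path results
    impose no symmetry, and a small radius replaces it.\<close>
  define f where "f = (if fixed then \<phi> else id)"
  have fs: "smooth_map n X A n X A f" using X sm by (simp add: f_def smooth_manifold_def)
  have fper: "(f ^^ p) x = x" if "x \<in> topspace X" for x using period[OF that] by (simp add: f_def)
  have ffix: "f x0 = x0" "f y0 = y0" by (auto simp: f_def fixed_def)
  obtain V c where V: "openin X V" "x0 \<in> V"
    and c: "continuous_map (prod_topology (top_of_set {0..1::real}) (subtopology X V)) X (\<lambda>(t, z). c t z)"
    and c0: "\<And>z. z \<in> V \<Longrightarrow> c 0 z = z" and c1: "\<And>z. z \<in> V \<Longrightarrow> c 1 z = x0"
    and cf: "\<And>t z. t \<in> {0..1} \<Longrightarrow> z \<in> V \<Longrightarrow> f z \<in> V \<Longrightarrow> c t (f z) = f (c t z)"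
    by (rule equivariant_contraction[OF X fs p_pos fper x0 ffix(1)], assumption, rule that, assumption, assumption, assumption, simp_all)
  obtain W d where W: "openin X W" "y0 \<in> W"
    and d: "continuous_map (prod_topology (top_of_set {0..1::real}) (subtopology X W)) X (\<lambda>(t, z). d t z)"
    and d0: "\<And>z. z \<in> W \<Longrightarrow> d 0 z = z" and d1: "\<And>z. z \<in> W \<Longrightarrow> d 1 z = y0"
    and df: "\<And>t z. t \<in> {0..1} \<Longrightarrow> z \<in> W \<Longrightarrow> f z \<in> W \<Longrightarrow> d t (f z) = f (d t z)"
    by (rule equivariant_contraction[OF X fs p_pos fper y0 ffix(2)], assumption, rule that, assumption, assumption, assumption, simp_all)
  \<comment> \<open>Equivariance in the middle third means that f fixes every point of the path. For
    f = \<open>\<phi>\<close> this uses path-connectedness of the fixed set; for f = id any path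
    will do.\<close>
  have "\<exists>\<sigma>. pathin X \<sigma> \<and> \<sigma> 0 = x0 \<and> \<sigma> 1 = y0 \<and> (\<forall>t\<in>{0..1}. f (\<sigma> t) = \<sigma> t)"
  proof (cases fixed)
    case True
    then have "x0 \<in> {x \<in> topspace X. \<phi> x = x}" "y0 \<in> {x \<in> topspace X. \<phi> x = x}"
      using x0 y0 by (auto simp: fixed_def)
    then obtain \<sigma> where \<sigma>: "pathin X \<sigma>" "\<sigma> \<in> {0..1} \<rightarrow> {x \<in> topspace X. \<phi> x = x}" "\<sigma> 0 = x0" "\<sigma> 1 = y0"
      using fix_conn unfolding path_connectedin by blast
    then show ?thesis using True by (intro exI[of _ \<sigma>]) (auto simp: f_def)
  next
    case False
    then show ?thesis
      using pc x0 y0 unfolding path_connected_space_def by (auto simp: f_def)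
  qed
  then obtain \<sigma> where \<sigma>: "pathin X \<sigma>" "\<sigma> 0 = x0" "\<sigma> 1 = y0" and \<sigma>f: "\<And>t. t \<in> {0..1} \<Longrightarrow> f (\<sigma> t) = \<sigma> t"
    by blast
  define \<gamma> where "\<gamma> = (\<lambda>x y t. if t \<le> 1/3 then c (3 * t) x else if t \<le> 2/3 then \<sigma> (3 * t - 1) else d (3 - 3 * t) y)"
  have \<gamma>f: "\<gamma> (f x) (f y) t = f (\<gamma> x y t)"
    if "x \<in> V" "f x \<in> V" "y \<in> W" "f y \<in> W" "t \<in> {0..1}" for x y t
    using that cf[of "3 * t" x] df[of "3 - 3 * t" y] \<sigma>f[of "3 * t - 1"] by (auto simp: \<gamma>_def)
  define J where "J = {j \<in> {..<p}. \<not> ((\<phi> ^^ j) x0 = x0 \<and> (\<phi> ^^ j) y0 = y0)}"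
  define \<delta> where "\<delta> = (\<lambda>j. max (\<rho> x0 ((\<phi> ^^ j) x0)) (\<rho> y0 ((\<phi> ^^ j) y0)))"
  have \<delta>: "0 < \<delta> j" if "j \<in> J" for j
  proof -
    have "(\<phi> ^^ j) x0 \<noteq> x0 \<or> (\<phi> ^^ j) y0 \<noteq> y0" using that by (simp add: J_def)
    then have "\<rho> x0 ((\<phi> ^^ j) x0) \<noteq> 0 \<or> \<rho> y0 ((\<phi> ^^ j) y0) \<noteq> 0"
      using \<rho>_eq x0 y0 funpow_in by metis
    then show ?thesis
      using \<rho>_nonneg[of x0 "(\<phi> ^^ j) x0"] \<rho>_nonneg[of y0 "(\<phi> ^^ j) y0"] unfolding \<delta>_def by linarith
  qed
  obtain r1 where r1: "0 < r1" "ball_at x0 r1 \<subseteq> V" using open_contains_ball_at[OF V] .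
  obtain r2 where r2: "0 < r2" "ball_at y0 r2 \<subseteq> W" using open_contains_ball_at[OF W] .
  \<comment> \<open>Half of the smallest displacement of the pair by a power that moves it. The
    inserted 1 covers the case without such powers, when both base points are fixed.\<close>
  define r3 where "r3 = Min (insert 1 (\<delta> ` J)) / 2"
  have finJ: "finite J" by (simp add: J_def)
  have r3: "0 < r3" using finJ \<delta> by (simp add: r3_def)
  have r3J: "2 * r3 \<le> \<delta> j" if "j \<in> J" for j using finJ that by (simp add: r3_def)
  define r where "r = min r1 (min r2 r3)"
  have r: "0 < r" "r \<le> r1" "r \<le> r2" "r \<le> r3" using r1(1) r2(1) r3 by (auto simp: r_def)
  have BV: "ball_at x0 r \<subseteq> V" "ball_at y0 r \<subseteq> W" using r1(2) r2(2) r by (force simp: ball_at_def)+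
  have "local_planner x0 y0 r \<gamma>"
    unfolding local_planner_def
  proof (intro conjI ballI allI impI)
    show "0 < r" by (rule r)
    show "\<gamma> x y 0 = x" if "x \<in> ball_at x0 r" for x y
      using that BV c0 by (auto simp: \<gamma>_def)
    show "\<gamma> x y 1 = y" if "y \<in> ball_at y0 r" for x y
      using that BV d0 by (auto simp: \<gamma>_def)
    have "continuous_map (prod_topology (top_of_set {0..1::real}) (subtopology X (ball_at x0 r))) X (\<lambda>(t, z). c t z)"
      "continuous_map (prod_topology (top_of_set {0..1::real}) (subtopology X (ball_at y0 r))) X (\<lambda>(t, z). d t z)"
    proof -
      have mono: "continuous_map (prod_topology (top_of_set {0..1::real}) (subtopology X S))
          (prod_topology (top_of_set {0..1::real}) (subtopology X T)) (\<lambda>z. z)" if "S \<subseteq> T" for S T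
      proof -
        have "continuous_map (subtopology X S) X (\<lambda>z. z)"
          by (rule continuous_map_from_subtopology) simp
        moreover have "(\<lambda>z. z) \<in> topspace (subtopology X S) \<rightarrow> T" using that by auto
        ultimately have "continuous_map (subtopology X S) (subtopology X T) (\<lambda>z. z)"
          unfolding continuous_map_in_subtopology by (rule conjI)
        from continuous_map_pairedI[OF continuous_map_fst continuous_map_compose[OF continuous_map_snd this]]
        show ?thesis by simp
      qed
      show "continuous_map (prod_topology (top_of_set {0..1::real}) (subtopology X (ball_at x0 r))) X (\<lambda>(t, z). c t z)"
        using continuous_map_compose[OF mono[OF BV(1)] c] by (simp add: o_def)
      show "continuous_map (prod_topology (top_of_set {0..1::real}) (subtopology X (ball_at y0 r))) X (\<lambda>(t, z). d t z)"
        using continuous_map_compose[OF mono[OF BV(2)] d] by (simp add: o_def)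
    qed
    from continuous_map_concat_contractions[OF this \<sigma> ball_at_subset ball_at_subset]
    show "continuous_map (prod_topology (prod_topology (subtopology X (ball_at x0 r)) (subtopology X (ball_at y0 r)))
       (top_of_set {0..1})) X (\<lambda>((x, y), t). \<gamma> x y t)"
      using c1 d1 BV unfolding \<gamma>_def by (simp add: subset_iff)
    fix m x y and t :: real
    assume x: "x \<in> ball_at x0 r" and y: "y \<in> ball_at y0 r" and mx: "\<psi> m x \<in> ball_at x0 r"
      and my: "\<psi> m y \<in> ball_at y0 r" and t: "t \<in> {0..1}"
    have xX: "x \<in> topspace X" "y \<in> topspace X" using x y by (auto simp: ball_at_def)
    define j where "j = nat (m mod int p)"
    have jp: "j < p" using p_pos by (simp add: j_def nat_less_iff)
    have \<psi>j: "\<psi> m = \<phi> ^^ j" by (simp add: \<psi>_def j_def)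
    show "\<gamma> (\<psi> m x) (\<psi> m y) t = \<psi> m (\<gamma> x y t)"
    proof (cases fixed)
      case True
      then have f\<phi>: "f = \<phi>" by (simp add: f_def)
      \<comment> \<open>Since \<open>\<phi>\<close> is an isometry, balls around fixed points are
        invariant, so the one-step equivariance can be iterated along the orbit.\<close>
      have inv: "\<phi> z \<in> ball_at w r" if "z \<in> ball_at w r" "\<phi> w = w" "w \<in> topspace X" for z w
        using that \<rho>_\<phi>[of w z] funpow_in[of z 1] by (simp add: ball_at_def)
      have in_ball: "(\<phi> ^^ i) x \<in> ball_at x0 r" "(\<phi> ^^ i) y \<in> ball_at y0 r" for i
        using x y inv x0 y0 True by (induction i) (auto simp: fixed_def)
      have "\<gamma> ((\<phi> ^^ i) x) ((\<phi> ^^ i) y) t = (\<phi> ^^ i) (\<gamma> x y t)" for i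
      proof (induction i)
        case (Suc i)
        have "\<gamma> (\<phi> ((\<phi> ^^ i) x)) (\<phi> ((\<phi> ^^ i) y)) t = \<phi> (\<gamma> ((\<phi> ^^ i) x) ((\<phi> ^^ i) y) t)"
          using \<gamma>f[of "(\<phi> ^^ i) x" "(\<phi> ^^ i) y" t] in_ball[of i] in_ball[of "Suc i"] BV t
          unfolding f\<phi> by auto
        then show ?case using Suc by simp
      qed simp
      then show ?thesis by (simp add: \<psi>j)
    next
      case False
      \<comment> \<open>A power that returns both points to their balls moves each centre by less
        than 2 * r, hence fixes both centres. As p is prime and the pair is not fixed, j =
        0.\<close>
      have "j \<notin> J"
      proof
        assume j: "j \<in> J"
        have "\<rho> z ((\<phi> ^^ j) z) < 2 * r" if "u \<in> ball_at z r" "(\<phi> ^^ j) u \<in> ball_at z r" "z \<in> topspace X" for u z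
        proof -
          have "\<rho> z ((\<phi> ^^ j) z) \<le> \<rho> z ((\<phi> ^^ j) u) + \<rho> ((\<phi> ^^ j) u) ((\<phi> ^^ j) z)" by (rule \<rho>_tri)
          also have "\<rho> ((\<phi> ^^ j) u) ((\<phi> ^^ j) z) = \<rho> z u"
            using that \<rho>_funpow[of u z j] \<rho>_sym by (simp add: ball_at_def)
          finally show ?thesis using that by (simp add: ball_at_def)
        qed
        from this[OF x] this[OF y] have "\<delta> j < 2 * r"
          using mx my x0 y0 by (simp add: \<delta>_def \<psi>j)
        then show False using r3J[OF j] r(4) by linarith
      qed
      then have "(\<phi> ^^ j) x0 = x0" "(\<phi> ^^ j) y0 = y0" using jp by (auto simp: J_def)
      then have "j = 0"
        using prime_period_fixed[OF p period[OF x0], of j] prime_period_fixed[OF p period[OF y0], of j] jp False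
        by (auto simp: fixed_def)
      then show ?thesis by (simp add: \<psi>j)
    qed
  qed
  then show thesis by (rule that)
qed

section \<open>Planners on the mapping torus\<close>

lemma open_map_restrict_image:
  assumes f: "open_map X Y f" and U: "openin X U"
  shows "open_map (subtopology X U) (subtopology Y (f ` U)) f"
  by (rule open_map_into_subtopology[OF open_map_from_subtopology[OF f U]]) auto

context periodic_metric
begin

definition qq :: "(real \<times> 'a) \<times> (real \<times> 'a) \<Rightarrow> (real \<times> 'a) set \<times> (real \<times> 'a) set" where
  "qq = (\<lambda>(a, b). (q a, q b))"

abbreviation LL :: "((real \<times> 'a) \<times> (real \<times> 'a)) topology" where
  "LL \<equiv> prod_topology line line"

abbreviation MM :: "((real \<times> 'a) set \<times> (real \<times> 'a) set) topology" where
  "MM \<equiv> prod_topology M M"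

lemma continuous_qq: "continuous_map LL MM qq"
  unfolding qq_def continuous_map_prod_top by (simp add: continuous_q)

lemma open_map_qq: "open_map LL MM qq"
  unfolding qq_def by (rule open_map_prod[OF open_map_q open_map_q])

lemma qq_image: "qq ` topspace LL = topspace MM"
proof -
  have "qq ` (topspace line \<times> topspace line) = (q ` topspace line) \<times> (q ` topspace line)"
    by (force simp: qq_def)
  then show ?thesis by (simp only: topspace_prod_topology q_image)
qed

text \<open>Only the difference of the real coordinates enters. The function is thus invariant under
  the lifted diagonal flow and lives on R x X x X, of dimension 2n + 1.\<close>

definition lift_dist :: "real \<Rightarrow> 'a \<Rightarrow> 'a \<Rightarrow> (real \<times> 'a) \<times> (real \<times> 'a) \<Rightarrow> real" where
  "lift_dist s0 x0 y0 w = \<bar>fst (snd w) - fst (fst w) - s0\<bar> + \<rho> x0 (snd (fst w)) + \<rho> y0 (snd (snd w))"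

lemma continuous_lift_dist:
  assumes "x0 \<in> topspace X" "y0 \<in> topspace X"
  shows "continuous_map LL euclideanreal (lift_dist s0 x0 y0)"
proof -
  have 1: "continuous_map LL euclideanreal (\<lambda>w. fst (fst w))" "continuous_map LL euclideanreal (\<lambda>w. fst (snd w))"
    "continuous_map LL X (\<lambda>w. snd (fst w))" "continuous_map LL X (\<lambda>w. snd (snd w))"
    using continuous_map_compose[OF continuous_map_fst[of line line] continuous_map_fst[of euclideanreal X, folded line_def]]
      continuous_map_compose[OF continuous_map_snd[of line line] continuous_map_fst[of euclideanreal X, folded line_def]]
      continuous_map_compose[OF continuous_map_fst[of line line] continuous_map_snd[of euclideanreal X, folded line_def]]
      continuous_map_compose[OF continuous_map_snd[of line line] continuous_map_snd[of euclideanreal X, folded line_def]]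
    by (simp_all add: o_def)
  have "continuous_map LL euclideanreal (\<lambda>w. \<rho> x0 (snd (fst w)))"
    "continuous_map LL euclideanreal (\<lambda>w. \<rho> y0 (snd (snd w)))"
    using continuous_map_compose[OF 1(3) \<rho>_cont1[OF assms(1)]] continuous_map_compose[OF 1(4) \<rho>_cont1[OF assms(2)]]
    by (simp_all add: o_def)
  then show ?thesis unfolding lift_dist_def[abs_def] by (intro continuous_intros 1)
qed

definition tube :: "real \<Rightarrow> 'a \<Rightarrow> 'a \<Rightarrow> real \<Rightarrow> ((real \<times> 'a) \<times> (real \<times> 'a)) set" where
  "tube s0 x0 y0 c = {w \<in> topspace LL. lift_dist s0 x0 y0 w < c}"

lemma openin_tube:
  assumes "x0 \<in> topspace X" "y0 \<in> topspace X"
  shows "openin LL (tube s0 x0 y0 c)"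
  using openin_continuous_map_preimage[OF continuous_lift_dist[OF assms], of "{..<c}" s0] by (simp add: tube_def)

lemma tubeD:
  assumes "(a, b) \<in> tube s0 x0 y0 c"
  shows "a \<in> topspace line" "b \<in> topspace line" "\<bar>fst b - fst a - s0\<bar> < c"
    "snd a \<in> ball_at x0 c" "snd b \<in> ball_at y0 c"
proof -
  have ab: "a \<in> topspace line" "b \<in> topspace line"
    and D: "\<bar>fst b - fst a - s0\<bar> + \<rho> x0 (snd a) + \<rho> y0 (snd b) < c"
    using assms unfolding tube_def lift_dist_def by simp_all
  show "a \<in> topspace line" "b \<in> topspace line" by (rule ab)+
  show "\<bar>fst b - fst a - s0\<bar> < c" "snd a \<in> ball_at x0 c" "snd b \<in> ball_at y0 c"
    using ab D \<rho>_nonneg[of x0 "snd a"] \<rho>_nonneg[of y0 "snd b"] by (auto simp: ball_at_def)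
qed

text \<open>Lifts of a point of the image of the tube differ by a simultaneous deck transformation of both
  factors, because the tube has width at most \<open>1\<close> in the \<open>t\<close>-difference; the equivariance of \<open>\<gamma>\<close> then
  makes the path independent of the lift.\<close>

lemma motion_planner_tube:
  assumes lp: "local_planner x0 y0 c \<gamma>" and c: "c \<le> 1/2"
    and x0: "x0 \<in> topspace X" "y0 \<in> topspace X"
  shows "has_motion_planner M (qq ` tube s0 x0 y0 c)"
proof -
  define W where "W = tube s0 x0 y0 c"
  have oW: "openin LL W" unfolding W_def by (rule openin_tube[OF x0])
  have tW: "topspace (subtopology LL W) = W" by (rule topspace_subtopology_subset[OF openin_subset[OF oW]])
  have oQ: "openin MM (qq ` W)" using open_map_qq oW unfolding open_map_def by blast
  have tQ: "topspace (subtopology MM (qq ` W)) = qq ` W" by (rule topspace_subtopology_subset[OF openin_subset[OF oQ]])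
  let ?I = "top_of_set {0..1::real}"
  let ?P = "prod_topology (subtopology LL W) ?I" and ?R = "prod_topology (subtopology MM (qq ` W)) ?I"
  have \<gamma>c: "continuous_map (prod_topology (prod_topology (subtopology X (ball_at x0 c)) (subtopology X (ball_at y0 c))) ?I)
       X (\<lambda>((x, y), t). \<gamma> x y t)"
    and \<gamma>01: "\<And>x y. x \<in> ball_at x0 c \<Longrightarrow> y \<in> ball_at y0 c \<Longrightarrow> \<gamma> x y 0 = x \<and> \<gamma> x y 1 = y"
    and \<gamma>eq: "\<And>m x y t. x \<in> ball_at x0 c \<Longrightarrow> y \<in> ball_at y0 c \<Longrightarrow> \<psi> m x \<in> ball_at x0 c \<Longrightarrow>
       \<psi> m y \<in> ball_at y0 c \<Longrightarrow> t \<in> {0..1} \<Longrightarrow> \<gamma> (\<psi> m x) (\<psi> m y) t = \<psi> m (\<gamma> x y t)"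
    using lp unfolding local_planner_def by blast+
  have \<gamma>X: "\<gamma> x y t \<in> topspace X" if "x \<in> ball_at x0 c" "y \<in> ball_at y0 c" "t \<in> {0..1}" for x y t
    using continuous_map_image_subset_topspace[OF \<gamma>c] that ball_at_subset by force
  define H where "H = (\<lambda>((a, b), t::real). (fst a + t * (fst b - fst a), \<gamma> (snd a) (snd b) t))"
  have Hc: "continuous_map ?P line H"
  proof -
    have f1: "continuous_map ?P line (\<lambda>z. fst (fst z))"
      using continuous_map_compose[OF continuous_map_fst continuous_map_from_subtopology[OF continuous_map_fst]]
      by (simp add: o_def)
    have f2: "continuous_map ?P line (\<lambda>z. snd (fst z))"
      using continuous_map_compose[OF continuous_map_fst continuous_map_from_subtopology[OF continuous_map_snd]]
      by (simp add: o_def)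
    have f3: "continuous_map ?P ?I snd" by (rule continuous_map_snd)
    then have f3': "continuous_map ?P euclideanreal snd" using continuous_map_into_fulltopology by blast
    have g: "continuous_map ?P euclideanreal (\<lambda>z. fst (fst (fst z)))" "continuous_map ?P euclideanreal (\<lambda>z. fst (snd (fst z)))"
      "continuous_map ?P X (\<lambda>z. snd (fst (fst z)))" "continuous_map ?P X (\<lambda>z. snd (snd (fst z)))"
      using continuous_map_compose[OF f1 continuous_map_fst[of euclideanreal X, folded line_def]]
        continuous_map_compose[OF f2 continuous_map_fst[of euclideanreal X, folded line_def]]
        continuous_map_compose[OF f1 continuous_map_snd[of euclideanreal X, folded line_def]]
        continuous_map_compose[OF f2 continuous_map_snd[of euclideanreal X, folded line_def]]
      by (simp_all add: o_def)
    have W: "(fst (fst z), snd (fst z)) \<in> tube s0 x0 y0 c" if "z \<in> topspace ?P" for z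
    proof -
      have "fst z \<in> W" using that unfolding topspace_prod_topology tW by (simp add: mem_Times_iff)
      then show ?thesis by (simp add: W_def)
    qed
    have "(\<lambda>z. snd (fst (fst z))) \<in> topspace ?P \<rightarrow> ball_at x0 c" using tubeD(4)[OF W] by blast
    then have g3: "continuous_map ?P (subtopology X (ball_at x0 c)) (\<lambda>z. snd (fst (fst z)))"
      unfolding continuous_map_in_subtopology using g(3) by blast
    have "(\<lambda>z. snd (snd (fst z))) \<in> topspace ?P \<rightarrow> ball_at y0 c" using tubeD(5)[OF W] by blast
    then have g4: "continuous_map ?P (subtopology X (ball_at y0 c)) (\<lambda>z. snd (snd (fst z)))"
      unfolding continuous_map_in_subtopology using g(4) by blast
    from continuous_map_compose[OF continuous_map_pairedI[OF continuous_map_pairedI[OF g3 g4] f3] \<gamma>c]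
    have "continuous_map ?P X (\<lambda>z. \<gamma> (snd (fst (fst z))) (snd (snd (fst z))) (snd z))" by (simp add: o_def)
    moreover have "continuous_map ?P euclideanreal
        (\<lambda>z. fst (fst (fst z)) + snd z * (fst (snd (fst z)) - fst (fst (fst z))))"
      by (intro continuous_intros g f3')
    ultimately show ?thesis
      unfolding H_def line_def case_prod_unfold by (intro continuous_map_pairedI)
  qed
  have Hin: "H ((a, b), t) \<in> topspace line" if "(a, b) \<in> W" "t \<in> {0..1}" for a b t
    using \<gamma>X tubeD that by (auto simp: H_def W_def)
  have wd: "q (H ((a, b), t)) = q (H ((a', b'), t))"
    if W: "(a, b) \<in> W" "(a', b') \<in> W" and eq: "qq (a, b) = qq (a', b')" and t: "t \<in> {0..1}" for a b a' b' t
  proof -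
    note w = tubeD[OF W(1)[unfolded W_def]] and w' = tubeD[OF W(2)[unfolded W_def]]
    obtain k where k: "a' = shift k a" using q_eq_iff[OF w(1) w'(1)] eq by (auto simp: qq_def)
    obtain l where l: "b' = shift l b" using q_eq_iff[OF w(2) w'(2)] eq by (auto simp: qq_def)
    have fa: "fst a' = fst a + of_int k" "fst b' = fst b + of_int l" using k l by (simp_all add: shift_def)
    have "\<bar>real_of_int l - real_of_int k\<bar> < 1" using w(3) w'(3) c unfolding fa by linarith
    then have lk: "l = k" by linarith
    have sa: "snd a' = \<psi> (- k) (snd a)" "snd b' = \<psi> (- k) (snd b)" using k l lk by (simp_all add: shift_def)
    have "\<gamma> (snd a') (snd b') t = \<psi> (- k) (\<gamma> (snd a) (snd b) t)"
      using \<gamma>eq[OF w(4,5), of "- k" t] w'(4,5) t unfolding sa by blast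
    then have "H ((a', b'), t) = shift k (H ((a, b), t))"
      using fa lk by (simp add: H_def shift_def algebra_simps)
    then show ?thesis using q_shift[OF Hin[OF W(1) t]] by simp
  qed
  \<comment> \<open>The factor [0,1] is included before descending: a product of open maps is open,
    so q after H factors continuously through this map.\<close>
  have quot: "quotient_map ?P ?R (\<lambda>(w, t). (qq w, t))"
  proof (rule continuous_open_imp_quotient_map)
    have "continuous_map (subtopology LL W) (subtopology MM (qq ` W)) qq"
      unfolding continuous_map_in_subtopology
      using continuous_map_from_subtopology[OF continuous_qq] tW by blast
    then show "continuous_map ?P ?R (\<lambda>(w, t). (qq w, t))"
      unfolding continuous_map_prod_top by simp
    have "open_map ?I ?I (\<lambda>t. t)" by (simp add: open_map_def)
    from open_map_prod[OF open_map_restrict_image[OF open_map_qq oW] this]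
    show "open_map ?P ?R (\<lambda>(w, t). (qq w, t))" .
    show "(\<lambda>(w, t). (qq w, t)) ` topspace ?P = topspace ?R"
      unfolding topspace_prod_topology tW tQ by force
  qed
  obtain g where g: "continuous_map ?R M g" "\<And>z. z \<in> topspace ?P \<Longrightarrow> g ((\<lambda>(w, t). (qq w, t)) z) = (q \<circ> H) z"
  proof (rule quotient_map_lift_exists[OF quot continuous_map_compose[OF Hc continuous_q]])
    fix y z assume yz: "y \<in> topspace ?P" "z \<in> topspace ?P" "(\<lambda>(w, t). (qq w, t)) y = (\<lambda>(w, t). (qq w, t)) z"
    obtain a b t a' b' t' where e: "y = ((a, b), t)" "z = ((a', b'), t')" by (metis prod.exhaust)
    have "(a, b) \<in> W" "(a', b') \<in> W" "t \<in> {0..1}" "qq (a, b) = qq (a', b')" "t = t'"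
      using yz unfolding topspace_prod_topology tW e by auto
    then show "(q \<circ> H) y = (q \<circ> H) z" unfolding e o_apply by (metis wd)
  qed blast
  have gW: "g (qq (a, b), t) = q (H ((a, b), t))" if "(a, b) \<in> W" "t \<in> {0..1}" for a b t
    using g(2)[of "((a, b), t)"] that unfolding topspace_prod_topology tW by simp
  have "continuous_map ?R M (\<lambda>(z, t). g (z, t))" using g(1) by simp
  from continuous_map_into_path_space[OF this]
  have "continuous_map (subtopology MM (qq ` W)) (path_space M) (\<lambda>z. restrict (\<lambda>t. g (z, t)) {0..1})" .
  moreover have "path_ends (restrict (\<lambda>t. g (z, t)) {0..1}) = z" if z: "z \<in> qq ` W" for z
  proof -
    obtain a b where ab: "(a, b) \<in> W" "z = qq (a, b)" using z by (metis imageE prod.exhaust)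
    note w = tubeD[OF ab(1)[unfolded W_def]]
    have "g (z, 0) = q a" "g (z, 1) = q b"
      using gW[OF ab(1), of 0] gW[OF ab(1), of 1] \<gamma>01[OF w(4,5)] ab(2) by (simp_all add: H_def)
    then show ?thesis using ab(2) by (simp add: path_ends_def qq_def)
  qed
  ultimately show ?thesis unfolding has_motion_planner_def W_def by blast
qed

text \<open>Plays the role of a distance to the orbit of a base pair. Taking the infimum over all
  lifts makes it a function on M x M whose sublevel sets are images of tubes.\<close>

definition orbit_dist :: "real \<Rightarrow> 'a \<Rightarrow> 'a \<Rightarrow> (real \<times> 'a) set \<times> (real \<times> 'a) set \<Rightarrow> real" where
  "orbit_dist s0 x0 y0 z = Inf {lift_dist s0 x0 y0 w |w. w \<in> topspace LL \<and> qq w = z}"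

lemma lift_dist_nonneg: "0 \<le> lift_dist s0 x0 y0 w"
  using \<rho>_nonneg by (simp add: lift_dist_def)

lemma orbit_dist_le_lift_dist: "w \<in> topspace LL \<Longrightarrow> orbit_dist s0 x0 y0 (qq w) \<le> lift_dist s0 x0 y0 w"
  unfolding orbit_dist_def by (rule cInf_lower) (use lift_dist_nonneg in \<open>auto intro!: bdd_belowI[of _ 0]\<close>)

lemma orbit_dist_less_imp_tube:
  assumes z: "z \<in> topspace MM" and G: "orbit_dist s0 x0 y0 z < c"
  shows "z \<in> qq ` tube s0 x0 y0 c"
proof -
  obtain w0 where "w0 \<in> topspace LL" "qq w0 = z" using z qq_image by (metis imageE)
  then have "{lift_dist s0 x0 y0 w |w. w \<in> topspace LL \<and> qq w = z} \<noteq> {}" by blast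
  from cInf_lessD[OF this G[unfolded orbit_dist_def]] obtain w where "w \<in> topspace LL" "qq w = z" "lift_dist s0 x0 y0 w < c" by blast
  then show ?thesis unfolding tube_def by blast
qed

text \<open>Proximity of lifts modulo simultaneous translation. Three separate bounds of size e
  account for the factor 3 in the following estimates.\<close>

definition close :: "real \<Rightarrow> (real \<times> 'a) \<times> (real \<times> 'a) \<Rightarrow> (real \<times> 'a) \<times> (real \<times> 'a) \<Rightarrow> bool" where
  "close e w v \<longleftrightarrow> \<bar>(fst (snd w) - fst (fst w)) - (fst (snd v) - fst (fst v))\<bar> \<le> e \<and>
     \<rho> (snd (fst w)) (snd (fst v)) \<le> e \<and> \<rho> (snd (snd w)) (snd (snd v)) \<le> e"

lemma close_sym: "close e w v \<Longrightarrow> close e v w"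
  using \<rho>_sym unfolding close_def by (simp add: abs_minus_commute)

text \<open>Every lift of \<open>qq w\<close> arises from w by a pair of deck transformations. The
  same pair applied to v gives a competitor for \<open>qq v\<close>, and \<open>\<rho>\<close> is
  unchanged because the powers of \<open>\<phi>\<close> are isometries.\<close>

lemma orbit_dist_close_le:
  assumes w: "w \<in> topspace LL" and v: "v \<in> topspace LL" and cl: "close e w v"
  shows "orbit_dist s0 x0 y0 (qq v) \<le> orbit_dist s0 x0 y0 (qq w) + 3 * e"
proof -
  let ?A = "{lift_dist s0 x0 y0 u |u. u \<in> topspace LL \<and> qq u = qq w}"
  have "orbit_dist s0 x0 y0 (qq v) - 3 * e \<le> Inf ?A"
  proof (rule cInf_greatest)
    show "?A \<noteq> {}" using w by blast
    fix d assume "d \<in> ?A"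
    then obtain a b where d: "d = lift_dist s0 x0 y0 (a, b)" and ab: "a \<in> topspace line" "b \<in> topspace line"
      and eq: "qq (a, b) = qq w" by auto
    obtain wa wb va vb where e: "w = (wa, wb)" "v = (va, vb)" by (metis prod.exhaust)
    have in_line: "wa \<in> topspace line" "wb \<in> topspace line" "va \<in> topspace line" "vb \<in> topspace line"
      using w v unfolding e by auto
    obtain k where k: "a = shift k wa" using q_eq_iff[OF in_line(1) ab(1)] eq by (auto simp: qq_def e)
    obtain l where l: "b = shift l wb" using q_eq_iff[OF in_line(2) ab(2)] eq by (auto simp: qq_def e)
    define u where "u = (shift k va, shift l vb)"
    have uL: "u \<in> topspace LL" using shift_in in_line by (simp add: u_def)
    have "qq u = qq v" using q_shift in_line by (simp add: u_def e qq_def)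
    then have 1: "orbit_dist s0 x0 y0 (qq v) \<le> lift_dist s0 x0 y0 u" using orbit_dist_le_lift_dist[OF uL] by simp
    have 2: "\<rho> x0 (snd (shift k va)) \<le> \<rho> x0 (snd a) + e"
    proof -
      have "\<rho> (snd a) (snd (shift k va)) = \<rho> (snd wa) (snd va)"
        using \<rho>_\<psi>[of "snd wa" "snd va"] in_line by (auto simp: k shift_def)
      then show ?thesis using \<rho>_tri[of x0 "snd (shift k va)" "snd a"] cl by (simp add: close_def e)
    qed
    have 3: "\<rho> y0 (snd (shift l vb)) \<le> \<rho> y0 (snd b) + e"
    proof -
      have "\<rho> (snd b) (snd (shift l vb)) = \<rho> (snd wb) (snd vb)"
        using \<rho>_\<psi>[of "snd wb" "snd vb"] in_line by (auto simp: l shift_def)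
      then show ?thesis using \<rho>_tri[of y0 "snd (shift l vb)" "snd b"] cl by (simp add: close_def e)
    qed
    have 4: "\<bar>fst (shift l vb) - fst (shift k va) - s0\<bar> \<le> \<bar>fst b - fst a - s0\<bar> + e"
    proof -
      have "\<bar>(fst wb - fst wa) - (fst vb - fst va)\<bar> \<le> e" using cl by (simp add: close_def e)
      then show ?thesis unfolding k l shift_def by simp
    qed
    have "lift_dist s0 x0 y0 u \<le> d + 3 * e" using 2 3 4 by (simp add: lift_dist_def d u_def)
    then show "orbit_dist s0 x0 y0 (qq v) - 3 * e \<le> d" using 1 by simp
  qed
  then show ?thesis by (simp add: orbit_dist_def)
qed

lemma orbit_dist_close:
  assumes "w \<in> topspace LL" "v \<in> topspace LL" "close e w v"
  shows "\<bar>orbit_dist s0 x0 y0 (qq v) - orbit_dist s0 x0 y0 (qq w)\<bar> \<le> 3 * e"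
  using orbit_dist_close_le[OF assms, of s0 x0 y0] orbit_dist_close_le[OF assms(2,1) close_sym[OF assms(3)], of s0 x0 y0] by linarith

lemma continuous_orbit_dist: "continuous_map MM euclideanreal (orbit_dist s0 x0 y0)"
  unfolding continuous_map_def
proof (intro conjI allI impI)
  fix S :: "real set" assume "openin euclideanreal S"
  then have S: "open S" by simp
  show "openin MM {z \<in> topspace MM. orbit_dist s0 x0 y0 z \<in> S}"
  proof (subst openin_subopen, intro ballI)
    fix z assume z: "z \<in> {z \<in> topspace MM. orbit_dist s0 x0 y0 z \<in> S}"
    then obtain w where w: "w \<in> topspace LL" "z = qq w" using qq_image by (metis (no_types, lifting) imageE mem_Collect_eq)
    obtain e where e: "0 < e" "\<And>y. \<bar>y - orbit_dist s0 x0 y0 z\<bar> < e \<Longrightarrow> y \<in> S"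
      using S z unfolding open_dist dist_real_def by blast
    have snds: "snd (fst w) \<in> topspace X" "snd (snd w) \<in> topspace X" using w(1) by auto
    \<comment> \<open>Points of this tube are e / 4 close to w, so the values differ by at most 3 *
      e / 4, which is less than e.\<close>
    define N where "N = tube (fst (snd w) - fst (fst w)) (snd (fst w)) (snd (snd w)) (e / 4)"
    have oN: "openin LL N" unfolding N_def by (rule openin_tube[OF snds])
    have wN: "w \<in> N" using w(1) e(1) by (simp add: N_def tube_def lift_dist_def \<rho>_refl)
    have "qq v \<in> {z \<in> topspace MM. orbit_dist s0 x0 y0 z \<in> S}" if v: "v \<in> N" for v
    proof -
      have vL: "v \<in> topspace LL" using v by (simp only: N_def tube_def mem_Collect_eq)
      have "\<bar>fst (snd v) - fst (fst v) - (fst (snd w) - fst (fst w))\<bar> + \<rho> (snd (fst w)) (snd (fst v)) +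
          \<rho> (snd (snd w)) (snd (snd v)) < e / 4"
        using v by (simp only: N_def tube_def lift_dist_def mem_Collect_eq)
      then have "close (e / 4) w v"
        using \<rho>_nonneg[of "snd (fst w)" "snd (fst v)"] \<rho>_nonneg[of "snd (snd w)" "snd (snd v)"]
        unfolding close_def by linarith
      from orbit_dist_close[OF w(1) vL this, of s0 x0 y0] have "orbit_dist s0 x0 y0 (qq v) \<in> S"
        using e by (intro e(2)) (simp add: w(2))
      then show ?thesis using qq_image vL by blast
    qed
    then show "\<exists>T. openin MM T \<and> z \<in> T \<and> T \<subseteq> {z \<in> topspace MM. orbit_dist s0 x0 y0 z \<in> S}"
      using open_map_qq oN wN w(2) unfolding open_map_def by (intro exI[of _ "qq ` N"]) blast
  qed
qed auto

text \<open>Each factor X contributes n to the exponent and the difference of the real coordinates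
  contributes 1. This is where 2n + 1 replaces the dimension 2n + 2 of M x M.\<close>

lemma covering_number_MM:
  assumes cov: "small_covers X \<rho> C n"
    and K: "1 \<le> (K::nat)"
  obtains \<T> where "finite \<T>" "card \<T> \<le> 3 * C\<^sup>2 * K ^ (2 * n + 1)" "topspace MM \<subseteq> \<Union>\<T>"
    "\<forall>T\<in>\<T>. \<forall>y\<in>T. \<forall>z\<in>T. \<exists>w v. w \<in> topspace LL \<and> v \<in> topspace LL \<and> y = qq w \<and> z = qq v \<and> close (1 / K) w v"
proof -
  obtain \<S> where S: "finite \<S>" "card \<S> \<le> C * K ^ n" "topspace X \<subseteq> \<Union>\<S>"
    and S4: "\<And>S y z. S \<in> \<S> \<Longrightarrow> y \<in> S \<Longrightarrow> z \<in> S \<Longrightarrow> \<rho> y z \<le> 1 / K"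
    using cov K unfolding small_covers_def by meson
  define P where "P = (\<lambda>(i::int, S, S'). {w \<in> topspace LL. \<lfloor>(fst (snd w) - fst (fst w)) * K\<rfloor> = i \<and>
     snd (fst w) \<in> S \<and> snd (snd w) \<in> S'})"
  define I where "I = {- int K..int K - 1} \<times> (\<S> \<times> \<S>)"
  have finI: "finite I" using S(1) by (simp add: I_def)
  show thesis
  proof (rule that[of "(\<lambda>i. qq ` P i) ` I"])
    show "finite ((\<lambda>i. qq ` P i) ` I)" using finI by simp
    have "card ((\<lambda>i. qq ` P i) ` I) \<le> card I" by (rule card_image_le[OF finI])
    also have "\<dots> = (2 * K) * (card \<S> * card \<S>)"
    proof -
      have "card {- int K..int K - 1} = 2 * K" by simp
      then show ?thesis by (simp only: I_def card_cartesian_product)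
    qed
    also have "\<dots> \<le> (3 * K) * ((C * K ^ n) * (C * K ^ n))" using S(2) by (intro mult_mono) auto
    also have "\<dots> = 3 * C\<^sup>2 * K ^ (2 * n + 1)" by (simp add: power_add power2_eq_square mult_2)
    finally show "card ((\<lambda>i. qq ` P i) ` I) \<le> 3 * C\<^sup>2 * K ^ (2 * n + 1)" .
    show "topspace MM \<subseteq> \<Union>((\<lambda>i. qq ` P i) ` I)"
    proof
      fix z assume "z \<in> topspace MM"
      then obtain w where w: "w \<in> topspace LL" "z = qq w" using qq_image by (metis imageE)
      obtain a b where "w = (a, b)" by (rule prod.exhaust)
      with w have ab: "a \<in> topspace line" "b \<in> topspace line" "z = (q a, q b)" by (auto simp: qq_def)
      \<comment> \<open>Both lifts are moved into the fundamental domain, so their real coordinates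
        differ by less than 1. Multiplied by K, the difference has only 2 * K possible integer
        parts.\<close>
      define a' where "a' = shift (- \<lfloor>fst a\<rfloor>) a"
      define b' where "b' = shift (- \<lfloor>fst b\<rfloor>) b"
      have r: "a' \<in> {0..<1} \<times> topspace X" "b' \<in> {0..<1} \<times> topspace X"
        using representative ab by (simp_all only: a'_def b'_def)
      have z: "z = qq (a', b')" using q_shift ab by (simp add: qq_def a'_def b'_def)
      obtain S where SS: "S \<in> \<S>" "snd a' \<in> S" using r(1) S(3) by (metis UnionE mem_Times_iff subsetD)
      obtain S' where SS': "S' \<in> \<S>" "snd b' \<in> S'" using r(2) S(3) by (metis UnionE mem_Times_iff subsetD)
      define i where "i = \<lfloor>(fst b' - fst a') * K\<rfloor>"
      have "- 1 < fst b' - fst a'" "fst b' - fst a' < 1" using r by auto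
      then have "(- 1) * real K < (fst b' - fst a') * K" "(fst b' - fst a') * K < 1 * real K"
        using K by (intro mult_strict_right_mono; simp)+
      then have "- int K \<le> i" "i < int K" unfolding i_def le_floor_iff floor_less_iff by simp_all
      then have "i \<in> {- int K..int K - 1}" by simp
      moreover have "(a', b') \<in> P (i, S, S')" using SS SS' r by (auto simp: P_def i_def)
      ultimately show "z \<in> \<Union>((\<lambda>i. qq ` P i) ` I)"
        using SS(1) SS'(1) z unfolding I_def by (intro UnionI[of "qq ` P (i, S, S')"]) auto
    qed
    show "\<forall>T\<in>(\<lambda>i. qq ` P i) ` I. \<forall>y\<in>T. \<forall>z\<in>T.
       \<exists>w v. w \<in> topspace LL \<and> v \<in> topspace LL \<and> y = qq w \<and> z = qq v \<and> close (1 / K) w v"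
    proof (intro ballI)
      fix T y z assume "T \<in> (\<lambda>i. qq ` P i) ` I" "y \<in> T" "z \<in> T"
      then obtain i S S' w v where i: "S \<in> \<S>" "S' \<in> \<S>" and wv: "w \<in> P (i, S, S')" "v \<in> P (i, S, S')" "y = qq w" "z = qq v"
        by (auto simp: I_def)
      have "close (1 / K) w v"
        unfolding close_def
      proof (intro conjI)
        have "\<lfloor>(fst (snd w) - fst (fst w)) * K\<rfloor> = \<lfloor>(fst (snd v) - fst (fst v)) * K\<rfloor>" using wv by (simp add: P_def)
        then have "\<bar>(fst (snd w) - fst (fst w)) * K - (fst (snd v) - fst (fst v)) * K\<bar> < 1" by linarith
        then have "\<bar>(fst (snd w) - fst (fst w)) - (fst (snd v) - fst (fst v))\<bar> * K < 1"
          unfolding left_diff_distrib[symmetric] abs_mult by simp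
        then show "\<bar>(fst (snd w) - fst (fst w)) - (fst (snd v) - fst (fst v))\<bar> \<le> 1 / K"
          using K by (simp add: field_simps)
        show "\<rho> (snd (fst w)) (snd (fst v)) \<le> 1 / K" "\<rho> (snd (snd w)) (snd (snd v)) \<le> 1 / K"
          using wv S4 i by (auto simp: P_def)
      qed
      then show "\<exists>w v. w \<in> topspace LL \<and> v \<in> topspace LL \<and> y = qq w \<and> z = qq v \<and> close (1 / K) w v"
        using wv unfolding P_def prod.case by blast
    qed
  qed
qed

lemma local_planner_mono:
  assumes lp: "local_planner x0 y0 r \<gamma>" and c: "0 < c" "c \<le> r"
  shows "local_planner x0 y0 c \<gamma>"
proof -
  have sub: "ball_at x c \<subseteq> ball_at x r" for x using c(2) by (auto simp: ball_at_def)
  have eq: "subtopology X (ball_at x c) = subtopology (subtopology X (ball_at x r)) (ball_at x c)" for x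
    using sub[of x] by (simp add: subtopology_subtopology Int_absorb1)
  have "continuous_map (subtopology X (ball_at x c)) (subtopology X (ball_at x r)) (\<lambda>y. y)" for x
    unfolding eq[of x] by (rule continuous_map_from_subtopology) simp
  then have "continuous_map (prod_topology (prod_topology (subtopology X (ball_at x0 c)) (subtopology X (ball_at y0 c))) (top_of_set {0..1::real}))
      (prod_topology (prod_topology (subtopology X (ball_at x0 r)) (subtopology X (ball_at y0 r))) (top_of_set {0..1}))
      (\<lambda>(z, t). ((\<lambda>(x, y). (x, y)) z, t))"
    unfolding continuous_map_prod_top by simp
  then have "continuous_map (prod_topology (prod_topology (subtopology X (ball_at x0 c)) (subtopology X (ball_at y0 c))) (top_of_set {0..1::real}))
      (prod_topology (prod_topology (subtopology X (ball_at x0 r)) (subtopology X (ball_at y0 r))) (top_of_set {0..1})) (\<lambda>z. z)"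
    by (simp add: case_prod_unfold)
  from continuous_map_compose[OF this] lp
  have "continuous_map (prod_topology (prod_topology (subtopology X (ball_at x0 c)) (subtopology X (ball_at y0 c))) (top_of_set {0..1::real})) X
      (\<lambda>((x, y), t). \<gamma> x y t)"
    unfolding local_planner_def o_def by blast
  then show ?thesis
    using lp c(1) sub unfolding local_planner_def by (meson subsetD)
qed

text \<open>Sublevel sets at c / 2 already cover, while planners exist on those at c. The generic
  thresholds are chosen in the gap between the two levels.\<close>

lemma motion_planner_cover_M:
  assumes lp: "\<And>x0 y0. x0 \<in> topspace X \<Longrightarrow> y0 \<in> topspace X \<Longrightarrow> \<exists>r \<gamma>. local_planner x0 y0 r \<gamma>"
    and cov: "small_covers X \<rho> C n"
  shows "motion_planner_cover M (2 * n + 2)"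
proof -
  define good where "good = (\<lambda>f c. \<exists>s0 x0 y0. x0 \<in> topspace X \<and> y0 \<in> topspace X \<and> 0 < c \<and>
     f = orbit_dist s0 x0 y0 \<and> has_motion_planner M (qq ` tube s0 x0 y0 c))"
  have "\<exists>f c. good f c \<and> f z < c / 2" if z: "z \<in> topspace MM" for z
  proof -
    obtain w where w: "w \<in> topspace LL" "z = qq w" using z qq_image by (metis imageE)
    have snds: "snd (fst w) \<in> topspace X" "snd (snd w) \<in> topspace X" using w(1) by auto
    obtain r \<gamma> where r: "local_planner (snd (fst w)) (snd (snd w)) r \<gamma>" using lp[OF snds] by blast
    define c where "c = min r (1/2)"
    have c: "0 < c" "c \<le> r" "c \<le> 1/2" using r by (auto simp: c_def local_planner_def)
    define s0 where "s0 = fst (snd w) - fst (fst w)"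
    have "good (orbit_dist s0 (snd (fst w)) (snd (snd w))) c"
      unfolding good_def using motion_planner_tube[OF local_planner_mono[OF r c(1,2)] c(3) snds] snds c(1) by blast
    moreover have "orbit_dist s0 (snd (fst w)) (snd (snd w)) z < c / 2"
      using orbit_dist_le_lift_dist[OF w(1), of s0 "snd (fst w)" "snd (snd w)"] c(1) w(2) by (simp add: lift_dist_def s0_def \<rho>_refl)
    ultimately show ?thesis by blast
  qed
  then obtain f c where fc: "\<And>z. z \<in> topspace MM \<Longrightarrow> good (f z) (c z)" "\<And>z. z \<in> topspace MM \<Longrightarrow> f z z < c z / 2"
    by metis
  have fcont: "continuous_map MM euclideanreal (f z)" if "z \<in> topspace MM" for z
    using fc(1)[OF that] continuous_orbit_dist by (auto simp: good_def)
  have "compact_space MM" using compact_M[OF compact_X] by (simp add: compact_space_prod_topology)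
  moreover have "openin MM {y \<in> topspace MM. f z y < c z / 2} \<and> z \<in> {y \<in> topspace MM. f z y < c z / 2}"
    if "z \<in> topspace MM" for z
    using openin_continuous_map_preimage[OF fcont[OF that], of "{..<c z / 2}"] fc(2)[OF that] that by simp
  ultimately obtain T where T: "finite T" "T \<subseteq> topspace MM"
    "topspace MM \<subseteq> (\<Union>z\<in>T. {y \<in> topspace MM. f z y < c z / 2})"
    using compact_space_finite_cover[of MM "\<lambda>z. {y \<in> topspace MM. f z y < c z / 2}"] by blast
  obtain m and \<tau> :: "nat \<Rightarrow> _" where \<tau>: "T = \<tau> ` {..<m}" using finite_imp_nat_seg_image_inj_on[OF T(1)]
    by (metis lessThan_def)
  have \<tau>T: "\<tau> j \<in> topspace MM" if "j < m" for j using that T(2) \<tau> by blast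
  \<comment> \<open>Rescaling moves every gap to the interval from 1 to 2, the range from which
    \<open>generic_thresholds\<close> draws.\<close>
  define F where "F = (\<lambda>j z. 2 / c (\<tau> j) * f (\<tau> j) z)"
  have cpos: "0 < c (\<tau> j)" if "j < m" for j using fc(1)[OF \<tau>T[OF that]] by (auto simp: good_def)
  \<comment> \<open>On e-close pairs \<open>F j\<close> varies by at most (2 / c) * 3 * e. With E
    above every 6 / c, the mesh e = 1 / (K * E) keeps this below 1 / K, and the power of E is
    absorbed into the constant.\<close>
  define E where "E = (\<Sum>j<m. nat \<lceil>6 / c (\<tau> j)\<rceil>) + 1"
  have E: "6 / c (\<tau> j) < E" if "j < m" for j
  proof -
    have "nat \<lceil>6 / c (\<tau> j)\<rceil> \<le> (\<Sum>j<m. nat \<lceil>6 / c (\<tau> j)\<rceil>)" using that by (intro member_le_sum) auto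
    then show ?thesis unfolding E_def by linarith
  qed
  have Evar: "\<exists>\<S>. finite \<S> \<and> card \<S> \<le> (3 * C\<^sup>2 * E ^ (2 * n + 1)) * K ^ (2 * n + 1) \<and> topspace MM \<subseteq> \<Union>\<S> \<and>
      (\<forall>S\<in>\<S>. \<forall>x\<in>S \<inter> topspace MM. \<forall>y\<in>S \<inter> topspace MM. \<forall>j<m. \<bar>F j x - F j y\<bar> < 1 / K)" if K: "1 \<le> K" for K :: nat
  proof -
    have KE: "1 \<le> K * E" using K by (simp add: E_def)
    obtain \<T> where T: "finite \<T>" "card \<T> \<le> 3 * C\<^sup>2 * (K * E) ^ (2 * n + 1)" "topspace MM \<subseteq> \<Union>\<T>"
      and T4: "\<forall>T\<in>\<T>. \<forall>y\<in>T. \<forall>z\<in>T. \<exists>w v. w \<in> topspace LL \<and> v \<in> topspace LL \<and> y = qq w \<and> z = qq v \<and> close (1 / (K * E)) w v"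
      by (rule covering_number_MM[OF cov KE])
    have small: "\<bar>F j x - F j y\<bar> < 1 / K" if S: "S \<in> \<T>" "x \<in> S" "y \<in> S" and j: "j < m" for S x y j
    proof -
      obtain w v where wv: "w \<in> topspace LL" "v \<in> topspace LL" "x = qq w" "y = qq v" "close (1 / (K * E)) w v"
        using T4 S by blast
      obtain s0 x0 y0 where G: "f (\<tau> j) = orbit_dist s0 x0 y0" using fc(1)[OF \<tau>T[OF j]] by (auto simp: good_def)
      have "\<bar>f (\<tau> j) x - f (\<tau> j) y\<bar> \<le> 3 * (1 / (K * E))"
        using orbit_dist_close[OF wv(2,1) close_sym[OF wv(5)], of s0 x0 y0] wv(3,4) G by simp
      then have "2 / c (\<tau> j) * \<bar>f (\<tau> j) x - f (\<tau> j) y\<bar> \<le> 2 / c (\<tau> j) * (3 * (1 / (K * E)))"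
        using cpos[OF j] by (intro mult_left_mono) auto
      also have "\<dots> = (6 / c (\<tau> j)) / (K * E)" by simp
      also have "\<dots> < E / (K * E)" using E[OF j] KE by (intro divide_strict_right_mono) auto
      also have "\<dots> = 1 / K" using KE by simp
      finally have "2 / c (\<tau> j) * \<bar>f (\<tau> j) x - f (\<tau> j) y\<bar> < 1 / K" .
      moreover have "\<bar>F j x - F j y\<bar> = 2 / c (\<tau> j) * \<bar>f (\<tau> j) x - f (\<tau> j) y\<bar>"
        unfolding F_def right_diff_distrib[symmetric] abs_mult using cpos[OF j] by simp
      ultimately show ?thesis by simp
    qed
    show ?thesis
    proof (intro exI[of _ \<T>] conjI)
      show "card \<T> \<le> 3 * C\<^sup>2 * E ^ (2 * n + 1) * K ^ (2 * n + 1)"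
        using T(2) by (simp add: power_mult_distrib mult_ac)
    qed (use T small in blast)+
  qed
  obtain cc where cc: "\<And>j. 1 \<le> cc j" "\<And>j. j < m \<Longrightarrow> cc j < (2::real)"
    "\<And>z J. z \<in> topspace MM \<Longrightarrow> J \<subseteq> {..<m} \<Longrightarrow> card J = Suc (2 * n + 1) \<Longrightarrow> \<exists>j\<in>J. F j z \<noteq> cc j"
    using generic_thresholds[OF Evar] by blast
  have "motion_planner_cover M (Suc (2 * n + 1))"
  proof (rule motion_planner_cover_of_thresholds[of m M F _ cc])
    show "continuous_map MM euclideanreal (F j)" if "j < m" for j
      unfolding F_def by (intro continuous_intros fcont \<tau>T that)
    show "\<exists>j<m. F j z < cc j" if z: "z \<in> topspace MM" for z
    proof -
      obtain j where j: "j < m" "f (\<tau> j) z < c (\<tau> j) / 2" using T(3) z \<tau> by blast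
      then have "F j z < 1" using cpos[OF j(1)] by (simp add: F_def field_simps)
      then show ?thesis using cc(1)[of j] j(1) by (intro exI[of _ j]) simp
    qed
    show "has_motion_planner M {z \<in> topspace MM. F j z < cc j}" if j: "j < m" for j
    proof -
      obtain s0 x0 y0 where G: "f (\<tau> j) = orbit_dist s0 x0 y0" "has_motion_planner M (qq ` tube s0 x0 y0 (c (\<tau> j)))"
        using fc(1)[OF \<tau>T[OF j]] by (auto simp: good_def)
      have "{z \<in> topspace MM. F j z < cc j} \<subseteq> qq ` tube s0 x0 y0 (c (\<tau> j))"
      proof
        fix z assume z: "z \<in> {z \<in> topspace MM. F j z < cc j}"
        then have "F j z < 2" using cc(2)[OF j] by simp
        then have "orbit_dist s0 x0 y0 z < c (\<tau> j)" using cpos[OF j] by (simp add: F_def G(1) field_simps)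
        then show "z \<in> qq ` tube s0 x0 y0 (c (\<tau> j))" using orbit_dist_less_imp_tube z by blast
      qed
      then show ?thesis using has_motion_planner_subset[OF G(2)] by blast
    qed
  qed (use cc(3) in blast)
  then show ?thesis by simp
qed

end

theorem corollary5p7:
  fixes X :: "'a topology"
    and A :: "('a set \<times> ('a \<Rightarrow> nat \<Rightarrow> real)) set"
    and n p :: nat
    and \<phi> :: "'a \<Rightarrow> 'a"
  assumes "closed_smooth_manifold n X A"
    and "connected_space X"
    and "diffeomorphism n X A n X A \<phi>"
    and "prime p"
    and "\<And>x. x \<in> topspace X \<Longrightarrow> (\<phi> ^^ p) x = x"
    and "path_connectedin X {x \<in> topspace X. \<phi> x = x}"
  shows "TC (mapping_torus X \<phi>) \<le> enat (2 * manifold_dim (mapping_torus X \<phi>))"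
proof -
  have Xs: "smooth_manifold n X A" and Xc: "compact_space X"
    using assms(1) by (auto simp: closed_smooth_manifold_def)
  have sm: "smooth_map n X A n X A \<phi>" using assms(3) by (simp add: diffeomorphism_def)
  have p: "0 < p" using assms(4) by (rule prime_gt_0_nat)
  obtain \<rho> C where "periodic_metric X \<phi> p \<rho>" and cov: "small_covers X \<rho> C n"
    using invariant_metric[OF assms(1) sm assms(5) p] by blast
  then interpret periodic_metric X \<phi> p \<rho> by simp
  show ?thesis
  \<comment> \<open>An empty M has no well-determined dimension, but then zero sets cover M x M and
    the bound holds for any value of it.\<close>
  proof (cases "topspace X = {}")
    case True
    then have M: "topspace M = {}" unfolding q_image_unit[symmetric] by blast
    have "motion_planner_cover M 0"
      unfolding motion_planner_cover_def topspace_prod_topology M by simp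
    then have "TC M \<le> enat 0" unfolding TC_def by (intro Inf_lower) blast
    then show ?thesis by (simp add: enat_0)
  next
    case False
    then have "topspace M \<noteq> {}" unfolding q_image_unit[symmetric] by force
    moreover have "topological_manifold (Suc n) M"
      using topological_manifold_M Xs by (simp add: smooth_manifold_def)
    ultimately have dim: "manifold_dim M = Suc n" by (simp add: manifold_dim_eq)
    have pc: "path_connected_space X"
      using locally_path_connected_manifold[of n X] Xs assms(2)
      by (simp add: smooth_manifold_def path_connected_eq_connected_space)
    have lp: "\<exists>r \<gamma>. local_planner x0 y0 r \<gamma>" if "x0 \<in> topspace X" "y0 \<in> topspace X" for x0 y0
      using exists_local_planner[OF Xs sm pc assms(4,6) that] by blast
    have "motion_planner_cover M (2 * n + 2)" by (rule motion_planner_cover_M[OF lp cov])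
    then have "TC M \<le> enat (2 * n + 2)" unfolding TC_def by (intro Inf_lower) blast
    then show ?thesis by (simp add: dim)
  qed
qed

end
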